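(* Let $M$ be a compact manifold (with Riemannian metric $g$), let $\psi : M \to \mathbb{S}^n(\tfrac{1}{\sqrt2})\times\{\tfrac{1}{\sqrt2}\}$ be a nonconstant harmonic map, and let $\mathbf{i} : \mathbb{S}^n(\tfrac{1}{\sqrt2})\times\{\tfrac{1}{\sqrt2}\} \to \mathbb{S}^{n+1}$ be the inclusion map. Then $\phi = \mathbf{i}\circ\psi : M \to \mathbb{S}^{n+1}$ is nonharmonic biharmonic if and only if the energy density $e(\psi)$ is constant.
   Context: All manifolds and maps are smooth. $\mathbb{S}^k(r)\subset\mathbb{R}^{k+1}$ is the sphere of radius $r$ centred at the origin with the induced metric, and $\mathbb{S}^k=\mathbb{S}^k(1)$; $\mathbb{S}^n(\tfrac1{\sqrt2})\times\{\tfrac1{\sqrt2}\}=\{(x,\tfrac1{\sqrt2})\in\mathbb{R}^{n+1}\times\mathbb{R}: |x|=\tfrac1{\sqrt2}\}\subset\mathbb{S}^{n+1}$. For a map $\phi:(M,g)\to(N,h)$ between Riemannian manifolds, the energy density is $e(\phi)=\tfrac12|d\phi|^2$, the tension field is $\tau(\phi)=\mathrm{trace}\,\nabla d\phi$, and $\phi$ is harmonic if $\tau(\phi)=0$. The map $\phi$ is biharmonic if it is a critical point of the bienergy $E^2(\phi)=\tfrac12\int_M|\tau(\phi)|^2v_g$, equivalently if $$\tau^2(\phi)=-\Delta^\phi(\tau(\phi))-\mathrm{trace}\,R^N(d\phi,\tau(\phi))d\phi=0,$$ where $\Delta^\phi=-\mathrm{trace}_g(\nabla^\phi\nabla^\phi-\nabla^\phi_{\nabla})$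 is the Laplacian on sections of $\phi^{-1}TN$ and $R^N(X,Y)Z=[\nabla^N_X,\nabla^N_Y]Z-\nabla^N_{[X,Y]}Z$.
   Formalization: The compact manifold M is assumed connected; otherwise the claim fails, e.g. for a map taking two different constant values on two components, which is nonconstant harmonic with e(ψ)=0 while i∘ψ is harmonic. *)

theory Defs
  imports "HOL-Analysis.Analysis"
begin

section \<open>Smooth maps between open subsets of Euclidean spaces\<close>

abbreviation fderiv :: "('a::euclidean_space \<Rightarrow> 'b::euclidean_space) \<Rightarrow> 'a \<Rightarrow> 'a \<Rightarrow> 'b"
  where "fderiv f x \<equiv> frechet_derivative f (at x)"

text \<open>Only meant for open \<open>S\<close>: the derivatives are taken in the ambient space.\<close>

primrec Ck_on :: "nat \<Rightarrow> 'a::euclidean_space set \<Rightarrow> ('a \<Rightarrow> 'b::euclidean_space) \<Rightarrow> bool" where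
  "Ck_on 0 S f \<longleftrightarrow> continuous_on S f"
| "Ck_on (Suc k) S f \<longleftrightarrow>
     (\<forall>x\<in>S. f differentiable (at x)) \<and> (\<forall>v. Ck_on k S (\<lambda>x. fderiv f x v))"

definition smooth_on :: "'a::euclidean_space set \<Rightarrow> ('a \<Rightarrow> 'b::euclidean_space) \<Rightarrow> bool"
  where "smooth_on S f \<longleftrightarrow> (\<forall>k. Ck_on k S f)"


section \<open>Riemannian geometry in one coordinate chart\<close>

text \<open>
  Let \<open>G\<close> be a Riemannian metric on an open subset of \<open>'e\<close>, so that \<open>G x\<close> is an inner product on the
  tangent space \<open>'e\<close> at \<open>x\<close>. Vector fields are functions \<open>'e \<Rightarrow> 'e\<close>; the constant ones
  \<open>\<lambda>_. u\<close> have constant coefficients in the coordinate frame.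
  All operators below depend only on the germs of their arguments at the point of evaluation.
\<close>

type_synonym 'e coord_metric = "'e \<Rightarrow> 'e \<Rightarrow> 'e \<Rightarrow> real"

text \<open>
  The Christoffel symbols as a bilinear map: \<open>christoffel G x u v\<close> is the value at \<open>x\<close> of the
  Levi-Civita derivative of the constant field \<open>v\<close> along the constant field \<open>u\<close>, given by the
  Koszul formula (in which the bracket terms vanish).
\<close>

definition christoffel :: "'e::euclidean_space coord_metric \<Rightarrow> 'e \<Rightarrow> 'e \<Rightarrow> 'e \<Rightarrow> 'e" where
  "christoffel G x u v = (THE z. \<forall>w. 2 * G x z w =
     fderiv (\<lambda>y. G y v w) x u + fderiv (\<lambda>y. G y u w) x v - fderiv (\<lambda>y. G y u v) x w)"

definition levi_civita ::
    "'e::euclidean_space coord_metric \<Rightarrow> ('e \<Rightarrow> 'e) \<Rightarrow> ('e \<Rightarrow> 'e) \<Rightarrow> 'e \<Rightarrow> 'e" where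
  "levi_civita G X Y = (\<lambda>x. fderiv Y x (X x) + christoffel G x (X x) (Y x))"

definition lie_bracket :: "('e::euclidean_space \<Rightarrow> 'e) \<Rightarrow> ('e \<Rightarrow> 'e) \<Rightarrow> 'e \<Rightarrow> 'e" where
  "lie_bracket X Y = (\<lambda>x. fderiv Y x (X x) - fderiv X x (Y x))"

definition curvature_field ::
    "'e::euclidean_space coord_metric \<Rightarrow> ('e \<Rightarrow> 'e) \<Rightarrow> ('e \<Rightarrow> 'e) \<Rightarrow> ('e \<Rightarrow> 'e) \<Rightarrow> 'e \<Rightarrow> 'e" where
  "curvature_field G X Y Z = (\<lambda>x.
     levi_civita G X (levi_civita G Y Z) x - levi_civita G Y (levi_civita G X Z) x
     - levi_civita G (lie_bracket X Y) Z x)"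

text \<open>The curvature is a tensor, so tangent vectors may be extended to constant fields.\<close>

definition curvature :: "'e::euclidean_space coord_metric \<Rightarrow> 'e \<Rightarrow> 'e \<Rightarrow> 'e \<Rightarrow> 'e \<Rightarrow> 'e" where
  "curvature G x u v w = curvature_field G (\<lambda>_. u) (\<lambda>_. v) (\<lambda>_. w) x"

definition raise_index :: "'e::euclidean_space coord_metric \<Rightarrow> 'e \<Rightarrow> ('e \<Rightarrow> real) \<Rightarrow> 'e" where
  "raise_index G x l = (THE z. \<forall>w. G x z w = l w)"

text \<open>
  For \<open>b \<in> Basis\<close>, raising the index of the dual basis covector \<open>\<lambda>w. w \<bullet> b\<close> gives the vector
  with components \<open>g\<^sup>b\<^sup>c\<close>, so the sum below is \<open>\<Sum>\<^sub>b\<^sub>c g\<^sup>b\<^sup>c B c b\<close>.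
\<close>

definition metric_trace ::
    "'e::euclidean_space coord_metric \<Rightarrow> 'e \<Rightarrow> ('e \<Rightarrow> 'e \<Rightarrow> 'f::real_vector) \<Rightarrow> 'f" where
  "metric_trace G x B = (\<Sum>b\<in>Basis. B (raise_index G x (\<lambda>w. w \<bullet> b)) b)"

text \<open>
  For a map \<open>F\<close> between coordinate domains with metrics \<open>G\<close> (source) and \<open>H\<close> (target), sections of
  the pull-back of the tangent bundle along \<open>F\<close> are functions \<open>'m \<Rightarrow> 'n\<close>.
\<close>

definition pullback_conn :: "'n::euclidean_space coord_metric \<Rightarrow> ('m::euclidean_space \<Rightarrow> 'n) \<Rightarrow>
    ('m \<Rightarrow> 'm) \<Rightarrow> ('m \<Rightarrow> 'n) \<Rightarrow> 'm \<Rightarrow> 'n" where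
  "pullback_conn H F X V =
     (\<lambda>x. fderiv V x (X x) + christoffel H (F x) (fderiv F x (X x)) (V x))"

definition second_fundamental_form :: "'m::euclidean_space coord_metric \<Rightarrow>
    'n::euclidean_space coord_metric \<Rightarrow> ('m \<Rightarrow> 'n) \<Rightarrow> 'm \<Rightarrow> 'm \<Rightarrow> 'm \<Rightarrow> 'n" where
  "second_fundamental_form G H F x u v =
     pullback_conn H F (\<lambda>_. u) (\<lambda>y. fderiv F y v) x
     - fderiv F x (levi_civita G (\<lambda>_. u) (\<lambda>_. v) x)"

definition coord_tension :: "'m::euclidean_space coord_metric \<Rightarrow>
    'n::euclidean_space coord_metric \<Rightarrow> ('m \<Rightarrow> 'n) \<Rightarrow> 'm \<Rightarrow> 'n" where
  "coord_tension G H F x = metric_trace G x (second_fundamental_form G H F x)"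

definition coord_energy_density :: "'m::euclidean_space coord_metric \<Rightarrow>
    'n::euclidean_space coord_metric \<Rightarrow> ('m \<Rightarrow> 'n) \<Rightarrow> 'm \<Rightarrow> real" where
  "coord_energy_density G H F x =
     1/2 * metric_trace G x (\<lambda>u v. H (F x) (fderiv F x u) (fderiv F x v))"

text \<open>The sign makes this the nonnegative (geometer's) Laplacian.\<close>

definition rough_laplacian :: "'m::euclidean_space coord_metric \<Rightarrow>
    'n::euclidean_space coord_metric \<Rightarrow> ('m \<Rightarrow> 'n) \<Rightarrow> ('m \<Rightarrow> 'n) \<Rightarrow> 'm \<Rightarrow> 'n" where
  "rough_laplacian G H F V x =
     - metric_trace G x (\<lambda>u v.
         pullback_conn H F (\<lambda>_. u) (pullback_conn H F (\<lambda>_. v) V) x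
         - pullback_conn H F (levi_civita G (\<lambda>_. u) (\<lambda>_. v)) V x)"

definition coord_bitension :: "'m::euclidean_space coord_metric \<Rightarrow>
    'n::euclidean_space coord_metric \<Rightarrow> ('m \<Rightarrow> 'n) \<Rightarrow> 'm \<Rightarrow> 'n" where
  "coord_bitension G H F x =
     - rough_laplacian G H F (coord_tension G H F) x
     - metric_trace G x (\<lambda>u v.
         curvature H (F x) (fderiv F x u) (coord_tension G H F x) (fderiv F x v))"


section \<open>Riemannian manifolds\<close>

text \<open>
  A chart is a domain together with a coordinate map; values of the coordinate map outside the
  domain are irrelevant. The metric of a manifold is recorded by its coordinate expression in
  every chart of the atlas. The dimension is that of the model space \<open>'e\<close>.
\<close>

type_synonym ('p, 'e) chart = "'p set \<times> ('p \<Rightarrow> 'e)"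

abbreviation dom_chart :: "('p, 'e) chart \<Rightarrow> 'p set" where "dom_chart \<equiv> fst"
abbreviation coord :: "('p, 'e) chart \<Rightarrow> 'p \<Rightarrow> 'e" where "coord \<equiv> snd"

definition coord_inv :: "('p, 'e) chart \<Rightarrow> 'e \<Rightarrow> 'p"
  where "coord_inv c = inv_into (dom_chart c) (coord c)"

record ('p, 'e) riem_mfd =
  mtop :: "'p topology"
  atlas :: "('p, 'e) chart set"
  metric :: "('p, 'e) chart \<Rightarrow> 'e coord_metric"

abbreviation points :: "('p, 'e) riem_mfd \<Rightarrow> 'p set" where "points M \<equiv> topspace (mtop M)"

definition smooth_manifold :: "('p, 'e::euclidean_space) riem_mfd \<Rightarrow> bool" where
  "smooth_manifold M \<longleftrightarrow>
     Hausdorff_space (mtop M) \<and> second_countable (mtop M) \<and>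
     (\<Union>c\<in>atlas M. dom_chart c) = points M \<and>
     (\<forall>c\<in>atlas M. openin (mtop M) (dom_chart c) \<and> open (coord c ` dom_chart c) \<and>
        homeomorphic_map (subtopology (mtop M) (dom_chart c))
          (top_of_set (coord c ` dom_chart c)) (coord c)) \<and>
     (\<forall>c\<in>atlas M. \<forall>d\<in>atlas M.
        smooth_on (coord c ` (dom_chart c \<inter> dom_chart d)) (coord d \<circ> coord_inv c))"

definition riemannian_metric :: "('p, 'e::euclidean_space) riem_mfd \<Rightarrow> bool" where
  "riemannian_metric M \<longleftrightarrow>
     (\<forall>c\<in>atlas M. \<forall>x\<in>coord c ` dom_chart c.
        bilinear (metric M c x) \<and>
        (\<forall>u v. metric M c x u v = metric M c x v u) \<and>
        (\<forall>u. u \<noteq> 0 \<longrightarrow> metric M c x u u > 0)) \<and>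
     (\<forall>c\<in>atlas M. \<forall>u v. smooth_on (coord c ` dom_chart c) (\<lambda>x. metric M c x u v)) \<and>
     (\<forall>c\<in>atlas M. \<forall>d\<in>atlas M. \<forall>x\<in>coord c ` (dom_chart c \<inter> dom_chart d). \<forall>u v.
        metric M c x u v =
        metric M d ((coord d \<circ> coord_inv c) x)
          (fderiv (coord d \<circ> coord_inv c) x u) (fderiv (coord d \<circ> coord_inv c) x v))"

definition riemannian_manifold :: "('p, 'e::euclidean_space) riem_mfd \<Rightarrow> bool" where
  "riemannian_manifold M \<longleftrightarrow> smooth_manifold M \<and> riemannian_metric M"

definition coord_expr ::
    "('p, 'm) chart \<Rightarrow> ('q, 'n) chart \<Rightarrow> ('p \<Rightarrow> 'q) \<Rightarrow> 'm \<Rightarrow> 'n"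
  where "coord_expr c d f = coord d \<circ> f \<circ> coord_inv c"

definition smooth_map :: "('p, 'm::euclidean_space) riem_mfd \<Rightarrow>
    ('q, 'n::euclidean_space) riem_mfd \<Rightarrow> ('p \<Rightarrow> 'q) \<Rightarrow> bool" where
  "smooth_map M N f \<longleftrightarrow>
     continuous_map (mtop M) (mtop N) f \<and>
     (\<forall>c\<in>atlas M. \<forall>d\<in>atlas N.
        smooth_on (coord c ` {p \<in> dom_chart c. f p \<in> dom_chart d}) (coord_expr c d f))"

definition harmonic_map :: "('p, 'm::euclidean_space) riem_mfd \<Rightarrow>
    ('q, 'n::euclidean_space) riem_mfd \<Rightarrow> ('p \<Rightarrow> 'q) \<Rightarrow> bool" where
  "harmonic_map M N f \<longleftrightarrow>
     smooth_map M N f \<and>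
     (\<forall>c\<in>atlas M. \<forall>d\<in>atlas N. \<forall>p\<in>dom_chart c. f p \<in> dom_chart d \<longrightarrow>
        coord_tension (metric M c) (metric N d) (coord_expr c d f) (coord c p) = 0)"

definition biharmonic_map :: "('p, 'm::euclidean_space) riem_mfd \<Rightarrow>
    ('q, 'n::euclidean_space) riem_mfd \<Rightarrow> ('p \<Rightarrow> 'q) \<Rightarrow> bool" where
  "biharmonic_map M N f \<longleftrightarrow>
     smooth_map M N f \<and>
     (\<forall>c\<in>atlas M. \<forall>d\<in>atlas N. \<forall>p\<in>dom_chart c. f p \<in> dom_chart d \<longrightarrow>
        coord_bitension (metric M c) (metric N d) (coord_expr c d f) (coord c p) = 0)"

definition chart_at :: "('p, 'e) riem_mfd \<Rightarrow> 'p \<Rightarrow> ('p, 'e) chart" where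
  "chart_at M p = (SOME c. c \<in> atlas M \<and> p \<in> dom_chart c)"

text \<open>The energy density does not depend on the charts in which it is computed.\<close>

definition energy_density :: "('p, 'm::euclidean_space) riem_mfd \<Rightarrow>
    ('q, 'n::euclidean_space) riem_mfd \<Rightarrow> ('p \<Rightarrow> 'q) \<Rightarrow> 'p \<Rightarrow> real" where
  "energy_density M N f p =
     (let c = chart_at M p; d = chart_at N (f p)
      in coord_energy_density (metric M c) (metric N d) (coord_expr c d f) (coord c p))"


section \<open>Submanifolds of Euclidean space and the two spheres\<close>

text \<open>
  The charts of an embedded submanifold \<open>S\<close> are all diffeomorphisms from relatively open subsets
  of \<open>S\<close> onto open subsets of the model space, where a map defined on a subset of Euclidean space
  is smooth if it extends locally to a smooth map on an open subset of the ambient space.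
\<close>

definition submanifold_charts ::
    "'v::euclidean_space set \<Rightarrow> ('v, 'e::euclidean_space) chart set" where
  "submanifold_charts S = {(U, c).
     openin (top_of_set S) U \<and> inj_on c U \<and> open (c ` U) \<and>
     smooth_on (c ` U) (coord_inv (U, c)) \<and>
     (\<forall>p\<in>U. \<exists>W c'. open W \<and> p \<in> W \<and> smooth_on W c' \<and> (\<forall>q\<in>U \<inter> W. c' q = c q))}"

definition induced_metric :: "('v::euclidean_space, 'e::euclidean_space) chart \<Rightarrow> 'e coord_metric"
  where "induced_metric c x u v = fderiv (coord_inv c) x u \<bullet> fderiv (coord_inv c) x v"

definition submanifold :: "'v::euclidean_space set \<Rightarrow> ('v, 'e::euclidean_space) riem_mfd" where
  "submanifold S =
     \<lparr> mtop = top_of_set S, atlas = submanifold_charts S, metric = induced_metric \<rparr>"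

text \<open>
  With \<open>n = DIM('n)\<close>, the space of dimension \<open>n + 1\<close> is \<open>'n \<times> real\<close> and that of dimension
  \<open>n + 2\<close> is \<open>('n \<times> real) \<times> real\<close>, with the Euclidean inner product of the product type.
\<close>

definition unit_sphere ::
    "(('n::euclidean_space \<times> real) \<times> real, 'n \<times> real) riem_mfd"
  where "unit_sphere = submanifold (sphere 0 1)"

definition small_sphere ::
    "(('n::euclidean_space \<times> real) \<times> real, 'n) riem_mfd"
  where "small_sphere = submanifold (sphere 0 (1 / sqrt 2) \<times> {1 / sqrt 2})"

definition small_sphere_inclusion ::
    "('n::euclidean_space \<times> real) \<times> real \<Rightarrow> ('n \<times> real) \<times> real"
  where "small_sphere_inclusion = (\<lambda>y. y)"

end

theory Submission
  imports Defs
begin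

text \<open>
  Write \<open>\<Phi>\<close> for \<open>\<psi>\<close> in a chart of \<open>M\<close>, as a map into the ambient Euclidean space, and \<open>q = |d\<Phi>|\<^sup>2 = 2 e(\<psi>)\<close>.
  Pushing sections forward by the parametrisation of a target chart turns the Levi-Civita connection of
  a sphere into the ambient derivative plus a normal correction, so all tension fields become ambient
  expressions. Harmonicity of \<open>\<psi>\<close> reads \<open>\<Delta>\<Phi> = - 2 q (x, 0)\<close> for \<open>\<Phi> = (x, 1/\<surd>2)\<close>; hence in the unit sphere
  \<open>\<tau>(\<phi>) = q n\<close> with the unit normal \<open>n = (- x, 1/\<surd>2)\<close>. Since \<open>dn = - d\<Phi>\<close>, the curvature term cancels and
  \<open>\<tau>\<^sup>2(\<phi>) = (\<Delta>q) n - 2 d\<Phi>(grad q)\<close>, whose components are normal and tangent to the small sphere. So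
  biharmonicity forces \<open>\<Delta>q = 0\<close>, and the strong maximum principle on the compact connected \<open>M\<close> makes \<open>q\<close>
  constant; conversely a constant \<open>q\<close> makes \<open>\<tau>\<^sup>2(\<phi>)\<close> vanish, and \<open>\<tau>(\<phi>) = 0\<close> would give \<open>d\<Phi> = 0\<close>.
\<close>

section \<open>Calculus of smooth maps\<close>

text \<open>The radius \<open>1 / sqrt 2\<close> enters through one coincidence: both factors of a
  point of the small sphere have the same length, so the unit normal is \<open>- \<Phi>\<close> plus
  a constant vector. For another radius its derivative would be a different multiple of the
  derivative of \<open>\<Phi>\<close>, and the quadratic term of the rough Laplacian would no longer
  match the curvature term. The definitions live in charts and characterise Christoffel symbols and
  raised indices by \<open>THE\<close>, so existence, bilinearity and smoothness have to be
  extracted from them. Orthogonal frames depending smoothly on the point serve for this; they also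
  make traces visibly nonnegative and independent of coordinates. Since a parametrisation of the
  target has injective derivative, it is enough to compute the images of all fields in the ambient
  space, where the Christoffel symbols of the target disappear. Constancy of a harmonic q could also
  come from integrating over M; the maximum principle is local, so each chart can be treated alone,
  and compactness only has to supply a point where q is largest.\<close>

lemma fderiv_eqI: "(f has_derivative f') (at x) \<Longrightarrow> fderiv f x = f'"
  using frechet_derivative_at by fastforce

lemma has_derivative_fderiv: "f differentiable (at x) \<Longrightarrow> (f has_derivative fderiv f x) (at x)"
  by (simp add: frechet_derivative_works)

lemma has_derivative_cong_open:
  assumes "open S" "x \<in> S" "\<And>y. y \<in> S \<Longrightarrow> f y = g y"
  shows "(f has_derivative f') (at x) \<longleftrightarrow> (g has_derivative f') (at x)"
  using assms has_derivative_transform_within_open[of f f' x UNIV S g]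
    has_derivative_transform_within_open[of g f' x UNIV S f] by auto

lemma fderiv_cong_open:
  assumes "open S" "x \<in> S" "\<And>y. y \<in> S \<Longrightarrow> f y = g y"
  shows "fderiv f x = fderiv g x"
  unfolding frechet_derivative_def using has_derivative_cong_open[OF assms] by simp

lemma differentiable_cong_open:
  assumes "open S" "x \<in> S" "\<And>y. y \<in> S \<Longrightarrow> f y = g y"
  shows "f differentiable (at x) \<longleftrightarrow> g differentiable (at x)"
  unfolding differentiable_def using has_derivative_cong_open[OF assms] by simp

lemma fderiv_sum_Basis:
  fixes f :: "'a::euclidean_space \<Rightarrow> 'b::euclidean_space"
  assumes "f differentiable (at x)"
  shows "fderiv f x v = (\<Sum>b\<in>Basis. (v \<bullet> b) *\<^sub>R fderiv f x b)"
proof -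
  have l: "linear (fderiv f x)" using assms by (rule linear_frechet_derivative)
  have "fderiv f x v = fderiv f x (\<Sum>b\<in>Basis. (v \<bullet> b) *\<^sub>R b)" by (simp add: euclidean_representation)
  also have "\<dots> = (\<Sum>b\<in>Basis. (v \<bullet> b) *\<^sub>R fderiv f x b)"
    using l by (simp add: linear_sum linear_cmul)
  finally show ?thesis .
qed

section \<open>Maps of class \<open>Ck_on\<close>: locality and closure properties\<close>

lemma Ck_on_cong:
  assumes "open S" "Ck_on k S f" "\<And>x. x \<in> S \<Longrightarrow> f x = g x"
  shows "Ck_on k S g"
  using assms(2,3)
proof (induction k arbitrary: f g)
  case 0
  then show ?case by (auto intro: continuous_on_eq)
next
  case (Suc k)
  have "Ck_on k S (\<lambda>x. fderiv g x v)" for v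
  proof (rule Suc.IH)
    show "Ck_on k S (\<lambda>x. fderiv f x v)" using Suc.prems by simp
    show "fderiv f x v = fderiv g x v" if "x \<in> S" for x
      using fderiv_cong_open[OF assms(1) that Suc.prems(2)] by simp
  qed
  moreover have "g differentiable (at x)" if "x \<in> S" for x
    using differentiable_cong_open[of S x f g] assms(1) Suc.prems that by auto
  ultimately show ?case by simp
qed

text \<open>Lets the inductions below use an explicit derivative formula in place of
  \<open>fderiv\<close>; the two agree on the open set by uniqueness of the derivative.\<close>

lemma Ck_on_SucI:
  assumes "open S" "\<And>x. x \<in> S \<Longrightarrow> (f has_derivative f' x) (at x)" "\<And>v. Ck_on k S (\<lambda>x. f' x v)"
  shows "Ck_on (Suc k) S f"
proof -
  have "Ck_on k S (\<lambda>x. fderiv f x v)" for v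
    by (rule Ck_on_cong[OF assms(1) assms(3)[of v]]) (use fderiv_eqI[OF assms(2)] in simp)
  then show ?thesis using assms(2) by (auto simp: differentiable_def)
qed

lemma Ck_on_SucD: "Ck_on (Suc k) S f \<Longrightarrow> Ck_on k S f"
proof (induction k arbitrary: f)
  case 0
  then show ?case
    by (auto intro!: continuous_at_imp_continuous_on differentiable_imp_continuous_within)
next
  case (Suc k)
  then show ?case by (metis Ck_on.simps(2))
qed

lemma Ck_on_local:
  assumes "\<And>x. x \<in> S \<Longrightarrow> \<exists>W. open W \<and> x \<in> W \<and> Ck_on k W f"
  shows "Ck_on k S f"
  using assms
proof (induction k arbitrary: f)
  case 0
  have "continuous (at x) f" if "x \<in> S" for x
    using 0[OF that] by (auto simp: continuous_on_eq_continuous_at)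
  then show ?case by (simp add: continuous_at_imp_continuous_on)
next
  case (Suc k)
  have "Ck_on k S (\<lambda>x. fderiv f x v)" for v
    by (rule Suc.IH) (use Suc.prems in fastforce)
  then show ?case using Suc.prems by fastforce
qed

lemma Ck_on_subset: "Ck_on k S f \<Longrightarrow> T \<subseteq> S \<Longrightarrow> Ck_on k T f"
  by (induction k arbitrary: f) (auto intro: continuous_on_subset)

lemma Ck_on_const: "open S \<Longrightarrow> Ck_on k S (\<lambda>x. c)"
  by (induction k arbitrary: c) auto

lemma Ck_on_add:
  assumes "open S" "Ck_on k S f" "Ck_on k S g"
  shows "Ck_on k S (\<lambda>x. f x + g x)"
  using assms(2,3)
proof (induction k arbitrary: f g)
  case 0 then show ?case by (auto intro: continuous_intros)
next
  case (Suc k)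
  show ?case
    by (rule Ck_on_SucI[where f' = "\<lambda>x v. fderiv f x v + fderiv g x v"])
      (use Suc assms in \<open>auto intro!: has_derivative_add has_derivative_fderiv\<close>)
qed

lemma Ck_on_linear:
  assumes "open S" "bounded_linear L" "Ck_on k S f"
  shows "Ck_on k S (\<lambda>x. L (f x))"
  using assms(3)
proof (induction k arbitrary: f)
  case 0 then show ?case using assms(2) by (auto intro: linear_continuous_on continuous_on_compose2[of UNIV] bounded_linear.continuous_on)
next
  case (Suc k)
  show ?case
    by (rule Ck_on_SucI[where f' = "\<lambda>x v. L (fderiv f x v)"])
      (use Suc assms in \<open>auto intro!: bounded_linear.has_derivative[OF assms(2)] has_derivative_fderiv\<close>)
qed

lemma Ck_on_ident: "open S \<Longrightarrow> Ck_on k S (\<lambda>x. x)"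
  by (cases k) (auto intro: Ck_on_const)

lemma Ck_on_bilinear:
  fixes bil :: "'b::euclidean_space \<Rightarrow> 'c::euclidean_space \<Rightarrow> 'd::euclidean_space"
  assumes "open S" "bounded_bilinear bil" "Ck_on k S f" "Ck_on k S g"
  shows "Ck_on k S (\<lambda>x. bil (f x) (g x))"
  using assms(3,4)
proof (induction k arbitrary: f g)
  case 0 then show ?case using assms(2) by (auto intro: bounded_bilinear.continuous_on)
next
  case (Suc k)
  show ?case
  proof (rule Ck_on_SucI[where f' = "\<lambda>x v. bil (f x) (fderiv g x v) + bil (fderiv f x v) (g x)"])
    show "((\<lambda>x. bil (f x) (g x)) has_derivative (\<lambda>v. bil (f x) (fderiv g x v) + bil (fderiv f x v) (g x))) (at x)"
      if "x \<in> S" for x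
      by (rule bounded_bilinear.FDERIV[OF assms(2)]) (use Suc that in \<open>auto intro: has_derivative_fderiv\<close>)
    have "Ck_on k S f" "Ck_on k S g" using Suc.prems Ck_on_SucD by blast+
    then show "Ck_on k S (\<lambda>x. bil (f x) (fderiv g x v) + bil (fderiv f x v) (g x))" for v
      using Suc by (intro Ck_on_add assms Suc.IH) auto
  qed (rule assms)
qed

lemma Ck_on_sum:
  assumes "open S" "\<And>i. i \<in> I \<Longrightarrow> Ck_on k S (f i)"
  shows "Ck_on k S (\<lambda>x. \<Sum>i\<in>I. f i x)"
  using assms(2)
  by (induction I rule: infinite_finite_induct) (auto intro: Ck_on_const Ck_on_add assms)

lemma Ck_on_compose:
  assumes "open S" "f ` S \<subseteq> T" "Ck_on k S f" "Ck_on k T g"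
  shows "Ck_on k S (\<lambda>x. g (f x))"
  using assms(2-)
proof (induction k arbitrary: f g)
  case 0 then show ?case by (auto intro: continuous_on_compose2)
next
  case (Suc k)
  have fk: "Ck_on k S f" using Suc.prems Ck_on_SucD by blast
  \<comment> \<open>The chain rule moves both the base point and the direction of
    \<open>fderiv g\<close>. Expanding the direction in \<open>Basis\<close> leaves derivatives of
    \<open>g\<close> in fixed directions, to which the induction hypothesis applies.\<close>
  show ?case
  proof (rule Ck_on_SucI[where f' = "\<lambda>x v. \<Sum>b\<in>Basis. (fderiv f x v \<bullet> b) *\<^sub>R fderiv g (f x) b"])
    fix x assume x: "x \<in> S"
    have gd: "g differentiable (at (f x))" and fd: "f differentiable (at x)" using Suc.prems x by auto
    have "((\<lambda>x. g (f x)) has_derivative (\<lambda>v. fderiv g (f x) (fderiv f x v))) (at x)"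
      using has_derivative_compose[OF has_derivative_fderiv[OF fd] has_derivative_fderiv[OF gd]] .
    then show "((\<lambda>x. g (f x)) has_derivative (\<lambda>v. \<Sum>b\<in>Basis. (fderiv f x v \<bullet> b) *\<^sub>R fderiv g (f x) b)) (at x)"
      by (simp only: fderiv_sum_Basis[OF gd, symmetric])
  next
    fix v
    have a: "Ck_on k S (\<lambda>x. fderiv g (f x) b)" for b
      by (rule Suc.IH) (use Suc.prems fk in auto)
    have b: "Ck_on k S (\<lambda>x. fderiv f x v \<bullet> b)" for b
      by (rule Ck_on_linear[OF assms(1) bounded_linear_inner_left]) (use Suc.prems in auto)
    show "Ck_on k S (\<lambda>x. \<Sum>b\<in>Basis. (fderiv f x v \<bullet> b) *\<^sub>R fderiv g (f x) b)"
      by (intro Ck_on_sum assms Ck_on_bilinear[OF assms(1) bounded_bilinear_scaleR] a b)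
  qed (rule assms)
qed

text \<open>The derivative of the reciprocal is built from the reciprocal itself and the derivative
  of \<open>f\<close>, so the induction on \<open>k\<close> feeds on its own hypothesis for the same
  \<open>f\<close>.\<close>

lemma Ck_on_inverse:
  fixes f :: "'a::euclidean_space \<Rightarrow> real"
  assumes "open S" "\<And>x. x \<in> S \<Longrightarrow> f x \<noteq> 0" "Ck_on k S f"
  shows "Ck_on k S (\<lambda>x. inverse (f x))"
  using assms(3)
proof (induction k)
  case 0 then show ?case using assms by (auto intro!: continuous_intros)
next
  case (Suc k)
  have i: "Ck_on k S (\<lambda>x. inverse (f x))" using Suc Ck_on_SucD by blast
  show ?case
  proof (rule Ck_on_SucI[where f' = "\<lambda>x v. (- 1) *\<^sub>R (inverse (f x) * fderiv f x v * inverse (f x))"])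
    fix x assume x: "x \<in> S"
    have "f differentiable (at x)" using Suc.prems x by auto
    from Deriv.has_derivative_inverse[OF assms(2)[OF x] has_derivative_fderiv[OF this]]
    show "((\<lambda>x. inverse (f x)) has_derivative (\<lambda>v. (- 1) *\<^sub>R (inverse (f x) * fderiv f x v * inverse (f x)))) (at x)"
      by simp
  next
    fix v
    show "Ck_on k S (\<lambda>x. (- 1) *\<^sub>R (inverse (f x) * fderiv f x v * inverse (f x)))"
      by (intro Ck_on_linear[OF assms(1) bounded_linear_scaleR_right] Ck_on_bilinear[OF assms(1) bounded_bilinear_mult] i)
        (use Suc.prems in auto)
  qed (rule assms)
qed

lemma smooth_on_cong: "open S \<Longrightarrow> smooth_on S f \<Longrightarrow> (\<And>x. x \<in> S \<Longrightarrow> f x = g x) \<Longrightarrow> smooth_on S g"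
  unfolding smooth_on_def using Ck_on_cong[of S _ f g] by auto

lemma smooth_on_local:
  assumes "\<And>x. x \<in> S \<Longrightarrow> \<exists>W. open W \<and> x \<in> W \<and> smooth_on W f"
  shows "smooth_on S f"
  using assms unfolding smooth_on_def by (meson Ck_on_local)

lemma smooth_on_subset: "smooth_on S f \<Longrightarrow> T \<subseteq> S \<Longrightarrow> smooth_on T f"
  unfolding smooth_on_def using Ck_on_subset by blast

lemma smooth_on_const: "open S \<Longrightarrow> smooth_on S (\<lambda>x. c)"
  by (simp add: smooth_on_def Ck_on_const)

lemma smooth_on_ident: "open S \<Longrightarrow> smooth_on S (\<lambda>x. x)"
  by (simp add: smooth_on_def Ck_on_ident)

lemma smooth_on_add: "open S \<Longrightarrow> smooth_on S f \<Longrightarrow> smooth_on S g \<Longrightarrow> smooth_on S (\<lambda>x. f x + g x)"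
  by (simp add: smooth_on_def Ck_on_add)

lemma smooth_on_linear: "open S \<Longrightarrow> bounded_linear L \<Longrightarrow> smooth_on S f \<Longrightarrow> smooth_on S (\<lambda>x. L (f x))"
  by (simp add: smooth_on_def Ck_on_linear)

lemma smooth_on_bilinear:
  fixes bil :: "'b::euclidean_space \<Rightarrow> 'c::euclidean_space \<Rightarrow> 'd::euclidean_space"
  shows "open S \<Longrightarrow> bounded_bilinear bil \<Longrightarrow> smooth_on S f \<Longrightarrow> smooth_on S g \<Longrightarrow> smooth_on S (\<lambda>x. bil (f x) (g x))"
  by (simp add: smooth_on_def Ck_on_bilinear)

lemmas smooth_on_scaleR = smooth_on_bilinear[OF _ bounded_bilinear_scaleR]
lemmas smooth_on_mult = smooth_on_bilinear[OF _ bounded_bilinear_mult]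
lemmas smooth_on_inner = smooth_on_bilinear[OF _ bounded_bilinear_inner]
lemmas smooth_on_inner_left = smooth_on_linear[OF _ bounded_linear_inner_left]

lemma smooth_on_minus: "open S \<Longrightarrow> smooth_on S f \<Longrightarrow> smooth_on S (\<lambda>x. - f x)"
  by (rule smooth_on_linear[OF _ bounded_linear_minus[OF bounded_linear_ident]])

lemma smooth_on_diff: "open S \<Longrightarrow> smooth_on S f \<Longrightarrow> smooth_on S g \<Longrightarrow> smooth_on S (\<lambda>x. f x - g x)"
  using smooth_on_add[of S f "\<lambda>x. - g x"] smooth_on_minus[of S g] by simp

lemma smooth_on_sum: "open S \<Longrightarrow> (\<And>i. i \<in> I \<Longrightarrow> smooth_on S (f i)) \<Longrightarrow> smooth_on S (\<lambda>x. \<Sum>i\<in>I. f i x)"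
  by (simp add: smooth_on_def Ck_on_sum)

lemma smooth_on_compose:
  "open S \<Longrightarrow> f ` S \<subseteq> T \<Longrightarrow> smooth_on S f \<Longrightarrow> smooth_on T g \<Longrightarrow> smooth_on S (\<lambda>x. g (f x))"
  unfolding smooth_on_def using Ck_on_compose[of S f T _ g] by auto

lemma smooth_on_inverse:
  fixes f :: "'a::euclidean_space \<Rightarrow> real"
  shows "open S \<Longrightarrow> (\<And>x. x \<in> S \<Longrightarrow> f x \<noteq> 0) \<Longrightarrow> smooth_on S f \<Longrightarrow> smooth_on S (\<lambda>x. inverse (f x))"
  by (simp add: smooth_on_def Ck_on_inverse)

lemma smooth_on_differentiable: "smooth_on S f \<Longrightarrow> x \<in> S \<Longrightarrow> f differentiable (at x)"
  unfolding smooth_on_def by (metis Ck_on.simps(2))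

lemma smooth_on_has_derivative: "smooth_on S f \<Longrightarrow> x \<in> S \<Longrightarrow> (f has_derivative fderiv f x) (at x)"
  by (rule has_derivative_fderiv[OF smooth_on_differentiable])

lemma smooth_on_continuous_on: "smooth_on S f \<Longrightarrow> continuous_on S f"
  unfolding smooth_on_def by (metis Ck_on.simps(1))

lemma smooth_on_fderiv: "smooth_on S f \<Longrightarrow> smooth_on S (\<lambda>x. fderiv f x v)"
  unfolding smooth_on_def by (metis Ck_on.simps(2))

lemma smooth_on_fderiv_apply:
  assumes "open S" "smooth_on S F" "F ` S \<subseteq> T" "smooth_on T f" "smooth_on S V"
  shows "smooth_on S (\<lambda>x. fderiv f (F x) (V x))"
proof (rule smooth_on_cong[OF assms(1)])
  show "smooth_on S (\<lambda>x. \<Sum>b\<in>Basis. (V x \<bullet> b) *\<^sub>R fderiv f (F x) b)"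
    by (intro smooth_on_sum smooth_on_scaleR smooth_on_inner_left assms
        smooth_on_compose[OF assms(1,3,2)] smooth_on_fderiv)
  show "(\<Sum>b\<in>Basis. (V x \<bullet> b) *\<^sub>R fderiv f (F x) b) = fderiv f (F x) (V x)" if "x \<in> S" for x
    by (rule fderiv_sum_Basis[symmetric]) (use assms that in \<open>auto intro: smooth_on_differentiable\<close>)
qed

lemma fderiv_linear:
  assumes "smooth_on S f" "x \<in> S"
  shows "linear (fderiv f x)"
  using linear_frechet_derivative smooth_on_differentiable[OF assms] by blast

lemma fderiv_compose:
  assumes "f differentiable (at x)" "g differentiable (at (f x))"
  shows "fderiv (\<lambda>x. g (f x)) x v = fderiv g (f x) (fderiv f x v)"
  using fderiv_eqI[OF has_derivative_compose[OF has_derivative_fderiv[OF assms(1)] has_derivative_fderiv[OF assms(2)]]]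
  by simp

text \<open>Product and chain rule for a derivative applied to a moving vector at a moving point.
  With \<open>f\<close> a parametrisation, the first summand is the second derivative that the
  Christoffel symbols of the target will supply.\<close>

lemma has_derivative_fderiv_apply:
  assumes F: "F differentiable (at x)" and V: "V differentiable (at x)"
    and f: "open T" "smooth_on T f" "F x \<in> T"
  shows "((\<lambda>y. fderiv f (F y) (V y)) has_derivative
     (\<lambda>u. fderiv (\<lambda>z. fderiv f z (V x)) (F x) (fderiv F x u) + fderiv f (F x) (fderiv V x u))) (at x)"
proof -
  have d: "((\<lambda>y. fderiv f (F y) b) has_derivative (\<lambda>u. fderiv (\<lambda>z. fderiv f z b) (F x) (fderiv F x u))) (at x)" for b
    using has_derivative_compose[OF has_derivative_fderiv[OF F] smooth_on_has_derivative[OF smooth_on_fderiv[OF f(2)] f(3)]] .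
  have D0: "((\<lambda>y. \<Sum>b\<in>Basis. (V y \<bullet> b) *\<^sub>R fderiv f (F y) b) has_derivative
     (\<lambda>u. \<Sum>b\<in>Basis. (V x \<bullet> b) *\<^sub>R fderiv (\<lambda>z. fderiv f z b) (F x) (fderiv F x u) + (fderiv V x u \<bullet> b) *\<^sub>R fderiv f (F x) b)) (at x)"
    by (intro has_derivative_sum has_derivative_scaleR d has_derivative_inner_left has_derivative_fderiv[OF V])
  have eq: "(\<Sum>b\<in>Basis. (V x \<bullet> b) *\<^sub>R fderiv (\<lambda>z. fderiv f z b) (F x) (fderiv F x u) + (fderiv V x u \<bullet> b) *\<^sub>R fderiv f (F x) b)
    = fderiv (\<lambda>z. fderiv f z (V x)) (F x) (fderiv F x u) + fderiv f (F x) (fderiv V x u)" for u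
  proof -
    have "((\<lambda>z. \<Sum>b\<in>Basis. (V x \<bullet> b) *\<^sub>R fderiv f z b) has_derivative
      (\<lambda>u. \<Sum>b\<in>Basis. (V x \<bullet> b) *\<^sub>R fderiv (\<lambda>z. fderiv f z b) (F x) u)) (at (F x))"
      by (intro has_derivative_sum has_derivative_scaleR_right smooth_on_has_derivative[OF smooth_on_fderiv[OF f(2)] f(3)])
    moreover have "(\<Sum>b\<in>Basis. (V x \<bullet> b) *\<^sub>R fderiv f z b) = fderiv f z (V x)" if "z \<in> T" for z
      by (rule fderiv_sum_Basis[OF smooth_on_differentiable[OF f(2) that], symmetric])
    ultimately have "((\<lambda>z. fderiv f z (V x)) has_derivative
      (\<lambda>u. \<Sum>b\<in>Basis. (V x \<bullet> b) *\<^sub>R fderiv (\<lambda>z. fderiv f z b) (F x) u)) (at (F x))"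
      by (rule has_derivative_transform_within_open[OF _ f(1,3)])
    from fderiv_eqI[OF this] show ?thesis
      using fderiv_sum_Basis[OF smooth_on_differentiable[OF f(2,3)], of "fderiv V x u"]
      by (simp add: sum.distrib)
  qed
  have D: "((\<lambda>y. \<Sum>b\<in>Basis. (V y \<bullet> b) *\<^sub>R fderiv f (F y) b) has_derivative
     (\<lambda>u. fderiv (\<lambda>z. fderiv f z (V x)) (F x) (fderiv F x u) + fderiv f (F x) (fderiv V x u))) (at x)"
    using D0 unfolding eq .
  have "continuous (at x) F" using F by (rule differentiable_imp_continuous_within)
  then obtain W where W: "open W" "x \<in> W" "\<And>y. y \<in> W \<Longrightarrow> F y \<in> T"
    using f(1,3) by (metis continuous_at_open)
  show ?thesis
    by (rule has_derivative_transform_within_open[OF D W(1,2)])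
      (rule fderiv_sum_Basis[OF smooth_on_differentiable[OF f(2) W(3)], symmetric])
qed

section \<open>Symmetry of second derivatives\<close>

text \<open>The mean value theorem in direction \<open>u\<close> turns the second difference into an
  increment of the \<open>u\<close>-derivative along \<open>v\<close>; differentiability of that
  derivative at \<open>x\<close> then gives the error bound.\<close>

lemma second_difference_bound:
  fixes f :: "'a::euclidean_space \<Rightarrow> real"
  assumes S: "open S" "smooth_on S f" "x \<in> S" and e: "e > 0"
  shows "\<exists>d>0. \<forall>t. 0 < t \<and> t < d \<longrightarrow>
    \<bar>f (x + t *\<^sub>R u + t *\<^sub>R v) - f (x + t *\<^sub>R u) - f (x + t *\<^sub>R v) + f x - t\<^sup>2 * fderiv (\<lambda>y. fderiv f y u) x v\<bar> \<le> e * t\<^sup>2"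
proof -
  define g where "g = (\<lambda>y. fderiv f y u)"
  \<comment> \<open>The linearisation is used at the displacements \<open>s u + t v\<close> and
    \<open>s u\<close> with \<open>s <= t\<close>; their norms add up to at most \<open>t N\<close>.
    The summand 1 keeps \<open>N\<close> positive.\<close>
  define N where "N = 2 * norm u + norm v + 1"
  have N: "N > 0" by (simp add: N_def add_nonneg_pos)
  have "(g has_derivative fderiv g x) (at x)"
    unfolding g_def using S by (intro smooth_on_has_derivative smooth_on_fderiv)
  then have lin: "linear (fderiv g x)"
    and "\<forall>e>0. \<exists>d>0. \<forall>y. norm (y - x) < d \<longrightarrow> norm (g y - g x - fderiv g x (y - x)) \<le> e * norm (y - x)"
    unfolding has_derivative_at_alt by (auto simp: bounded_linear.linear)
  moreover have "e / N > 0" using e N by simp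
  ultimately obtain d1 where d1: "d1 > 0" "\<And>y. norm (y - x) < d1 \<Longrightarrow> norm (g y - g x - fderiv g x (y - x)) \<le> e / N * norm (y - x)"
    by blast
  obtain d2 where d2: "d2 > 0" "ball x d2 \<subseteq> S" using S by (meson open_contains_ball)
  have inS: "x + w \<in> S" if "norm w < d2" for w
    using d2(2) that by (auto simp: subset_eq dist_norm)
  define d where "d = min d1 d2 / N"
  have d: "d > 0" using d1 d2 N by (simp add: d_def)
  have "\<bar>f (x + t *\<^sub>R u + t *\<^sub>R v) - f (x + t *\<^sub>R u) - f (x + t *\<^sub>R v) + f x - t\<^sup>2 * fderiv g x v\<bar> \<le> e * t\<^sup>2"
    if t: "0 < t" "t < d" for t
  proof -
    have tN: "t * N < min d1 d2" using t N by (simp add: d_def pos_less_divide_eq)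
    have n1: "norm (s *\<^sub>R u + t *\<^sub>R v) \<le> t * (norm u + norm v)" if "0 \<le> s" "s \<le> t" for s
    proof -
      have "norm (s *\<^sub>R u + t *\<^sub>R v) \<le> s * norm u + t * norm v"
        using norm_triangle_ineq[of "s *\<^sub>R u" "t *\<^sub>R v"] that t by simp
      also have "\<dots> \<le> t * norm u + t * norm v" using that by (simp add: mult_right_mono)
      finally show ?thesis by (simp add: algebra_simps)
    qed
    have n2: "norm (s *\<^sub>R u) \<le> t * norm u" if "0 \<le> s" "s \<le> t" for s
      using that by (simp add: mult_right_mono)
    have le: "t * (norm u + norm v) < t * N" "t * norm u < t * N" using t by (auto simp: N_def intro!: mult_strict_left_mono add_nonneg_pos)
    \<comment> \<open>The first difference in direction \<open>v\<close>, as a function of the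
      parameter along \<open>u\<close>; \<open>h t - h 0\<close> is the second difference.\<close>
    define h where "h = (\<lambda>s. f (x + s *\<^sub>R u + t *\<^sub>R v) - f (x + s *\<^sub>R u))"
    have der: "(h has_real_derivative g (x + s *\<^sub>R u + t *\<^sub>R v) - g (x + s *\<^sub>R u)) (at s)" if s: "0 \<le> s" "s \<le> t" for s
    proof -
      have i: "x + s *\<^sub>R u + t *\<^sub>R v \<in> S" "x + s *\<^sub>R u \<in> S"
        using n1[OF s] n2[OF s] le tN inS[of "s *\<^sub>R u + t *\<^sub>R v"] inS[of "s *\<^sub>R u"] by (auto simp: add.assoc)
      have A: "((\<lambda>s. f (x + s *\<^sub>R u + t *\<^sub>R v)) has_derivative (\<lambda>r. fderiv f (x + s *\<^sub>R u + t *\<^sub>R v) (r *\<^sub>R u))) (at s)"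
        by (rule has_derivative_compose[where g = f and f = "\<lambda>s. x + s *\<^sub>R u + t *\<^sub>R v" and f' = "\<lambda>r. r *\<^sub>R u", OF _ smooth_on_has_derivative[OF S(2) i(1)]]) (auto intro!: derivative_eq_intros)
      have B: "((\<lambda>s. f (x + s *\<^sub>R u)) has_derivative (\<lambda>r. fderiv f (x + s *\<^sub>R u) (r *\<^sub>R u))) (at s)"
        by (rule has_derivative_compose[where g = f and f = "\<lambda>s. x + s *\<^sub>R u" and f' = "\<lambda>r. r *\<^sub>R u", OF _ smooth_on_has_derivative[OF S(2) i(2)]]) (auto intro!: derivative_eq_intros)
      have "(h has_derivative (\<lambda>r. fderiv f (x + s *\<^sub>R u + t *\<^sub>R v) (r *\<^sub>R u) - fderiv f (x + s *\<^sub>R u) (r *\<^sub>R u))) (at s)"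
        unfolding h_def by (intro has_derivative_diff A B)
      moreover have "(\<lambda>r. fderiv f (x + s *\<^sub>R u + t *\<^sub>R v) (r *\<^sub>R u) - fderiv f (x + s *\<^sub>R u) (r *\<^sub>R u))
          = (*) (g (x + s *\<^sub>R u + t *\<^sub>R v) - g (x + s *\<^sub>R u))"
        using linear_cmul[OF fderiv_linear[OF S(2) i(1)]] linear_cmul[OF fderiv_linear[OF S(2) i(2)]]
        by (auto simp: g_def algebra_simps fun_eq_iff)
      ultimately show ?thesis by (simp add: has_field_derivative_def)
    qed
    obtain s where s: "0 < s" "s < t" "h t - h 0 = (t - 0) * (g (x + s *\<^sub>R u + t *\<^sub>R v) - g (x + s *\<^sub>R u))"
      using MVT2[OF t(1) der] by auto
    let ?a = "g (x + s *\<^sub>R u + t *\<^sub>R v) - g x - fderiv g x (s *\<^sub>R u + t *\<^sub>R v)"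
    let ?b = "g (x + s *\<^sub>R u) - g x - fderiv g x (s *\<^sub>R u)"
    have a: "\<bar>?a\<bar> \<le> e / N * (t * (norm u + norm v))"
    proof -
      have "norm (s *\<^sub>R u + t *\<^sub>R v) < d1" using n1[of s] s le tN by linarith
      then have "\<bar>?a\<bar> \<le> e / N * norm (s *\<^sub>R u + t *\<^sub>R v)"
        using d1(2)[of "x + s *\<^sub>R u + t *\<^sub>R v"] by (simp add: add.assoc)
      also have "\<dots> \<le> e / N * (t * (norm u + norm v))"
        using n1[of s] s e N by (intro mult_left_mono) auto
      finally show ?thesis .
    qed
    have b: "\<bar>?b\<bar> \<le> e / N * (t * norm u)"
    proof -
      have "norm (s *\<^sub>R u) < d1" using n2[of s] s le tN by linarith
      then have "\<bar>?b\<bar> \<le> e / N * norm (s *\<^sub>R u)"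
        using d1(2)[of "x + s *\<^sub>R u"] by simp
      also have "\<dots> \<le> e / N * (t * norm u)"
        using n2[of s] s e N by (intro mult_left_mono) auto
      finally show ?thesis .
    qed
    have "fderiv g x (s *\<^sub>R u + t *\<^sub>R v) - fderiv g x (s *\<^sub>R u) = t * fderiv g x v"
      using lin by (simp add: linear_add linear_cmul)
    then have "h t - h 0 - t\<^sup>2 * fderiv g x v = t * (?a - ?b)"
      unfolding s(3) by (simp add: algebra_simps power2_eq_square)
    moreover have "\<bar>t * (?a - ?b)\<bar> \<le> t * (e / N * (t * (2 * norm u + norm v)))"
    proof -
      have "\<bar>?a - ?b\<bar> \<le> e / N * (t * (norm u + norm v)) + e / N * (t * norm u)"
        using a b by linarith
      also have "\<dots> = e / N * (t * (2 * norm u + norm v))" by (simp add: algebra_simps)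
      finally have "t * \<bar>?a - ?b\<bar> \<le> t * (e / N * (t * (2 * norm u + norm v)))"
        using t by (intro mult_left_mono) auto
      then show ?thesis using t by (simp add: abs_mult)
    qed
    moreover have "t * (e / N * (t * (2 * norm u + norm v))) \<le> t * (e / N * (t * N))"
      using t e N by (intro mult_left_mono) (auto simp: N_def)
    moreover have "t * (e / N * (t * N)) = e * t\<^sup>2" using N by (simp add: power2_eq_square)
    ultimately have "\<bar>h t - h 0 - t\<^sup>2 * fderiv g x v\<bar> \<le> e * t\<^sup>2" by linarith
    then show ?thesis by (simp add: h_def algebra_simps)
  qed
  then show ?thesis using d unfolding g_def by blast
qed

text \<open>The second difference is symmetric in \<open>u\<close> and \<open>v\<close>, and after
  division by the square of \<open>t\<close> it approximates both mixed derivatives.\<close>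

lemma fderiv_symmetric_real:
  fixes f :: "'a::euclidean_space \<Rightarrow> real"
  assumes S: "open S" "smooth_on S f" "x \<in> S"
  shows "fderiv (\<lambda>y. fderiv f y u) x v = fderiv (\<lambda>y. fderiv f y v) x u"
proof -
  have "\<bar>fderiv (\<lambda>y. fderiv f y u) x v - fderiv (\<lambda>y. fderiv f y v) x u\<bar> \<le> e" if "e > 0" for e
  proof -
    have e2: "e/2 > 0" using that by simp
    obtain d1 where d1: "d1 > 0" "\<And>t. 0 < t \<Longrightarrow> t < d1 \<Longrightarrow>
      \<bar>f (x + t *\<^sub>R u + t *\<^sub>R v) - f (x + t *\<^sub>R u) - f (x + t *\<^sub>R v) + f x - t\<^sup>2 * fderiv (\<lambda>y. fderiv f y u) x v\<bar> \<le> e/2 * t\<^sup>2"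
      using second_difference_bound[OF assms e2] by blast
    obtain d2 where d2: "d2 > 0" "\<And>t. 0 < t \<Longrightarrow> t < d2 \<Longrightarrow>
      \<bar>f (x + t *\<^sub>R v + t *\<^sub>R u) - f (x + t *\<^sub>R v) - f (x + t *\<^sub>R u) + f x - t\<^sup>2 * fderiv (\<lambda>y. fderiv f y v) x u\<bar> \<le> e/2 * t\<^sup>2"
      using second_difference_bound[OF assms e2] by blast
    define t where "t = min d1 d2 / 2"
    have t: "0 < t" "t < d1" "t < d2" using d1 d2 by (auto simp: t_def)
    have c: "x + t *\<^sub>R v + t *\<^sub>R u = x + t *\<^sub>R u + t *\<^sub>R v" by simp
    have "\<bar>t\<^sup>2 * fderiv (\<lambda>y. fderiv f y u) x v - t\<^sup>2 * fderiv (\<lambda>y. fderiv f y v) x u\<bar> \<le> t\<^sup>2 * e"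
      using d1(2)[OF t(1,2)] d2(2)[OF t(1,3)] unfolding c by argo
    then have "t\<^sup>2 * \<bar>fderiv (\<lambda>y. fderiv f y u) x v - fderiv (\<lambda>y. fderiv f y v) x u\<bar> \<le> t\<^sup>2 * e"
      by (simp add: right_diff_distrib[symmetric] abs_mult)
    then show ?thesis using t(1) by simp
  qed
  then show ?thesis by (metis abs_le_zero_iff dual_order.refl eq_iff_diff_eq_0 field_le_epsilon add_0)
qed

lemma fderiv_inner_left:
  "f differentiable (at x) \<Longrightarrow> fderiv (\<lambda>y. f y \<bullet> b) x v = fderiv f x v \<bullet> b"
  using fderiv_eqI[OF has_derivative_inner_left[OF has_derivative_fderiv]] by metis

lemma fderiv_symmetric:
  assumes S: "open S" "smooth_on S f" "x \<in> S"
  shows "fderiv (\<lambda>y. fderiv f y u) x v = fderiv (\<lambda>y. fderiv f y v) x u"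
proof (rule euclidean_eqI)
  fix b :: 'b assume "b \<in> Basis"
  have sb: "smooth_on S (\<lambda>y. f y \<bullet> b)" by (intro smooth_on_inner_left S)
  have "fderiv (\<lambda>y. fderiv (\<lambda>y. f y \<bullet> b) y u) x v = fderiv (\<lambda>y. fderiv f y u) x v \<bullet> b" for u v
  proof -
    have "fderiv (\<lambda>y. fderiv (\<lambda>y. f y \<bullet> b) y u) x = fderiv (\<lambda>y. fderiv f y u \<bullet> b) x"
      by (rule fderiv_cong_open[OF S(1,3)]) (use fderiv_inner_left smooth_on_differentiable[OF S(2)] in metis)
    then show ?thesis using fderiv_inner_left[OF smooth_on_differentiable[OF smooth_on_fderiv[OF S(2)] S(3)]] by metis
  qed
  with fderiv_symmetric_real[OF S(1) sb S(3), of u v]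
  show "fderiv (\<lambda>y. fderiv f y u) x v \<bullet> b = fderiv (\<lambda>y. fderiv f y v) x u \<bullet> b" by simp
qed

section \<open>Orthogonal frames and metric traces\<close>

definition inner_form :: "('e::euclidean_space \<Rightarrow> 'e \<Rightarrow> real) \<Rightarrow> bool" where
  "inner_form g \<longleftrightarrow> bilinear g \<and> (\<forall>u v. g u v = g v u) \<and> (\<forall>u. u \<noteq> 0 \<longrightarrow> g u u > 0)"

text \<open>Vectors are not normalised, so coefficients carry the division by
  \<open>g (f b) (f b)\<close>. The last clause records the expansion in the frame directly, since
  that is the form in which the spanning property is applied. Indexing by \<open>Basis\<close> fixes
  the number of vectors.\<close>

definition orthogonal_frame :: "('e::euclidean_space \<Rightarrow> 'e \<Rightarrow> real) \<Rightarrow> ('e \<Rightarrow> 'e) \<Rightarrow> bool" where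
  "orthogonal_frame g f \<longleftrightarrow> (\<forall>b\<in>Basis. f b \<noteq> 0) \<and>
     (\<forall>b\<in>Basis. \<forall>c\<in>Basis. b \<noteq> c \<longrightarrow> g (f b) (f c) = 0) \<and>
     (\<forall>v. v = (\<Sum>b\<in>Basis. (g v (f b) / g (f b) (f b)) *\<^sub>R f b))"

lemma inner_formD:
  assumes "inner_form g"
  shows "bilinear g" "g u v = g v u" "u \<noteq> 0 \<Longrightarrow> g u u > 0" "linear (g u)" "linear (\<lambda>u. g u v)"
  using assms by (auto simp: inner_form_def bilinear_def)

text \<open>Nondegeneracy, which gives the uniqueness half of every \<open>THE\<close> in the
  coordinate definitions.\<close>

lemma inner_form_unique:
  assumes "inner_form g" "\<And>w. g z w = g z' w"
  shows "z = z'"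
proof -
  have "g (z - z') (z - z') = 0"
    using assms(2) by (simp add: bilinear_lsub[OF inner_formD(1)[OF assms(1)]])
  then show ?thesis using inner_formD(3)[OF assms(1), of "z - z'"] by force
qed

lemma raise_index_eqI:
  assumes "inner_form (G x)" "\<And>w. G x z w = l w"
  shows "raise_index G x l = z"
  unfolding raise_index_def by (rule the_equality) (use assms inner_form_unique[OF assms(1)] in auto)

lemma orthogonal_frame_raise:
  assumes g: "inner_form g" and f: "orthogonal_frame g f" and l: "linear l"
  shows "g (\<Sum>b\<in>Basis. (l (f b) / g (f b) (f b)) *\<^sub>R f b) w = l w"
proof -
  interpret gl: linear "\<lambda>z. g z w" using inner_formD(5)[OF g] .
  have "g (\<Sum>b\<in>Basis. (l (f b) / g (f b) (f b)) *\<^sub>R f b) w = (\<Sum>b\<in>Basis. (l (f b) / g (f b) (f b)) * g (f b) w)"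
    by (simp add: gl.sum gl.scale)
  also have "\<dots> = l (\<Sum>b\<in>Basis. (g w (f b) / g (f b) (f b)) *\<^sub>R f b)"
    using inner_formD(2)[OF g] by (simp add: linear_sum[OF l] linear_cmul[OF l] mult.commute)
  also have "\<dots> = l w" using f unfolding orthogonal_frame_def by metis
  finally show ?thesis .
qed

lemma raise_index_frame:
  assumes "inner_form (G x)" "orthogonal_frame (G x) f" "linear l"
  shows "raise_index G x l = (\<Sum>b\<in>Basis. (l (f b) / G x (f b) (f b)) *\<^sub>R f b)"
  by (rule raise_index_eqI) (use assms orthogonal_frame_raise in auto)

lemma linear_inner_left: "linear (\<lambda>w. w \<bullet> b)"
  by (simp add: bounded_linear.linear bounded_linear_inner_left)

text \<open>Expand the raised basis covectors in the frame and exchange the two sums; the sum over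
  \<open>Basis\<close> then reassembles the second argument of \<open>B\<close>. Positivity and
  invariance of traces are read off from this form.\<close>

lemma metric_trace_frame:
  assumes g: "inner_form (G x)" and f: "orthogonal_frame (G x) f" and B: "bilinear B"
  shows "metric_trace G x B = (\<Sum>b\<in>Basis. (1 / G x (f b) (f b)) *\<^sub>R B (f b) (f b))"
proof -
  have Bl: "linear (\<lambda>u. B u v)" "linear (B u)" for u v using B by (auto simp: bilinear_def)
  have ri: "raise_index G x (\<lambda>w. w \<bullet> a) = (\<Sum>b\<in>Basis. ((f b \<bullet> a) / G x (f b) (f b)) *\<^sub>R f b)" for a
    by (rule raise_index_frame[where l = "\<lambda>w. w \<bullet> a", OF _ _ linear_inner_left]) (use g f in auto)
  have "metric_trace G x B = (\<Sum>a\<in>Basis. \<Sum>b\<in>Basis. (1 / G x (f b) (f b)) *\<^sub>R B (f b) ((f b \<bullet> a) *\<^sub>R a))"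
    unfolding metric_trace_def ri
    by (intro sum.cong) (auto simp: linear_sum[OF Bl(1)] linear_cmul[OF Bl(1)] linear_cmul[OF Bl(2)])
  also have "\<dots> = (\<Sum>b\<in>Basis. (1 / G x (f b) (f b)) *\<^sub>R B (f b) (\<Sum>a\<in>Basis. (f b \<bullet> a) *\<^sub>R a))"
    by (subst sum.swap) (simp add: linear_sum[OF Bl(2)] scaleR_sum_right)
  finally show ?thesis by (simp add: euclidean_representation)
qed

text \<open>The difference between \<open>v\<close> and its expansion is orthogonal to every frame
  vector, hence to their span, hence to itself.\<close>

lemma orthogonal_frameI:
  assumes g: "inner_form g" and ne: "\<And>b. b \<in> Basis \<Longrightarrow> f b \<noteq> 0"
    and orth: "\<And>b c. b \<in> Basis \<Longrightarrow> c \<in> Basis \<Longrightarrow> b \<noteq> c \<Longrightarrow> g (f b) (f c) = 0"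
    and span: "span (f ` Basis) = UNIV"
  shows "orthogonal_frame g f"
  unfolding orthogonal_frame_def
proof (intro conjI ballI allI impI)
  fix v
  define w where "w = v - (\<Sum>b\<in>Basis. (g v (f b) / g (f b) (f b)) *\<^sub>R f b)"
  have "g w (f c) = 0" if c: "c \<in> Basis" for c
  proof -
    interpret gl: linear "\<lambda>z. g z (f c)" using inner_formD(5)[OF g] .
    have "(\<Sum>b\<in>Basis. (g v (f b) / g (f b) (f b)) * g (f b) (f c))
        = (\<Sum>b\<in>Basis. if b = c then g v (f c) else 0)"
      using orth[OF _ c] inner_formD(3)[OF g ne[OF c]] by (intro sum.cong) auto
    then show ?thesis using c by (simp add: w_def gl.diff gl.sum gl.scale)
  qed
  then have "f ` Basis \<subseteq> {z. g w z = 0}" by auto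
  moreover have "subspace {z. g w z = 0}"
    using linear_subspace_kernel[OF inner_formD(4)[OF g]] .
  ultimately have "span (f ` Basis) \<subseteq> {z. g w z = 0}" by (rule span_minimal)
  then have "g w w = 0" unfolding span by auto
  then have "w = 0" using inner_formD(3)[OF g, of w] by force
  then show "v = (\<Sum>b\<in>Basis. (g v (f b) / g (f b) (f b)) *\<^sub>R f b)" by (simp add: w_def)
qed (use ne orth in auto)

lemma orthogonal_frame_transport:
  assumes g: "inner_form g" and f: "orthogonal_frame g f" and g': "inner_form g'"
    and A: "linear A" "surj A" and iso: "\<And>u v. g u v = g' (A u) (A v)"
  shows "orthogonal_frame g' (\<lambda>b. A (f b))"
  unfolding orthogonal_frame_def
proof (intro conjI ballI allI impI)
  fix v
  obtain w where w: "v = A w" using A(2) by blast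
  have "A w = A (\<Sum>b\<in>Basis. (g w (f b) / g (f b) (f b)) *\<^sub>R f b)"
    using f unfolding orthogonal_frame_def by metis
  then show "v = (\<Sum>b\<in>Basis. (g' v (A (f b)) / g' (A (f b)) (A (f b))) *\<^sub>R A (f b))"
    unfolding w iso by (simp add: linear_sum[OF A(1)] linear_cmul[OF A(1)])
next
  fix b :: 'a assume "b \<in> Basis"
  then have "g (f b) (f b) > 0" using f inner_formD(3)[OF g] by (auto simp: orthogonal_frame_def)
  then show "A (f b) \<noteq> 0" unfolding iso using linear_0[OF inner_formD(4)[OF g']] by force
qed (use f in \<open>auto simp: orthogonal_frame_def iso\<close>)

lemma metric_trace_linear: "linear L \<Longrightarrow> metric_trace G x (\<lambda>u v. L (B u v)) = L (metric_trace G x B)"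
  by (simp add: metric_trace_def linear_sum)

lemma metric_trace_add: "metric_trace G x (\<lambda>u v. B u v + C u v) = metric_trace G x B + metric_trace G x C"
  by (simp add: metric_trace_def sum.distrib)

lemma metric_trace_diff: "metric_trace G x (\<lambda>u v. B u v - C u v) = metric_trace G x B - metric_trace G x C"
  by (simp add: metric_trace_def sum_subtractf)

lemma metric_trace_scaleR: "metric_trace G x (\<lambda>u v. c *\<^sub>R B u v) = c *\<^sub>R metric_trace G x B"
  by (simp add: metric_trace_def scaleR_sum_right)

lemma metric_trace_scaleR_left: "metric_trace G x (\<lambda>u v. B u v *\<^sub>R z) = metric_trace G x B *\<^sub>R z"
  by (simp add: metric_trace_def scaleR_sum_left)

section \<open>A Riemannian metric on a coordinate domain and its smooth orthogonal frames\<close>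

locale coord_riemannian =
  fixes D :: "'m::euclidean_space set" and G :: "'m coord_metric"
  assumes open_D: "open D"
    and inner_form_G: "x \<in> D \<Longrightarrow> inner_form (G x)"
    and smooth_G: "smooth_on D (\<lambda>x. G x u v)"
begin

lemma smooth_G_apply:
  assumes "smooth_on D u" "smooth_on D v"
  shows "smooth_on D (\<lambda>x. G x (u x) (v x))"
proof (rule smooth_on_cong[OF open_D])
  show "smooth_on D (\<lambda>x. \<Sum>b\<in>Basis. \<Sum>c\<in>Basis. (u x \<bullet> b) * ((v x \<bullet> c) * G x b c))"
    by (intro smooth_on_sum smooth_on_mult smooth_on_inner_left smooth_G open_D assms)
  show "(\<Sum>b\<in>Basis. \<Sum>c\<in>Basis. (u x \<bullet> b) * ((v x \<bullet> c) * G x b c)) = G x (u x) (v x)" if "x \<in> D" for x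
  proof -
    note G = inner_formD[OF inner_form_G[OF that]]
    have "G x (u x) (v x) = G x (\<Sum>b\<in>Basis. (u x \<bullet> b) *\<^sub>R b) (\<Sum>c\<in>Basis. (v x \<bullet> c) *\<^sub>R c)"
      by (simp add: euclidean_representation)
    also have "\<dots> = (\<Sum>b\<in>Basis. \<Sum>c\<in>Basis. (u x \<bullet> b) * ((v x \<bullet> c) * G x b c))"
      by (simp only: linear_sum[OF G(5)] linear_sum[OF G(4)] linear_cmul[OF G(5)] linear_cmul[OF G(4)])
        (simp add: sum_distrib_left mult.left_commute, rule sum.swap)
    finally show ?thesis by simp
  qed
qed

text \<open>Gram--Schmidt without normalisation, so that no square roots have to be differentiated.\<close>

lemma smooth_orthogonal_frame_aux:
  assumes "finite B" "B \<subseteq> Basis"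
  shows "\<exists>f. \<forall>b\<in>B. smooth_on D (f b) \<and> (\<forall>x\<in>D. f b x \<noteq> 0 \<and> f b x \<in> span B \<and>
     b \<in> span ((\<lambda>b. f b x) ` B) \<and> (\<forall>c\<in>B. b \<noteq> c \<longrightarrow> G x (f b x) (f c x) = 0))"
  using assms
proof (induction B rule: finite_induct)
  case empty then show ?case by simp
next
  case (insert a B)
  then obtain f where f: "\<And>b. b \<in> B \<Longrightarrow> smooth_on D (f b)"
      "\<And>b x. b \<in> B \<Longrightarrow> x \<in> D \<Longrightarrow> f b x \<noteq> 0"
      "\<And>b x. b \<in> B \<Longrightarrow> x \<in> D \<Longrightarrow> f b x \<in> span B"
      "\<And>b x. b \<in> B \<Longrightarrow> x \<in> D \<Longrightarrow> b \<in> span ((\<lambda>b. f b x) ` B)"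
      "\<And>b c x. b \<in> B \<Longrightarrow> c \<in> B \<Longrightarrow> x \<in> D \<Longrightarrow> b \<noteq> c \<Longrightarrow> G x (f b x) (f c x) = 0"
    by auto
  \<comment> \<open>\<open>p\<close> is the orthogonal projection of the new basis vector
    \<open>a\<close> to the span of the frame built so far. The two span clauses of the induction
    have different uses: \<open>f b x\<close> in \<open>span B\<close> makes \<open>a - p x\<close>
    nonzero by independence of \<open>Basis\<close>, and the other one makes the final frame span
    the whole space.\<close>
  define p where "p = (\<lambda>x. \<Sum>b\<in>B. (G x a (f b x) / G x (f b x) (f b x)) *\<^sub>R f b x)"
  define h where "h = f(a := (\<lambda>x. a - p x))"
  have hB: "h b = f b" if "b \<in> B" for b using that insert.hyps by (auto simp: h_def)
  have ha: "h a x = a - p x" for x by (simp add: h_def)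
  have pos: "G x (f b x) (f b x) > 0" if "x \<in> D" "b \<in> B" for x b
    using inner_formD(3)[OF inner_form_G[OF that(1)] f(2)[OF that(2,1)]] .
  have sp: "smooth_on D p"
    unfolding p_def divide_inverse
    by (intro smooth_on_sum smooth_on_scaleR smooth_on_mult smooth_on_inverse smooth_G_apply open_D f(1) smooth_on_const)
      (use pos in force)+
  have pin: "p x \<in> span B" if "x \<in> D" for x
    unfolding p_def using f(3)[OF _ that] by (intro span_sum span_scale)
  have anot: "a \<notin> span B"
  proof
    have "independent (insert a B)" using independent_mono[OF independent_Basis insert.prems] .
    moreover assume "a \<in> span B"
    ultimately show False using insert.hyps by (simp add: independent_insert)
  qed
  have orth: "G x (h a x) (f c x) = 0" if x: "x \<in> D" and c: "c \<in> B" for x c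
  proof -
    interpret gl: linear "\<lambda>z. G x z (f c x)" using inner_formD(5)[OF inner_form_G[OF x]] .
    have "(\<Sum>b\<in>B. (G x a (f b x) / G x (f b x) (f b x)) * G x (f b x) (f c x))
      = (\<Sum>b\<in>B. if b = c then G x a (f c x) else 0)"
      using f(5)[OF _ c x] pos[OF x c] by (intro sum.cong) auto
    then show ?thesis using c insert.hyps by (simp add: ha p_def gl.diff gl.sum gl.scale)
  qed
  have "smooth_on D (h b) \<and> (\<forall>x\<in>D. h b x \<noteq> 0 \<and> h b x \<in> span (insert a B) \<and>
     b \<in> span ((\<lambda>b. h b x) ` insert a B) \<and> (\<forall>c\<in>insert a B. b \<noteq> c \<longrightarrow> G x (h b x) (h c x) = 0))"
    if b: "b \<in> insert a B" for b
  proof (intro conjI ballI impI)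
    have "smooth_on D (\<lambda>x. a - p x)" by (intro smooth_on_diff open_D smooth_on_const sp)
    then show "smooth_on D (h b)" using b f(1) hB by (cases "b = a") (auto simp: h_def)
  next
    fix x assume x: "x \<in> D"
    show "h b x \<noteq> 0"
      using b f(2)[OF _ x] hB anot pin[OF x] by (cases "b = a") (auto simp: ha)
    have mono: "span B \<subseteq> span (insert a B)" by (rule span_mono) auto
    show "h b x \<in> span (insert a B)"
    proof (cases "b = a")
      case True
      have "a - p x \<in> span (insert a B)" using pin[OF x] mono by (intro span_diff) (auto intro: span_base)
      then show ?thesis using True by (simp add: ha)
    next
      case False
      then show ?thesis using b f(3)[OF _ x, of b] mono hB[of b] by auto
    qed
    have im: "(\<lambda>b. h b x) ` insert a B = insert (a - p x) ((\<lambda>b. f b x) ` B)"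
      using hB by (auto simp: ha)
    have pin': "p x \<in> span ((\<lambda>b. f b x) ` B)"
      unfolding p_def by (intro span_sum span_scale span_base) auto
    have "b \<in> span (insert (a - p x) ((\<lambda>b. f b x) ` B))"
    proof (cases "b = a")
      case True
      have "(a - p x) + p x \<in> span (insert (a - p x) ((\<lambda>b. f b x) ` B))"
        by (intro span_add) (use pin' span_mono[of "(\<lambda>b. f b x) ` B" "insert (a - p x) ((\<lambda>b. f b x) ` B)"] in \<open>auto intro: span_base\<close>)
      then show ?thesis using True by simp
    next
      case False
      then show ?thesis
        using b f(4)[OF _ x, of b] span_mono[of "(\<lambda>b. f b x) ` B" "insert (a - p x) ((\<lambda>b. f b x) ` B)"] by auto
    qed
    then show "b \<in> span ((\<lambda>b. h b x) ` insert a B)" unfolding im .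
  next
    fix x c assume x: "x \<in> D" and c: "c \<in> insert a B" "b \<noteq> c"
    consider "b = a" "c \<in> B" | "c = a" "b \<in> B" | "b \<in> B" "c \<in> B" using b c by auto
    then show "G x (h b x) (h c x) = 0"
    proof cases
      case 1 then show ?thesis using orth[OF x, of c] hB by simp
    next
      case 2 then show ?thesis
        using orth[OF x, of b] hB[of b] inner_formD(2)[OF inner_form_G[OF x], of "h a x" "f b x"] by simp
    next
      case 3 then show ?thesis using f(5)[OF 3 x c(2)] hB by simp
    qed
  qed
  then show ?case by blast
qed

lemma smooth_orthogonal_frame:
  obtains f where "\<And>b. b \<in> Basis \<Longrightarrow> smooth_on D (f b)"
    "\<And>x. x \<in> D \<Longrightarrow> orthogonal_frame (G x) (\<lambda>b. f b x)"
proof -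
  obtain f where f: "\<forall>b\<in>Basis. smooth_on D (f b) \<and> (\<forall>x\<in>D. f b x \<noteq> 0 \<and> f b x \<in> span Basis \<and>
     b \<in> span ((\<lambda>b. f b x) ` Basis) \<and> (\<forall>c\<in>Basis. b \<noteq> c \<longrightarrow> G x (f b x) (f c x) = 0))"
    using smooth_orthogonal_frame_aux[OF finite_Basis order_refl] by blast
  show thesis
  proof (rule that)
    show "smooth_on D (f b)" if "b \<in> Basis" for b using f that by blast
    show "orthogonal_frame (G x) (\<lambda>b. f b x)" if x: "x \<in> D" for x
    proof (rule orthogonal_frameI[OF inner_form_G[OF x]])
      have "Basis \<subseteq> span ((\<lambda>b. f b x) ` Basis)" using f x by blast
      then have "span Basis \<subseteq> span ((\<lambda>b. f b x) ` Basis)" by (rule span_minimal) (rule subspace_span)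
      then show "span ((\<lambda>b. f b x) ` Basis) = UNIV" by auto
    qed (use f x in auto)
  qed
qed

lemma ex_orthogonal_frame:
  assumes "x \<in> D" obtains f where "orthogonal_frame (G x) f"
  using smooth_orthogonal_frame assms by metis

lemma raise_index_works:
  assumes "x \<in> D" "linear l" shows "G x (raise_index G x l) w = l w"
proof -
  obtain f where f: "orthogonal_frame (G x) f" using ex_orthogonal_frame assms by blast
  show ?thesis unfolding raise_index_frame[where G = G and x = x, OF inner_form_G[OF assms(1)] f assms(2)]
    by (rule orthogonal_frame_raise[OF inner_form_G[OF assms(1)] f assms(2)])
qed

text \<open>In a smooth orthogonal frame the vector behind the \<open>THE\<close> becomes an
  explicit quotient with nonvanishing denominators.\<close>

lemma smooth_raise_index:
  assumes "linear l" shows "smooth_on D (\<lambda>x. raise_index G x l)"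
proof -
  obtain f where f: "\<And>b. b \<in> Basis \<Longrightarrow> smooth_on D (f b)"
    "\<And>x. x \<in> D \<Longrightarrow> orthogonal_frame (G x) (\<lambda>b. f b x)" using smooth_orthogonal_frame by blast
  have bl: "bounded_linear l" using assms by (simp add: linear_conv_bounded_linear)
  have "G x (f b x) (f b x) \<noteq> 0" if "x \<in> D" "b \<in> Basis" for x b
    using inner_formD(3)[OF inner_form_G[OF that(1)], of "f b x"] f(2)[OF that(1)] that(2)
    by (force simp: orthogonal_frame_def)
  then have "smooth_on D (\<lambda>x. \<Sum>b\<in>Basis. (l (f b x) * inverse (G x (f b x) (f b x))) *\<^sub>R f b x)"
    by (intro smooth_on_sum smooth_on_scaleR smooth_on_mult smooth_on_inverse smooth_G_apply open_D
        smooth_on_linear[OF open_D bl] f(1)) auto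
  then show ?thesis
    by (rule smooth_on_cong[OF open_D])
      (use raise_index_frame[where G = G, OF inner_form_G f(2) assms] in \<open>simp add: divide_inverse\<close>)
qed

section \<open>Koszul formula and Christoffel symbols\<close>

definition koszul :: "'m \<Rightarrow> 'm \<Rightarrow> 'm \<Rightarrow> 'm \<Rightarrow> real" where
  "koszul x u v w = fderiv (\<lambda>y. G y v w) x u + fderiv (\<lambda>y. G y u w) x v - fderiv (\<lambda>y. G y u v) x w"

lemma fderiv_G_linear:
  assumes x: "x \<in> D"
  shows "linear (\<lambda>v. fderiv (\<lambda>y. G y v w) x u)" "linear (\<lambda>w. fderiv (\<lambda>y. G y v w) x u)"
proof -
  have d: "((\<lambda>y. G y v w) has_derivative fderiv (\<lambda>y. G y v w) x) (at x)" for v w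
    by (rule smooth_on_has_derivative[OF smooth_G x])
  have a: "fderiv (\<lambda>y. G y (v + v') w) x = (\<lambda>u. fderiv (\<lambda>y. G y v w) x u + fderiv (\<lambda>y. G y v' w) x u)"
    and b: "fderiv (\<lambda>y. G y w (v + v')) x = (\<lambda>u. fderiv (\<lambda>y. G y w v) x u + fderiv (\<lambda>y. G y w v') x u)" for v v' w
  proof -
    show "fderiv (\<lambda>y. G y (v + v') w) x = (\<lambda>u. fderiv (\<lambda>y. G y v w) x u + fderiv (\<lambda>y. G y v' w) x u)"
      by (rule fderiv_eqI, rule has_derivative_transform_within_open[OF has_derivative_add[OF d d] open_D x])
        (use bilinear_ladd[OF inner_formD(1)[OF inner_form_G]] in simp)
    show "fderiv (\<lambda>y. G y w (v + v')) x = (\<lambda>u. fderiv (\<lambda>y. G y w v) x u + fderiv (\<lambda>y. G y w v') x u)"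
      by (rule fderiv_eqI, rule has_derivative_transform_within_open[OF has_derivative_add[OF d d] open_D x])
        (use bilinear_radd[OF inner_formD(1)[OF inner_form_G]] in simp)
  qed
  have c: "fderiv (\<lambda>y. G y (r *\<^sub>R v) w) x = (\<lambda>u. r *\<^sub>R fderiv (\<lambda>y. G y v w) x u)"
    and e: "fderiv (\<lambda>y. G y w (r *\<^sub>R v)) x = (\<lambda>u. r *\<^sub>R fderiv (\<lambda>y. G y w v) x u)" for v w r
  proof -
    show "fderiv (\<lambda>y. G y (r *\<^sub>R v) w) x = (\<lambda>u. r *\<^sub>R fderiv (\<lambda>y. G y v w) x u)"
      by (rule fderiv_eqI, rule has_derivative_transform_within_open[OF has_derivative_scaleR_right[OF d] open_D x])
        (use bilinear_lmul[OF inner_formD(1)[OF inner_form_G]] in simp)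
    show "fderiv (\<lambda>y. G y w (r *\<^sub>R v)) x = (\<lambda>u. r *\<^sub>R fderiv (\<lambda>y. G y w v) x u)"
      by (rule fderiv_eqI, rule has_derivative_transform_within_open[OF has_derivative_scaleR_right[OF d] open_D x])
        (use bilinear_rmul[OF inner_formD(1)[OF inner_form_G]] in simp)
  qed
  show "linear (\<lambda>v. fderiv (\<lambda>y. G y v w) x u)" "linear (\<lambda>w. fderiv (\<lambda>y. G y v w) x u)"
    by (rule linearI; simp add: a b c e)+
qed

lemma koszul_linear:
  assumes "x \<in> D"
  shows "linear (koszul x u v)" "linear (\<lambda>v. koszul x u v w)" "linear (\<lambda>u. koszul x u v w)"
  using fderiv_G_linear[OF assms] fderiv_linear[OF smooth_G assms]
  unfolding koszul_def by (auto intro!: linear_compose_add linear_compose_sub)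

text \<open>For fixed \<open>u\<close> and \<open>v\<close> the Koszul expression is a linear form
  in \<open>w\<close>, so raising its index solves the defining equation, and nondegeneracy makes
  the solution unique.\<close>

lemma christoffel_eq:
  assumes x: "x \<in> D"
  shows "christoffel G x u v = (1/2) *\<^sub>R raise_index G x (koszul x u v)"
proof -
  note G = inner_form_G[OF x]
  let ?z = "(1/2) *\<^sub>R raise_index G x (koszul x u v)"
  have z: "2 * G x ?z w = koszul x u v w" for w
    using raise_index_works[OF x koszul_linear(1)[OF x], of u v w] by (simp add: bilinear_lmul[OF inner_formD(1)[OF G]])
  show ?thesis unfolding christoffel_def koszul_def[symmetric]
  proof (rule the_equality)
    show "\<forall>w. 2 * G x ?z w = koszul x u v w" using z by blast
    fix z' assume "\<forall>w. 2 * G x z' w = koszul x u v w"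
    then have "G x z' w = G x ?z w" for w using z[of w] by (metis mult_cancel_left zero_neq_numeral)
    then show "z' = ?z" by (rule inner_form_unique[OF G])
  qed
qed

text \<open>Smoothness of raised indices is known for a form that does not depend on the point. This
  expansion reduces the Koszul form, which does depend on it, to smooth coefficients and the fixed
  basis covectors.\<close>

lemma raise_index_Basis:
  assumes x: "x \<in> D" and l: "linear l"
  shows "raise_index G x l = (\<Sum>b\<in>Basis. l b *\<^sub>R raise_index G x (\<lambda>w. w \<bullet> b))"
proof (rule raise_index_eqI[where G = G and x = x, OF inner_form_G[OF x]])
  fix w
  interpret gl: linear "\<lambda>z. G x z w" using inner_formD(5)[OF inner_form_G[OF x]] .
  have "G x (\<Sum>b\<in>Basis. l b *\<^sub>R raise_index G x (\<lambda>w. w \<bullet> b)) w = (\<Sum>b\<in>Basis. l b * (w \<bullet> b))"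
    by (simp add: gl.sum gl.scale raise_index_works[OF x linear_inner_left])
  also have "\<dots> = l (\<Sum>b\<in>Basis. (w \<bullet> b) *\<^sub>R b)" by (simp add: linear_sum[OF l] linear_cmul[OF l] mult.commute)
  finally show "G x (\<Sum>b\<in>Basis. l b *\<^sub>R raise_index G x (\<lambda>w. w \<bullet> b)) w = l w" by (simp add: euclidean_representation)
qed

lemma christoffel_Basis:
  assumes "x \<in> D"
  shows "christoffel G x u v = (\<Sum>b\<in>Basis. ((1/2) * koszul x u v b) *\<^sub>R raise_index G x (\<lambda>w. w \<bullet> b))"
  unfolding christoffel_eq[OF assms] raise_index_Basis[OF assms koszul_linear(1)[OF assms]]
  by (simp add: scaleR_sum_right)

lemma bilinear_christoffel:
  assumes "x \<in> D"
  shows "bilinear (christoffel G x)"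
  unfolding bilinear_def christoffel_Basis[OF assms]
  by (intro conjI allI linear_compose_sum ballI linear_compose_scale[where 'a='m] linearI)
    (auto simp: linear_add[OF koszul_linear(2)[OF assms]] linear_add[OF koszul_linear(3)[OF assms]]
      linear_cmul[OF koszul_linear(2)[OF assms]] linear_cmul[OF koszul_linear(3)[OF assms]] algebra_simps)

lemma smooth_christoffel: "smooth_on D (\<lambda>x. christoffel G x u v)"
proof (rule smooth_on_cong[OF open_D])
  show "smooth_on D (\<lambda>x. \<Sum>b\<in>Basis. ((1/2) * koszul x u v b) *\<^sub>R raise_index G x (\<lambda>w. w \<bullet> b))"
    unfolding koszul_def
    by (intro smooth_on_sum smooth_on_scaleR smooth_on_mult smooth_on_const smooth_on_add smooth_on_diff
        smooth_on_fderiv smooth_G smooth_raise_index linear_inner_left open_D)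
qed (simp add: christoffel_Basis)

lemma smooth_metric_trace:
  fixes B :: "'m \<Rightarrow> 'm \<Rightarrow> 'm \<Rightarrow> 'v::euclidean_space"
  assumes "\<And>x. x \<in> D \<Longrightarrow> bilinear (B x)" "\<And>u v. smooth_on D (\<lambda>x. B x u v)"
  shows "smooth_on D (\<lambda>x. metric_trace G x (B x))"
proof (rule smooth_on_cong[OF open_D])
  show "smooth_on D (\<lambda>x. \<Sum>b\<in>Basis. \<Sum>c\<in>Basis. (raise_index G x (\<lambda>w. w \<bullet> b) \<bullet> c) *\<^sub>R B x c b)"
    by (intro smooth_on_sum smooth_on_scaleR smooth_on_inner_left smooth_raise_index linear_inner_left open_D assms(2))
  fix x assume x: "x \<in> D"
  have l: "linear (\<lambda>u. B x u b)" for b using assms(1)[OF x] by (simp add: bilinear_def)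
  have expand: "(\<Sum>c\<in>Basis. (z \<bullet> c) *\<^sub>R B x c b) = B x z b" for z b
  proof -
    have "B x z b = B x (\<Sum>c\<in>Basis. (z \<bullet> c) *\<^sub>R c) b" by (simp add: euclidean_representation)
    then show ?thesis by (simp only: linear_sum[OF l] linear_cmul[OF l])
  qed
  show "(\<Sum>b\<in>Basis. \<Sum>c\<in>Basis. (raise_index G x (\<lambda>w. w \<bullet> b) \<bullet> c) *\<^sub>R B x c b) = metric_trace G x (B x)"
    unfolding metric_trace_def by (intro sum.cong refl expand)
qed

text \<open>In an orthogonal frame the trace is a sum of nonnegative terms with positive weights, so
  a zero trace kills \<open>B\<close> on every frame vector. The linear map \<open>l\<close> then
  vanishes on a frame and hence everywhere; it is the derivative of a map when the trace is its
  squared norm.\<close>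

lemma metric_trace_nonneg:
  assumes x: "x \<in> D" and B: "bilinear B" "\<And>u. B u u \<ge> (0::real)"
  shows "metric_trace G x B \<ge> 0" and "metric_trace G x B = 0 \<Longrightarrow> (\<And>u. B u u = 0 \<Longrightarrow> l u = 0) \<Longrightarrow> linear l \<Longrightarrow> l u = 0"
proof -
  obtain f where f: "orthogonal_frame (G x) f" using ex_orthogonal_frame[OF x] by blast
  note tr = metric_trace_frame[where G = G and x = x, OF inner_form_G[OF x] f B(1)]
  have pos: "G x (f b) (f b) > 0" if "b \<in> Basis" for b
    using f that inner_formD(3)[OF inner_form_G[OF x]] by (auto simp: orthogonal_frame_def)
  have nn: "(1 / G x (f b) (f b)) *\<^sub>R B (f b) (f b) \<ge> 0" if "b \<in> Basis" for b
    using pos[OF that] B(2) by simp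
  show "metric_trace G x B \<ge> 0" unfolding tr by (intro sum_nonneg nn)
  assume z: "metric_trace G x B = 0" and l: "\<And>u. B u u = 0 \<Longrightarrow> l u = 0" "linear l"
  have "l (f b) = 0" if "b \<in> Basis" for b
  proof (rule l(1))
    have "(1 / G x (f b) (f b)) *\<^sub>R B (f b) (f b) = 0"
      using z nn that unfolding tr by (subst (asm) sum_nonneg_eq_0_iff) auto
    then show "B (f b) (f b) = 0" using pos[OF that] by simp
  qed
  moreover have "l u = l (\<Sum>b\<in>Basis. (G x u (f b) / G x (f b) (f b)) *\<^sub>R f b)"
    using f unfolding orthogonal_frame_def by metis
  ultimately show "l u = 0" by (simp add: linear_sum[OF l(2)] linear_cmul[OF l(2)])
qed

end

text \<open>A linear isometry carries an orthogonal frame to an orthogonal frame. The case of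
  interest is the derivative of a transition map between two charts.\<close>

lemma metric_trace_transport:
  fixes G G' :: "'m::euclidean_space coord_metric" and A :: "'m \<Rightarrow> 'm"
  assumes "coord_riemannian D G" "x \<in> D" "inner_form (G' x')" "linear A" "surj A"
    "\<And>u v. G x u v = G' x' (A u) (A v)" "bilinear B'"
  shows "metric_trace G x (\<lambda>u v. B' (A u) (A v)) = metric_trace G' x' B'"
proof -
  interpret coord_riemannian D G by fact
  obtain f where f: "orthogonal_frame (G x) f" using ex_orthogonal_frame[OF assms(2)] by blast
  have g: "inner_form (G x)" using inner_form_G[OF assms(2)] .
  have f': "orthogonal_frame (G' x') (\<lambda>b. A (f b))"
    using orthogonal_frame_transport[OF g f assms(3-5)] assms(6) by blast
  have "linear (\<lambda>u. B' (A u) v)" "linear (\<lambda>v. B' u (A v))" for u v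
    using assms(7) linear_compose[OF assms(4)] by (auto simp: bilinear_def o_def)
  then have "bilinear (\<lambda>u v. B' (A u) (A v))" by (simp add: bilinear_def)
  from metric_trace_frame[where G = G and x = x, OF g f this] metric_trace_frame[where G = G' and x = x', OF assms(3) f' assms(7)]
  show ?thesis by (simp add: assms(6))
qed

section \<open>Spheres in Euclidean space and maps into them\<close>

definition hessian :: "'m::euclidean_space coord_metric \<Rightarrow> ('m \<Rightarrow> 'v::euclidean_space) \<Rightarrow> 'm \<Rightarrow> 'm \<Rightarrow> 'm \<Rightarrow> 'v" where
  "hessian G f x u v = fderiv (\<lambda>y. fderiv f y v) x u - fderiv f x (christoffel G x u v)"

text \<open>The analyst's sign (trace of the Hessian), opposite to that of
  \<open>rough_laplacian\<close>. Vector-valued functions are treated as maps into a flat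
  space.\<close>

definition laplacian :: "'m::euclidean_space coord_metric \<Rightarrow> ('m \<Rightarrow> 'v::euclidean_space) \<Rightarrow> 'm \<Rightarrow> 'v" where
  "laplacian G f x = metric_trace G x (hessian G f x)"

definition deriv_normsq :: "'m::euclidean_space coord_metric \<Rightarrow> ('m \<Rightarrow> 'v::euclidean_space) \<Rightarrow> 'm \<Rightarrow> real" where
  "deriv_normsq G f x = metric_trace G x (\<lambda>u v. fderiv f x u \<bullet> fderiv f x v)"

lemma fderiv_inner:
  assumes "f differentiable (at x)" "g differentiable (at x)"
  shows "fderiv (\<lambda>y. f y \<bullet> g y) x u = f x \<bullet> fderiv g x u + fderiv f x u \<bullet> g x"
  using fderiv_eqI[OF has_derivative_inner[OF has_derivative_fderiv[OF assms(1)] has_derivative_fderiv[OF assms(2)]]]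
  by simp

lemma fderiv_scaleR:
  assumes "f differentiable (at x)" "g differentiable (at x)"
  shows "fderiv (\<lambda>y. f y *\<^sub>R g y) x u = f x *\<^sub>R fderiv g x u + fderiv f x u *\<^sub>R g x"
  using fderiv_eqI[OF has_derivative_scaleR[OF has_derivative_fderiv[OF assms(1)] has_derivative_fderiv[OF assms(2)]]]
  by simp

lemma fderiv_add:
  assumes "f differentiable (at x)" "g differentiable (at x)"
  shows "fderiv (\<lambda>y. f y + g y) x u = fderiv f x u + fderiv g x u"
  using fderiv_eqI[OF has_derivative_add[OF has_derivative_fderiv[OF assms(1)] has_derivative_fderiv[OF assms(2)]]]
  by simp

lemma fderiv_diff:
  assumes "f differentiable (at x)" "g differentiable (at x)"
  shows "fderiv (\<lambda>y. f y - g y) x u = fderiv f x u - fderiv g x u"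
  using fderiv_eqI[OF has_derivative_diff[OF has_derivative_fderiv[OF assms(1)] has_derivative_fderiv[OF assms(2)]]]
  by simp

lemma fderiv_bounded_linear:
  assumes "bounded_linear L" "f differentiable (at x)"
  shows "fderiv (\<lambda>y. L (f y)) x u = L (fderiv f x u)"
  using fderiv_eqI[OF bounded_linear.has_derivative[OF assms(1) has_derivative_fderiv[OF assms(2)]]]
  by simp

text \<open>The axiom \<open>left_inverse\<close> is the local ambient extension of the coordinate
  map that a chart of a submanifold provides. It yields both the injectivity of the derivative of
  \<open>P\<close> and a smooth way to undo that derivative.\<close>

locale regular_param =
  fixes P :: "'e::euclidean_space \<Rightarrow> 'v::euclidean_space" and D :: "'e set"
  assumes open_D: "open D" and smooth_P: "smooth_on D P"
    and left_inverse: "x \<in> D \<Longrightarrow> \<exists>W c. open W \<and> P x \<in> W \<and> smooth_on W c \<and> (\<forall>y\<in>D. P y \<in> W \<longrightarrow> c (P y) = y)"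
begin

lemmas P_differentiable = smooth_on_differentiable[OF smooth_P]
lemmas linear_DP = fderiv_linear[OF smooth_P]

lemma left_inverse_fderiv:
  assumes "open W" "smooth_on W c" "\<And>y. y \<in> D \<Longrightarrow> P y \<in> W \<Longrightarrow> c (P y) = y" and x: "x \<in> D" "P x \<in> W"
  shows "fderiv c (P x) (fderiv P x u) = u"
proof -
  have "open (D \<inter> P -` W)"
    by (rule continuous_open_preimage[OF smooth_on_continuous_on[OF smooth_P] open_D assms(1)])
  then have "fderiv (\<lambda>y. c (P y)) x = fderiv (\<lambda>y. y) x"
    by (rule fderiv_cong_open) (use assms in auto)
  then show ?thesis
    using fderiv_compose[OF P_differentiable[OF x(1)] smooth_on_differentiable[OF assms(2) x(2)], of u] by simp
qed

lemma DP_inj: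
  assumes x: "x \<in> D" and "fderiv P x u = fderiv P x v" shows "u = v"
proof -
  obtain W c where "open W" "P x \<in> W" "smooth_on W c" "\<And>y. y \<in> D \<Longrightarrow> P y \<in> W \<Longrightarrow> c (P y) = y"
    using left_inverse[OF x] by blast
  then show ?thesis using left_inverse_fderiv[of W c x u] left_inverse_fderiv[of W c x v] assms by metis
qed

lemma DP_eq_0: "x \<in> D \<Longrightarrow> fderiv P x u = 0 \<longleftrightarrow> u = 0"
  using DP_inj[of x u 0] linear_0[OF linear_DP] by auto

text \<open>The derivative of a local left inverse of \<open>P\<close> recovers \<open>V\<close>
  smoothly from its ambient image. Tension fields and covariant derivatives are accessible only
  through such images.\<close>

lemma smooth_lift:
  assumes "open W" "smooth_on W F" "F ` W \<subseteq> D" "smooth_on W (\<lambda>y. fderiv P (F y) (V y))"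
  shows "smooth_on W V"
proof (rule smooth_on_local)
  fix x assume x: "x \<in> W"
  then have Fx: "F x \<in> D" using assms(3) by blast
  obtain Wc c where c: "open Wc" "P (F x) \<in> Wc" "smooth_on Wc c" "\<And>y. y \<in> D \<Longrightarrow> P y \<in> Wc \<Longrightarrow> c (P y) = y"
    using left_inverse[OF Fx] by blast
  have sP: "smooth_on W (\<lambda>y. P (F y))" by (rule smooth_on_compose[OF assms(1,3,2) smooth_P])
  define W' where "W' = W \<inter> (\<lambda>y. P (F y)) -` Wc"
  have W': "open W'" unfolding W'_def
    by (rule continuous_open_preimage[OF smooth_on_continuous_on[OF sP] assms(1) c(1)])
  have sub: "W' \<subseteq> W" by (auto simp: W'_def)
  have "smooth_on W' (\<lambda>y. fderiv c (P (F y)) (fderiv P (F y) (V y)))"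
    by (rule smooth_on_fderiv_apply[OF W' smooth_on_subset[OF sP sub] _ c(3) smooth_on_subset[OF assms(4) sub]])
      (auto simp: W'_def)
  moreover have "fderiv c (P (F y)) (fderiv P (F y) (V y)) = V y" if "y \<in> W'" for y
    by (rule left_inverse_fderiv[OF c(1,3,4)]) (use that assms(3) in \<open>auto simp: W'_def\<close>)
  ultimately have "smooth_on W' V" by (rule smooth_on_cong[OF W'])
  then show "\<exists>W. open W \<and> x \<in> W \<and> smooth_on W V" using W' x c(2) by (auto simp: W'_def)
qed

end

text \<open>
  A parametrisation of an open piece of a round sphere of curvature \<open>\<kappa>\<close> whose tangent spaces are the
  hyperplanes orthogonal to \<open>\<nu>\<close> in the range of the projection \<open>\<pi>\<close>; then \<open>\<nu>\<close> is the centre-to-point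
  vector, rescaled so that \<open>- \<langle>X, Y\<rangle> \<nu>\<close> is the second fundamental form of the sphere in that range. The
  unit sphere is the case \<open>\<pi> = id\<close>, \<open>\<kappa> = 1\<close>; the small sphere is the case \<open>\<pi> (x, t) = (x, 0)\<close>, \<open>\<kappa> = 2\<close>.
\<close>

locale spherical_param = regular_param P D
  for P :: "'e::euclidean_space \<Rightarrow> 'v::euclidean_space" and D +
  fixes \<pi> :: "'v \<Rightarrow> 'v" and \<kappa> :: real
  assumes kappa_pos: "\<kappa> > 0"
    and linear_proj: "bounded_linear \<pi>" and proj_proj: "\<pi> (\<pi> z) = \<pi> z"
    and proj_fderiv: "x \<in> D \<Longrightarrow> \<pi> (fderiv P x u) = fderiv P x u"
    and radius: "x \<in> D \<Longrightarrow> (\<kappa> *\<^sub>R \<pi> (P x)) \<bullet> (\<kappa> *\<^sub>R \<pi> (P x)) = \<kappa>"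
    and tangent_space: "x \<in> D \<Longrightarrow> \<pi> z = z \<Longrightarrow> z \<bullet> \<pi> (P x) = 0 \<Longrightarrow> \<exists>u. z = fderiv P x u"
begin

abbreviation H :: "'e coord_metric" where "H \<equiv> \<lambda>x u v. fderiv P x u \<bullet> fderiv P x v"

definition \<nu> :: "'e \<Rightarrow> 'v" where "\<nu> x = \<kappa> *\<^sub>R \<pi> (P x)"

lemma smooth_nu: "smooth_on D \<nu>"
proof -
  have "smooth_on D (\<lambda>x. \<kappa> *\<^sub>R \<pi> (P x))"
    by (intro smooth_on_scaleR smooth_on_const smooth_on_linear[OF open_D linear_proj] open_D smooth_P)
  then show ?thesis by (simp add: \<nu>_def[abs_def])
qed

lemma nu_nu: "x \<in> D \<Longrightarrow> \<nu> x \<bullet> \<nu> x = \<kappa>"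
  using radius by (simp add: \<nu>_def)

lemma fderiv_nu:
  assumes "x \<in> D" shows "fderiv \<nu> x u = \<kappa> *\<^sub>R fderiv P x u"
proof -
  have "bounded_linear (\<lambda>z. \<kappa> *\<^sub>R \<pi> z)" using linear_proj by (rule bounded_linear_const_scaleR)
  from fderiv_bounded_linear[OF this P_differentiable[OF assms]]
  show ?thesis using proj_fderiv[OF assms] by (simp add: \<nu>_def[abs_def])
qed

lemma nu_orthogonal:
  assumes x: "x \<in> D" shows "fderiv P x u \<bullet> \<nu> x = 0" "\<nu> x \<bullet> fderiv P x u = 0"
proof -
  have d: "\<nu> differentiable (at x)" by (rule smooth_on_differentiable[OF smooth_nu x])
  have "fderiv (\<lambda>y. \<nu> y \<bullet> \<nu> y) x = fderiv (\<lambda>y. \<kappa>) x"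
    by (rule fderiv_cong_open[OF open_D x]) (rule nu_nu)
  then have "\<nu> x \<bullet> fderiv \<nu> x u + fderiv \<nu> x u \<bullet> \<nu> x = 0"
    using fderiv_inner[OF d d, of u] by simp
  then show "fderiv P x u \<bullet> \<nu> x = 0" "\<nu> x \<bullet> fderiv P x u = 0"
    using kappa_pos by (auto simp: fderiv_nu[OF x] inner_commute)
qed

lemma tangent_decomposition:
  assumes x: "x \<in> D" and z: "\<pi> z = z"
  shows "\<exists>u. z = fderiv P x u + ((z \<bullet> \<nu> x) / \<kappa>) *\<^sub>R \<nu> x"
proof -
  interpret \<pi>: linear \<pi> using linear_proj by (rule bounded_linear.linear)
  let ?z = "z - ((z \<bullet> \<nu> x) / \<kappa>) *\<^sub>R \<nu> x"
  have "\<pi> (\<nu> x) = \<nu> x" by (simp add: \<nu>_def \<pi>.scale proj_proj)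
  then have "\<pi> ?z = ?z" by (simp add: \<pi>.diff \<pi>.scale z)
  moreover have "?z \<bullet> \<nu> x = 0" using nu_nu[OF x] kappa_pos by (simp add: inner_diff_left)
  then have "?z \<bullet> \<pi> (P x) = 0" using kappa_pos by (simp add: \<nu>_def)
  ultimately obtain u where "?z = fderiv P x u" using tangent_space[OF x] by blast
  then show ?thesis by (metis diff_add_cancel)
qed

lemma inner_form_H: assumes "x \<in> D" shows "inner_form (H x)"
proof -
  have "bilinear (H x)"
    unfolding bilinear_def
    using linear_add[OF linear_DP[OF assms]] linear_cmul[OF linear_DP[OF assms]]
    by (auto intro!: linearI simp: inner_add_left inner_add_right)
  then show ?thesis using DP_eq_0[OF assms] by (auto simp: inner_form_def inner_commute)
qed

text \<open>Differentiate the orthogonality of \<open>fderiv P y v\<close> and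
  \<open>\<nu> y\<close>, using that the derivative of \<open>\<nu>\<close> is
  \<open>\<kappa>\<close> times that of \<open>P\<close>.\<close>

lemma second_derivative_nu:
  assumes x: "x \<in> D"
  shows "fderiv (\<lambda>y. fderiv P y v) x u \<bullet> \<nu> x = - \<kappa> * (fderiv P x u \<bullet> fderiv P x v)"
proof -
  have d: "\<nu> differentiable (at x)" "(\<lambda>y. fderiv P y v) differentiable (at x)"
    using smooth_on_differentiable smooth_nu smooth_on_fderiv[OF smooth_P] x by blast+
  have "fderiv (\<lambda>y. fderiv P y v \<bullet> \<nu> y) x = fderiv (\<lambda>y. 0) x"
    by (rule fderiv_cong_open[OF open_D x]) (rule nu_orthogonal)
  then show ?thesis
    using fderiv_inner[OF d(2,1), of u] by (simp add: fderiv_nu[OF x] inner_commute)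
qed

text \<open>Gauss formula. The second derivative of \<open>P\<close> stays in the range of
  \<open>\<pi>\<close> and its normal component is known, so adding the \<open>\<nu>\<close> term
  makes it tangent; the resulting tangent vector satisfies the Koszul formula, which determines
  it.\<close>

lemma DP_christoffel:
  assumes x: "x \<in> D"
  shows "fderiv P x (christoffel H x u v) =
    fderiv (\<lambda>y. fderiv P y v) x u + (fderiv P x u \<bullet> fderiv P x v) *\<^sub>R \<nu> x"
proof -
  define S where "S = (\<lambda>u v. fderiv (\<lambda>y. fderiv P y v) x u)"
  have sym: "S u v = S v u" for u v unfolding S_def by (rule fderiv_symmetric[OF open_D smooth_P x])
  have d: "(\<lambda>y. fderiv P y v) differentiable (at x)" for v
    using smooth_on_differentiable smooth_on_fderiv[OF smooth_P] x by blast
  have "\<pi> (S u v) = S u v"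
  proof -
    have "fderiv (\<lambda>y. \<pi> (fderiv P y v)) x = fderiv (\<lambda>y. fderiv P y v) x"
      by (rule fderiv_cong_open[OF open_D x]) (rule proj_fderiv)
    then show ?thesis using fderiv_bounded_linear[OF linear_proj d, of v u] by (simp add: S_def)
  qed
  from tangent_decomposition[OF x this] obtain z
    where "S u v = fderiv P x z + (S u v \<bullet> \<nu> x / \<kappa>) *\<^sub>R \<nu> x" by blast
  moreover have "S u v \<bullet> \<nu> x / \<kappa> = - (fderiv P x u \<bullet> fderiv P x v)"
    using second_derivative_nu[OF x, of v u] kappa_pos by (simp add: S_def)
  ultimately have z: "fderiv P x z = S u v + (fderiv P x u \<bullet> fderiv P x v) *\<^sub>R \<nu> x"
    by (metis add.commute add_diff_cancel_left' diff_minus_eq_add scaleR_minus_left)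
  have k: "fderiv (\<lambda>y. H y a b) x c = fderiv P x a \<bullet> S c b + S c a \<bullet> fderiv P x b" for a b c
    using fderiv_inner[OF d d] by (simp add: S_def)
  \<comment> \<open>By symmetry of \<open>S\<close> four of the six terms on the right cancel and
    the other two agree; the \<open>\<nu>\<close> term in the image of \<open>z\<close> is invisible
    against tangent vectors.\<close>
  have eq: "2 * H x z w = fderiv (\<lambda>y. H y v w) x u + fderiv (\<lambda>y. H y u w) x v - fderiv (\<lambda>y. H y u v) x w" for w
    unfolding k z using sym[of u w] sym[of v w] sym[of u v] nu_orthogonal[OF x]
    by (simp add: inner_add_left inner_add_right inner_commute)
  have "christoffel H x u v = z" unfolding christoffel_def
  proof (rule the_equality)
    show "\<forall>w. 2 * H x z w = fderiv (\<lambda>y. H y v w) x u + fderiv (\<lambda>y. H y u w) x v - fderiv (\<lambda>y. H y u v) x w"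
      using eq by blast
    fix z' assume z': "\<forall>w. 2 * H x z' w = fderiv (\<lambda>y. H y v w) x u + fderiv (\<lambda>y. H y u w) x v - fderiv (\<lambda>y. H y u v) x w"
    have "H x z' w = H x z w" for w using z'[rule_format, of w] eq[of w] by linarith
    then show "z' = z" by (rule inner_form_unique[OF inner_form_H[OF x]])
  qed
  then show ?thesis using z by (simp add: S_def)
qed

text \<open>The Christoffel term of the connection contributes exactly the second derivative of
  \<open>P\<close> that the product rule asks for, plus the normal correction. Every later covariant
  derivative is computed through this identity.\<close>

lemma DP_pullback_conn:
  assumes "F differentiable (at x)" "V differentiable (at x)" "F x \<in> D"
  shows "fderiv P (F x) (pullback_conn H F X V x) =
    fderiv (\<lambda>y. fderiv P (F y) (V y)) x (X x) +
    (fderiv P (F x) (fderiv F x (X x)) \<bullet> fderiv P (F x) (V x)) *\<^sub>R \<nu> (F x)"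
  using fderiv_eqI[OF has_derivative_fderiv_apply[OF assms(1,2) open_D smooth_P assms(3)]]
  by (simp add: pullback_conn_def linear_add[OF linear_DP[OF assms(3)]] DP_christoffel[OF assms(3)])

lemma smooth_pullback_conn:
  assumes "open W" "smooth_on W F" "F ` W \<subseteq> D" "smooth_on W V" "smooth_on W X"
  shows "smooth_on W (pullback_conn H F X V)"
proof (rule smooth_lift[OF assms(1-3)])
  have sV: "smooth_on W (\<lambda>y. fderiv P (F y) (V y))"
    by (rule smooth_on_fderiv_apply[OF assms(1-3) smooth_P assms(4)])
  have sX: "smooth_on W (\<lambda>y. fderiv F y (X y))"
    by (rule smooth_on_fderiv_apply[OF assms(1) smooth_on_ident[OF assms(1)] _ assms(2,5)]) auto
  have "smooth_on W (\<lambda>x. fderiv (\<lambda>y. fderiv P (F y) (V y)) x (X x))"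
    by (rule smooth_on_fderiv_apply[OF assms(1) smooth_on_ident[OF assms(1)] _ sV assms(5)]) auto
  moreover have "smooth_on W (\<lambda>x. (fderiv P (F x) (fderiv F x (X x)) \<bullet> fderiv P (F x) (V x)) *\<^sub>R \<nu> (F x))"
    by (intro smooth_on_scaleR smooth_on_inner sV assms smooth_on_compose[OF assms(1,3,2) smooth_nu]
        smooth_on_fderiv_apply[OF assms(1-3) smooth_P sX])
  ultimately have "smooth_on W (\<lambda>x. fderiv (\<lambda>y. fderiv P (F y) (V y)) x (X x)
    + (fderiv P (F x) (fderiv F x (X x)) \<bullet> fderiv P (F x) (V x)) *\<^sub>R \<nu> (F x))"
    by (rule smooth_on_add[OF assms(1)])
  then show "smooth_on W (\<lambda>y. fderiv P (F y) (pullback_conn H F X V y))"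
    by (rule smooth_on_cong[OF assms(1)], intro DP_pullback_conn[symmetric])
      (use assms smooth_on_differentiable in blast)+
qed

lemma levi_civita_eq_pullback: "levi_civita H X Y = pullback_conn H (\<lambda>x. x) X Y"
  by (simp add: levi_civita_def pullback_conn_def)

text \<open>Gauss equation for constant curvature \<open>\<kappa>\<close>. Third derivatives of
  \<open>P\<close> cancel by symmetry, and the curvature terms come from differentiating the factor
  \<open>\<nu>\<close> of the normal correction.\<close>

lemma DP_curvature:
  assumes x: "x \<in> D"
  shows "fderiv P x (curvature H x u v w) =
    (\<kappa> * (fderiv P x v \<bullet> fderiv P x w)) *\<^sub>R fderiv P x u - (\<kappa> * (fderiv P x u \<bullet> fderiv P x w)) *\<^sub>R fderiv P x v"
proof -
  note c = smooth_on_const[OF open_D] and i = smooth_on_ident[OF open_D]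
  have conn: "smooth_on D (levi_civita H (\<lambda>_. v) (\<lambda>_. w))" for v w
    unfolding levi_civita_eq_pullback by (rule smooth_pullback_conn[OF open_D i _ c c]) auto
  define K where "K = (\<lambda>u v. levi_civita H (\<lambda>_. u) (levi_civita H (\<lambda>_. v) (\<lambda>_. w)) x)"
  define S where "S = (\<lambda>u v. fderiv (\<lambda>y. fderiv (\<lambda>y. fderiv P y w) y v) x u)"
  \<comment> \<open>The coefficient \<open>r\<close> of \<open>\<nu>\<close> is left unspecified: it
    disappears once the curvature is known to be tangent.\<close>
  have step: "\<exists>r. fderiv P x (K u v) = S u v + (\<kappa> * (fderiv P x v \<bullet> fderiv P x w)) *\<^sub>R fderiv P x u + r *\<^sub>R \<nu> x" for u v
  proof -
    let ?V = "levi_civita H (\<lambda>_. v) (\<lambda>_. w)"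
    let ?h = "\<lambda>y. fderiv (\<lambda>y. fderiv P y w) y v"
    let ?g = "\<lambda>y. fderiv P y v \<bullet> fderiv P y w"
    have V: "fderiv P y (?V y) = ?h y + ?g y *\<^sub>R \<nu> y" if "y \<in> D" for y
      unfolding levi_civita_eq_pullback using DP_pullback_conn[of "\<lambda>x. x" y "\<lambda>_. w" "\<lambda>_. v"] that by simp
    have "fderiv P x (K u v) = fderiv (\<lambda>y. fderiv P y (?V y)) x u + (fderiv P x u \<bullet> fderiv P x (?V x)) *\<^sub>R \<nu> x"
      unfolding K_def levi_civita_eq_pullback[of "\<lambda>_. u"]
      using DP_pullback_conn[of "\<lambda>x. x" x ?V "\<lambda>_. u"] x smooth_on_differentiable[OF conn x] by simp
    moreover have "fderiv (\<lambda>y. fderiv P y (?V y)) x = fderiv (\<lambda>y. ?h y + ?g y *\<^sub>R \<nu> y) x"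
      by (rule fderiv_cong_open[OF open_D x V])
    moreover have sg: "smooth_on D ?g" and sh: "smooth_on D ?h"
      by (intro smooth_on_inner smooth_on_fderiv smooth_P open_D)+
    have "fderiv (\<lambda>y. ?h y + ?g y *\<^sub>R \<nu> y) x u = S u v + (?g x *\<^sub>R fderiv \<nu> x u + fderiv ?g x u *\<^sub>R \<nu> x)"
      using fderiv_add[of ?h x "\<lambda>y. ?g y *\<^sub>R \<nu> y" u] fderiv_scaleR[of ?g x \<nu> u]
        smooth_on_differentiable[OF sh x] smooth_on_differentiable[OF sg x] smooth_on_differentiable[OF smooth_nu x]
        smooth_on_differentiable[OF smooth_on_scaleR[OF open_D sg smooth_nu] x]
      by (simp add: S_def)
    ultimately have "fderiv P x (K u v) = S u v + (\<kappa> * (fderiv P x v \<bullet> fderiv P x w)) *\<^sub>R fderiv P x u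
       + (fderiv ?g x u + fderiv P x u \<bullet> fderiv P x (?V x)) *\<^sub>R \<nu> x"
      by (simp add: fderiv_nu[OF x] algebra_simps)
    then show ?thesis by blast
  qed
  have sym: "S u v = S v u"
    unfolding S_def by (rule fderiv_symmetric[OF open_D smooth_on_fderiv[OF smooth_P] x])
  have zero: "levi_civita H (lie_bracket (\<lambda>_. u) (\<lambda>_. v)) (\<lambda>_. w) x = 0"
    by (simp add: DP_eq_0[OF x, symmetric] levi_civita_def lie_bracket_def DP_christoffel[OF x]
        linear_0[OF linear_DP[OF x]] linear_0[OF fderiv_linear[OF smooth_on_fderiv[OF smooth_P] x]])
  have "curvature H x u v w = K u v - K v u"
    unfolding curvature_def curvature_field_def zero K_def by simp
  then have eq: "fderiv P x (curvature H x u v w) = fderiv P x (K u v) - fderiv P x (K v u)"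
    by (simp add: linear_diff[OF linear_DP[OF x]])
  obtain r s where r: "fderiv P x (K u v) = S u v + (\<kappa> * (fderiv P x v \<bullet> fderiv P x w)) *\<^sub>R fderiv P x u + r *\<^sub>R \<nu> x"
    and s: "fderiv P x (K v u) = S v u + (\<kappa> * (fderiv P x u \<bullet> fderiv P x w)) *\<^sub>R fderiv P x v + s *\<^sub>R \<nu> x"
    using step by blast
  have *: "fderiv P x (curvature H x u v w) = (\<kappa> * (fderiv P x v \<bullet> fderiv P x w)) *\<^sub>R fderiv P x u
    - (\<kappa> * (fderiv P x u \<bullet> fderiv P x w)) *\<^sub>R fderiv P x v + (r - s) *\<^sub>R \<nu> x"
    unfolding eq r s sym by (simp add: algebra_simps)
  \<comment> \<open>Pairing with \<open>\<nu>\<close> kills the left-hand side and the first two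
    terms of \<open>*\<close>, all of which are tangent.\<close>
  have "(r - s) * \<kappa> = 0"
    using arg_cong[OF *, of "\<lambda>z. z \<bullet> \<nu> x"] nu_orthogonal(1)[OF x] nu_nu[OF x]
    by (simp add: inner_add_left inner_diff_left)
  then show ?thesis using * kappa_pos by simp
qed

end

section \<open>Maps into a sphere, expressed in the ambient space\<close>

locale spherical_map = spherical_param P D \<pi> \<kappa> + coord_riemannian W G
  for P :: "'e::euclidean_space \<Rightarrow> 'v::euclidean_space" and D \<pi> \<kappa>
    and W :: "'m::euclidean_space set" and G +
  fixes F :: "'m \<Rightarrow> 'e"
  assumes smooth_F: "smooth_on W F" and F_D: "x \<in> W \<Longrightarrow> F x \<in> D"
begin

abbreviation \<Phi> :: "'m \<Rightarrow> 'v" where "\<Phi> \<equiv> \<lambda>x. P (F x)"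

lemma F_image: "F ` W \<subseteq> D" using F_D by blast

lemma open_W: "open W" by (rule coord_riemannian.open_D) (rule coord_riemannian_axioms)

lemma smooth_Phi: "smooth_on W \<Phi>"
  by (rule smooth_on_compose[OF open_W F_image smooth_F smooth_P])

lemma fderiv_Phi: "x \<in> W \<Longrightarrow> fderiv P (F x) (fderiv F x u) = fderiv \<Phi> x u"
  using fderiv_compose[OF smooth_on_differentiable[OF smooth_F] P_differentiable[OF F_D]] by simp

lemma DP_second_fundamental_form:
  assumes x: "x \<in> W"
  shows "fderiv P (F x) (second_fundamental_form G H F x u v) =
    hessian G \<Phi> x u v + (fderiv \<Phi> x u \<bullet> fderiv \<Phi> x v) *\<^sub>R \<nu> (F x)"
proof -
  have d: "(\<lambda>y. fderiv F y v) differentiable (at x)"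
    by (rule smooth_on_differentiable[OF smooth_on_fderiv[OF smooth_F] x])
  have "fderiv (\<lambda>y. fderiv P (F y) (fderiv F y v)) x = fderiv (\<lambda>y. fderiv \<Phi> y v) x"
    by (rule fderiv_cong_open[OF open_W x]) (rule fderiv_Phi)
  then show ?thesis
    using DP_pullback_conn[OF smooth_on_differentiable[OF smooth_F x] d F_D[OF x], of "\<lambda>_. u"]
    by (simp add: second_fundamental_form_def linear_diff[OF linear_DP[OF F_D[OF x]]] hessian_def
        levi_civita_def fderiv_Phi[OF x])
qed

text \<open>The trace of the Gauss formula along \<open>F\<close>. Harmonicity thus says that the
  ambient Laplacian of \<open>\<Phi>\<close> is normal, with coefficient given by the energy
  density.\<close>

lemma DP_tension:
  assumes x: "x \<in> W"
  shows "fderiv P (F x) (coord_tension G H F x) = laplacian G \<Phi> x + deriv_normsq G \<Phi> x *\<^sub>R \<nu> (F x)"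
  unfolding coord_tension_def metric_trace_linear[OF linear_DP[OF F_D[OF x]], symmetric]
  by (simp add: DP_second_fundamental_form[OF x] metric_trace_add metric_trace_scaleR_left
      laplacian_def deriv_normsq_def)

lemma energy_density_eq:
  "x \<in> W \<Longrightarrow> coord_energy_density G H F x = 1/2 * deriv_normsq G \<Phi> x"
  by (simp add: coord_energy_density_def deriv_normsq_def fderiv_Phi)

text \<open>
  If the tension field is \<open>q n\<close> for a unit normal \<open>n\<close> along \<open>\<Phi>\<close> with \<open>dn = - d\<Phi>\<close>, then the curvature
  term cancels the quadratic term of the rough Laplacian.
\<close>

lemma DP_bitension:
  assumes unit: "\<kappa> = 1" "\<And>z. \<pi> z = z"
    and n: "smooth_on W n" "\<And>x u. x \<in> W \<Longrightarrow> fderiv n x u = - fderiv \<Phi> x u"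
      "\<And>x u. x \<in> W \<Longrightarrow> fderiv \<Phi> x u \<bullet> n x = 0"
    and q: "smooth_on W q" "\<And>x. x \<in> W \<Longrightarrow> deriv_normsq G \<Phi> x = q x"
    and T: "\<And>x. x \<in> W \<Longrightarrow> laplacian G \<Phi> x + q x *\<^sub>R \<Phi> x = q x *\<^sub>R n x"
    and x: "x \<in> W"
  shows "fderiv P (F x) (coord_bitension G H F x) = laplacian G q x *\<^sub>R n x
     - metric_trace G x (\<lambda>u v. fderiv q x v *\<^sub>R fderiv \<Phi> x u)
     - metric_trace G x (\<lambda>u v. fderiv q x u *\<^sub>R fderiv \<Phi> x v)"
proof -
  have nu: "\<nu> (F y) = \<Phi> y" for y unfolding \<nu>_def by (simp add: unit)
  define \<tau> where "\<tau> = coord_tension G H F"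
  have T': "fderiv P (F y) (\<tau> y) = q y *\<^sub>R n y" if "y \<in> W" for y
    using DP_tension[OF that] T[OF that] q(2)[OF that] by (simp add: \<tau>_def nu)
  note qd = smooth_on_differentiable[OF q(1)] and nd = smooth_on_differentiable[OF n(1)]
    and Phid = smooth_on_differentiable[OF smooth_on_fderiv[OF smooth_Phi]]
    and dqd = smooth_on_differentiable[OF smooth_on_fderiv[OF q(1)]]
    and Fd = smooth_on_differentiable[OF smooth_F]
  have "smooth_on W (\<lambda>y. q y *\<^sub>R n y)" by (rule smooth_on_scaleR[OF open_W q(1) n(1)])
  then have "smooth_on W (\<lambda>y. fderiv P (F y) (\<tau> y))"
    by (rule smooth_on_cong[OF open_W]) (simp only: T')
  then have s\<tau>: "smooth_on W \<tau>" by (rule smooth_lift[OF open_W smooth_F F_image])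
  \<comment> \<open>The normal correction vanishes here because \<open>n\<close> is orthogonal to
    the image of the derivative of \<open>\<Phi>\<close>; the derivative of \<open>n\<close>
    produces the second term.\<close>
  have one: "fderiv P (F y) (pullback_conn H F X \<tau> y) = fderiv q y (X y) *\<^sub>R n y - q y *\<^sub>R fderiv \<Phi> y (X y)"
    if y: "y \<in> W" for X y
  proof -
    have "fderiv (\<lambda>z. fderiv P (F z) (\<tau> z)) y = fderiv (\<lambda>z. q z *\<^sub>R n z) y"
      by (rule fderiv_cong_open[OF open_W y]) (rule T')
    then show ?thesis
      using DP_pullback_conn[OF Fd[OF y] smooth_on_differentiable[OF s\<tau> y] F_D[OF y], of X]
        fderiv_scaleR[OF qd[OF y] nd[OF y], of "X y"]
      by (simp add: T'[OF y] fderiv_Phi[OF y] n(2,3)[OF y])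
  qed
  \<comment> \<open>Of the first covariant derivative only the part along \<open>\<Phi>\<close>
    pairs nontrivially with the derivative of \<open>\<Phi>\<close>, which gives the last term. The
    two mixed terms have \<open>u\<close> and \<open>v\<close> exchanged and are traced
    separately.\<close>
  have two: "fderiv P (F x) (pullback_conn H F (\<lambda>_. u) (pullback_conn H F (\<lambda>_. v) \<tau>) x) =
      fderiv (\<lambda>y. fderiv q y v) x u *\<^sub>R n x - fderiv q x v *\<^sub>R fderiv \<Phi> x u - fderiv q x u *\<^sub>R fderiv \<Phi> x v
      - q x *\<^sub>R fderiv (\<lambda>y. fderiv \<Phi> y v) x u - q x *\<^sub>R ((fderiv \<Phi> x u \<bullet> fderiv \<Phi> x v) *\<^sub>R \<Phi> x)" for u v
  proof -
    have s: "smooth_on W (pullback_conn H F (\<lambda>_. v) \<tau>)"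
      by (rule smooth_pullback_conn[OF open_W smooth_F F_image s\<tau> smooth_on_const[OF open_W]])
    have "fderiv (\<lambda>y. fderiv P (F y) (pullback_conn H F (\<lambda>_. v) \<tau> y)) x
        = fderiv (\<lambda>y. fderiv q y v *\<^sub>R n y - q y *\<^sub>R fderiv \<Phi> y v) x"
      by (rule fderiv_cong_open[OF open_W x]) (rule one)
    moreover have "fderiv (\<lambda>y. fderiv q y v *\<^sub>R n y - q y *\<^sub>R fderiv \<Phi> y v) x u =
        (fderiv q x v *\<^sub>R fderiv n x u + fderiv (\<lambda>y. fderiv q y v) x u *\<^sub>R n x)
        - (q x *\<^sub>R fderiv (\<lambda>y. fderiv \<Phi> y v) x u + fderiv q x u *\<^sub>R fderiv \<Phi> x v)"
      unfolding fderiv_scaleR[OF dqd[OF x] nd[OF x], symmetric] fderiv_scaleR[OF qd[OF x] Phid[OF x], symmetric]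
      by (intro fderiv_diff differentiable_scaleR qd nd Phid dqd x)
    ultimately show ?thesis
      using DP_pullback_conn[OF Fd[OF x] smooth_on_differentiable[OF s x] F_D[OF x], of "\<lambda>_. u"]
      by (simp add: one[OF x] fderiv_Phi[OF x] n(2,3)[OF x] nu inner_diff_right)
  qed
  have "fderiv P (F x) (pullback_conn H F (\<lambda>_. u) (pullback_conn H F (\<lambda>_. v) \<tau>) x
         - pullback_conn H F (levi_civita G (\<lambda>_. u) (\<lambda>_. v)) \<tau> x) =
      hessian G q x u v *\<^sub>R n x - fderiv q x v *\<^sub>R fderiv \<Phi> x u - fderiv q x u *\<^sub>R fderiv \<Phi> x v
      - q x *\<^sub>R hessian G \<Phi> x u v - q x *\<^sub>R ((fderiv \<Phi> x u \<bullet> fderiv \<Phi> x v) *\<^sub>R \<Phi> x)" for u v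
    by (simp add: linear_diff[OF linear_DP[OF F_D[OF x]]] two one[OF x] hessian_def levi_civita_def algebra_simps)
  then have A: "fderiv P (F x) (- rough_laplacian G H F \<tau> x) = laplacian G q x *\<^sub>R n x
     - metric_trace G x (\<lambda>u v. fderiv q x v *\<^sub>R fderiv \<Phi> x u)
     - metric_trace G x (\<lambda>u v. fderiv q x u *\<^sub>R fderiv \<Phi> x v)
     - q x *\<^sub>R laplacian G \<Phi> x - q x *\<^sub>R (q x *\<^sub>R \<Phi> x)"
    unfolding rough_laplacian_def minus_minus metric_trace_linear[OF linear_DP[OF F_D[OF x]], symmetric]
    by (simp only: metric_trace_diff metric_trace_scaleR metric_trace_scaleR_left laplacian_def
        q(2)[OF x, unfolded deriv_normsq_def])
  \<comment> \<open>The hypothesis \<open>T\<close> collapses the terms without derivatives of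
    \<open>q\<close> to a multiple of \<open>n\<close>, exactly the size of the curvature term
    \<open>C\<close>.\<close>
  have B: "q x *\<^sub>R laplacian G \<Phi> x + q x *\<^sub>R (q x *\<^sub>R \<Phi> x) = q x *\<^sub>R (q x *\<^sub>R n x)"
    using T[OF x] by (metis scaleR_add_right)
  have C: "fderiv P (F x) (metric_trace G x (\<lambda>u v.
         curvature H (F x) (fderiv F x u) (\<tau> x) (fderiv F x v))) = - (q x *\<^sub>R (q x *\<^sub>R n x))"
  proof -
    have "fderiv P (F x) (curvature H (F x) (fderiv F x u) (\<tau> x) (fderiv F x v)) =
        (- 1) *\<^sub>R ((fderiv \<Phi> x u \<bullet> fderiv \<Phi> x v) *\<^sub>R (q x *\<^sub>R n x))" for u v
      by (simp add: DP_curvature[OF F_D[OF x]] unit T'[OF x] fderiv_Phi[OF x] inner_commute[of "n x"] n(3)[OF x])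
    then show ?thesis
      unfolding metric_trace_linear[OF linear_DP[OF F_D[OF x]], symmetric]
      by (simp only: metric_trace_scaleR metric_trace_scaleR_left q(2)[OF x, unfolded deriv_normsq_def])
        simp
  qed
  have cancel: "X - a - b - (- c) = X" if "a + b = c" for X a b c :: 'v
    using that by (auto simp: algebra_simps)
  show ?thesis
    unfolding coord_bitension_def \<tau>_def[symmetric] linear_diff[OF linear_DP[OF F_D[OF x]]] A C
    by (rule cancel[OF B])
qed

end

section \<open>The strong maximum principle\<close>

text \<open>Restrict to the line through \<open>x\<close> in direction \<open>w\<close>. The first
  derivative vanishes at the maximum; if the second were positive, the first would be positive just
  after it, and the mean value theorem would give a larger value of \<open>f\<close>.\<close>

lemma second_derivative_nonpos_at_max:
  fixes f :: "'a::euclidean_space \<Rightarrow> real"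
  assumes S: "open S" "smooth_on S f" "x \<in> S" and max: "\<And>y. y \<in> S \<Longrightarrow> f y \<le> f x"
  shows "fderiv f x = (\<lambda>v. 0)" "fderiv (\<lambda>y. fderiv f y w) x w \<le> 0"
proof -
  show D0: "fderiv f x = (\<lambda>v. 0)"
    by (rule differential_zero_maxmin[OF S(3,1) smooth_on_has_derivative[OF S(2,3)]]) (use max in blast)
  show "fderiv (\<lambda>y. fderiv f y w) x w \<le> 0"
  proof (rule ccontr)
    assume "\<not> ?thesis"
    then have s: "fderiv (\<lambda>y. fderiv f y w) x w > 0" by simp
    define g where "g = (\<lambda>t. f (x + t *\<^sub>R w))"
    define g' where "g' = (\<lambda>t. fderiv f (x + t *\<^sub>R w) w)"
    have line: "((\<lambda>t. x + t *\<^sub>R w) has_derivative (\<lambda>r. r *\<^sub>R w)) (at t)" for t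
      by (auto intro!: derivative_eq_intros)
    have "open ((\<lambda>t. x + t *\<^sub>R w) -` S)"
      by (intro open_vimage S(1) continuous_intros)
    moreover have "0 \<in> (\<lambda>t. x + t *\<^sub>R w) -` S" using S(3) by simp
    ultimately obtain d where d0: "d > 0" "ball 0 d \<subseteq> (\<lambda>t. x + t *\<^sub>R w) -` S"
      using open_contains_ball_eq by blast
    have d: "d > 0" "\<And>t. \<bar>t\<bar> < d \<Longrightarrow> x + t *\<^sub>R w \<in> S"
      using d0 by (auto simp: subset_eq dist_real_def)
    have der: "(g has_real_derivative g' t) (at t)" if "\<bar>t\<bar> < d" for t
    proof -
      have "(g has_derivative (\<lambda>r. fderiv f (x + t *\<^sub>R w) (r *\<^sub>R w))) (at t)"
        unfolding g_def
        by (rule has_derivative_compose[where g = f, OF line smooth_on_has_derivative[OF S(2) d(2)[OF that]]])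
      then show ?thesis
        unfolding has_field_derivative_def g'_def
        by (simp add: linear_cmul[OF fderiv_linear[OF S(2) d(2)[OF that]]] mult.commute[of _ "fderiv f _ w"])
    qed
    have "(g' has_derivative (\<lambda>r. fderiv (\<lambda>y. fderiv f y w) x (r *\<^sub>R w))) (at 0)"
      unfolding g'_def
      by (rule has_derivative_compose[where g = "\<lambda>y. fderiv f y w", OF line])
        (use smooth_on_has_derivative[OF smooth_on_fderiv[OF S(2)] S(3)] in simp)
    then have "(g' has_real_derivative fderiv (\<lambda>y. fderiv f y w) x w) (at 0)"
      unfolding has_field_derivative_def
      by (simp add: linear_cmul[OF fderiv_linear[OF smooth_on_fderiv[OF S(2)] S(3)]] mult.commute[of _ "fderiv _ _ w"])
    from DERIV_pos_inc_right[OF this s] obtain d' where d': "d' > 0" "\<And>h. h > 0 \<Longrightarrow> h < d' \<Longrightarrow> g' 0 < g' h"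
      by auto
    define t where "t = min d d' / 2"
    have t: "t > 0" "t < d" "t < d'" using d(1) d'(1) by (auto simp: t_def)
    obtain z where z: "0 < z" "z < t" "g t - g 0 = (t - 0) * g' z"
      using MVT2[OF t(1), of g g'] der t by (metis abs_of_nonneg le_less_trans)
    have "g' z > 0" using d'(2)[of z] z t D0 by (simp add: g'_def)
    then have "g t > g 0" using z t by (metis diff_gt_0_iff_gt diff_zero mult_pos_pos)
    then show False using max[of "x + t *\<^sub>R w"] d(2)[of t] t by (simp add: g_def)
  qed
qed

section \<open>Hessian and Laplacian of functions in one chart\<close>

context coord_riemannian
begin

lemma bilinear_second_derivative:
  assumes f: "smooth_on D f" and x: "x \<in> D"
  shows "bilinear (\<lambda>u v. fderiv (\<lambda>y. fderiv f y v) x u)"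
proof -
  note d = smooth_on_differentiable[OF smooth_on_fderiv[OF f] x]
  have "linear (\<lambda>v. fderiv (\<lambda>y. fderiv f y v) x u)" for u
  proof (rule linearI)
    fix v w
    have "fderiv (\<lambda>y. fderiv f y (v + w)) x = fderiv (\<lambda>y. fderiv f y v + fderiv f y w) x"
      by (rule fderiv_cong_open[OF open_D x]) (rule linear_add[OF fderiv_linear[OF f]])
    then show "fderiv (\<lambda>y. fderiv f y (v + w)) x u = fderiv (\<lambda>y. fderiv f y v) x u + fderiv (\<lambda>y. fderiv f y w) x u"
      using fderiv_add[OF d d] by simp
  next
    fix r v
    have "fderiv (\<lambda>y. fderiv f y (r *\<^sub>R v)) x = fderiv (\<lambda>y. r *\<^sub>R fderiv f y v) x"
      by (rule fderiv_cong_open[OF open_D x]) (rule linear_cmul[OF fderiv_linear[OF f]])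
    then show "fderiv (\<lambda>y. fderiv f y (r *\<^sub>R v)) x u = r *\<^sub>R fderiv (\<lambda>y. fderiv f y v) x u"
      using fderiv_bounded_linear[OF bounded_linear_scaleR_right d] by simp
  qed
  then show ?thesis using fderiv_linear[OF smooth_on_fderiv[OF f] x] by (simp add: bilinear_def)
qed

lemma bilinear_hessian:
  assumes f: "smooth_on D f" and x: "x \<in> D"
  shows "bilinear (hessian G f x)"
proof -
  note a = bilinear_second_derivative[OF f x] and c = bilinear_christoffel[OF x] and l = fderiv_linear[OF f x]
  show ?thesis unfolding bilinear_def hessian_def
    using a c by (auto simp: bilinear_def intro!: linear_compose_sub linear_compose[OF _ l, unfolded o_def])
qed

lemma smooth_laplacian:
  assumes f: "smooth_on D f"
  shows "smooth_on D (laplacian G f)"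
proof -
  have "smooth_on D (\<lambda>x. fderiv f x (christoffel G x u v))" for u v
    by (rule smooth_on_fderiv_apply[OF open_D smooth_on_ident[OF open_D] _ f smooth_christoffel]) simp
  then have "smooth_on D (\<lambda>x. metric_trace G x (hessian G f x))"
    unfolding hessian_def[abs_def]
    by (intro smooth_metric_trace smooth_on_diff open_D smooth_on_fderiv f)
      (use bilinear_hessian[OF f, unfolded hessian_def[abs_def]] in auto)
  then show ?thesis by (simp add: laplacian_def[abs_def])
qed

lemma smooth_deriv_normsq:
  fixes f :: "'m \<Rightarrow> 'v::euclidean_space"
  assumes f: "smooth_on D f"
  shows "smooth_on D (deriv_normsq G f)"
proof -
  have "bilinear (\<lambda>u v. fderiv f x u \<bullet> fderiv f x v)" if "x \<in> D" for x
    unfolding bilinear_def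
    using linear_add[OF fderiv_linear[OF f that]] linear_cmul[OF fderiv_linear[OF f that]]
    by (auto intro!: linearI simp: inner_add_left inner_add_right)
  then have "smooth_on D (\<lambda>x. metric_trace G x (\<lambda>u v. fderiv f x u \<bullet> fderiv f x v))"
    by (intro smooth_metric_trace smooth_on_inner smooth_on_fderiv f open_D)
  then show ?thesis by (simp add: deriv_normsq_def[abs_def])
qed

lemma deriv_normsq_nonneg:
  assumes f: "smooth_on D f" and x: "x \<in> D"
  shows "deriv_normsq G f x \<ge> 0" "deriv_normsq G f x = 0 \<Longrightarrow> fderiv f x u = 0"
proof -
  have b: "bilinear (\<lambda>u v. fderiv f x u \<bullet> fderiv f x v)"
    unfolding bilinear_def
    using linear_add[OF fderiv_linear[OF f x]] linear_cmul[OF fderiv_linear[OF f x]]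
    by (auto intro!: linearI simp: inner_add_left inner_add_right)
  show "deriv_normsq G f x \<ge> 0" unfolding deriv_normsq_def
    by (rule metric_trace_nonneg(1)[OF x b]) simp
  assume z: "deriv_normsq G f x = 0"
  show "fderiv f x u = 0"
    by (rule metric_trace_nonneg(2)[OF x b _ z[unfolded deriv_normsq_def], where l = "fderiv f x"])
      (auto intro: fderiv_linear[OF f x])
qed

lemma laplacian_add:
  assumes "smooth_on D f" "smooth_on D g" and x: "x \<in> D"
  shows "laplacian G (\<lambda>x. f x + g x) x = laplacian G f x + laplacian G g x"
proof -
  note d = smooth_on_differentiable[OF assms(1)] smooth_on_differentiable[OF assms(2)]
  have "fderiv (\<lambda>y. fderiv (\<lambda>x. f x + g x) y v) x = fderiv (\<lambda>y. fderiv f y v + fderiv g y v) x" for v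
    by (rule fderiv_cong_open[OF open_D x]) (rule fderiv_add[OF d])
  then have "hessian G (\<lambda>x. f x + g x) x u v = hessian G f x u v + hessian G g x u v" for u v
    using fderiv_add[OF d[OF x]] x
      fderiv_add[OF smooth_on_differentiable[OF smooth_on_fderiv[OF assms(1)] x] smooth_on_differentiable[OF smooth_on_fderiv[OF assms(2)] x]]
    by (simp add: hessian_def)
  then have "hessian G (\<lambda>x. f x + g x) x = (\<lambda>u v. hessian G f x u v + hessian G g x u v)" by blast
  then show ?thesis by (simp add: laplacian_def metric_trace_add)
qed

lemma laplacian_bounded_linear:
  assumes L: "bounded_linear L" and f: "smooth_on D f" and x: "x \<in> D"
  shows "laplacian G (\<lambda>x. L (f x)) x = L (laplacian G f x)"
proof -
  note d = smooth_on_differentiable[OF f]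
  have "fderiv (\<lambda>y. fderiv (\<lambda>x. L (f x)) y v) x = fderiv (\<lambda>y. L (fderiv f y v)) x" for v
    by (rule fderiv_cong_open[OF open_D x]) (rule fderiv_bounded_linear[OF L d])
  then have "hessian G (\<lambda>x. L (f x)) x u v = L (hessian G f x u v)" for u v
    using fderiv_bounded_linear[OF L d[OF x]] fderiv_bounded_linear[OF L smooth_on_differentiable[OF smooth_on_fderiv[OF f] x]]
    by (simp add: hessian_def linear_diff[OF bounded_linear.linear[OF L]])
  then have "hessian G (\<lambda>x. L (f x)) x = (\<lambda>u v. L (hessian G f x u v))" by blast
  then show ?thesis by (simp add: laplacian_def metric_trace_linear[OF bounded_linear.linear[OF L]])
qed

text \<open>The terms of the product rule that contain the factor \<open>f x\<close> drop out. In
  the barrier below this makes the Laplacian positive at a point where a defining function vanishes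
  but its gradient does not.\<close>

lemma laplacian_square_at_zero:
  fixes f :: "'m \<Rightarrow> real"
  assumes f: "smooth_on D f" and x: "x \<in> D" "f x = 0"
  shows "laplacian G (\<lambda>x. f x * f x) x = 2 * deriv_normsq G f x"
proof -
  note d = smooth_on_differentiable[OF f]
  have m: "fderiv (\<lambda>x. f x * f x) y v = 2 * (f y * fderiv f y v)" if "y \<in> D" for y v
    using fderiv_inner[OF d[OF that] d[OF that], of v] by (simp add: mult.commute)
  have "fderiv (\<lambda>y. fderiv (\<lambda>x. f x * f x) y v) x = fderiv (\<lambda>y. 2 *\<^sub>R (f y \<bullet> fderiv f y v)) x" for v
    by (rule fderiv_cong_open[OF open_D x(1)]) (simp add: m)
  moreover have "fderiv (\<lambda>y. 2 *\<^sub>R (f y \<bullet> fderiv f y v)) x u = 2 *\<^sub>R fderiv (\<lambda>y. f y \<bullet> fderiv f y v) x u" for u v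
    by (rule fderiv_bounded_linear[OF bounded_linear_scaleR_right])
      (rule smooth_on_differentiable[OF smooth_on_inner[OF open_D f smooth_on_fderiv[OF f]] x(1)])
  ultimately have "hessian G (\<lambda>x. f x * f x) x u v = 2 *\<^sub>R (fderiv f x u \<bullet> fderiv f x v)" for u v
    using fderiv_inner[OF d[OF x(1)] smooth_on_differentiable[OF smooth_on_fderiv[OF f] x(1)]] x
    by (simp add: hessian_def m)
  then have "hessian G (\<lambda>x. f x * f x) x = (\<lambda>u v. 2 *\<^sub>R (fderiv f x u \<bullet> fderiv f x v))" by blast
  then show ?thesis by (simp only: laplacian_def metric_trace_scaleR deriv_normsq_def) simp
qed

lemma laplacian_cong:
  assumes "open S" "x \<in> S" "\<And>y. y \<in> S \<Longrightarrow> f y = g y"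
  shows "laplacian G f x = laplacian G g x"
proof -
  have D: "fderiv f y = fderiv g y" if "y \<in> S" for y by (rule fderiv_cong_open[OF assms(1) that assms(3)])
  have "fderiv (\<lambda>y. fderiv f y v) x = fderiv (\<lambda>y. fderiv g y v) x" for v
    by (rule fderiv_cong_open[OF assms(1,2)]) (simp add: D)
  then have "hessian G f x = hessian G g x" by (simp add: hessian_def fun_eq_iff D[OF assms(2)])
  then show ?thesis by (simp add: laplacian_def)
qed

text \<open>At a critical point the Christoffel term of the Hessian vanishes, so the Hessian is the
  plain second derivative and negative semidefinite.\<close>

lemma laplacian_nonpos_at_max:
  assumes f: "smooth_on D f" and S: "open S" "S \<subseteq> D" "x \<in> S" and max: "\<And>y. y \<in> S \<Longrightarrow> f y \<le> (f x :: real)"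
  shows "laplacian G f x \<le> 0"
proof -
  have x: "x \<in> D" using S by blast
  note s = second_derivative_nonpos_at_max[OF S(1) smooth_on_subset[OF f S(2)] S(3) max]
  have "bilinear (\<lambda>u v. - hessian G f x u v)"
    using bilinear_hessian[OF f x] by (auto simp: bilinear_def intro: linear_compose_neg)
  moreover have "- hessian G f x u u \<ge> 0" for u using s by (simp add: hessian_def)
  ultimately have "metric_trace G x (\<lambda>u v. - hessian G f x u v) \<ge> 0"
    by (rule metric_trace_nonneg(1)[OF x])
  then show ?thesis using metric_trace_linear[of uminus G x "hessian G f x"]
    by (simp add: laplacian_def linear_uminus)
qed

text \<open>Hopf's argument, with a polynomial barrier at a point of \<open>{f = max}\<close> nearest to a point outside it.\<close>

lemma strong_maximum_principle:
  fixes f :: "'m \<Rightarrow> real"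
  assumes f: "smooth_on D f" and lap: "\<And>x. x \<in> D \<Longrightarrow> laplacian G f x = 0"
    and x0: "x0 \<in> D" and max: "\<And>x. x \<in> D \<Longrightarrow> f x \<le> f x0"
  shows "\<exists>S. open S \<and> x0 \<in> S \<and> S \<subseteq> D \<and> (\<forall>x\<in>S. f x = f x0)"
proof -
  define m where "m = f x0"
  obtain r0 where r0: "r0 > 0" "cball x0 r0 \<subseteq> D" using open_D x0 by (meson open_contains_cball)
  \<comment> \<open>The margin \<open>2 * R\<close> guarantees that the nearest maximum point
    \<open>z\<close> and the whole ball about \<open>y\<close> reaching up to \<open>z\<close> stay
    inside \<open>D\<close>, as both \<open>y\<close> and \<open>z\<close> are within reach of
    \<open>R\<close>.\<close>
  define R where "R = r0 / 2"
  have R: "R > 0" "cball x0 (2 * R) \<subseteq> D" using r0 by (auto simp: R_def)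
  have cont: "continuous_on D f" by (rule smooth_on_continuous_on[OF f])
  have "f y = m" if y: "y \<in> ball x0 R" for y
  proof (rule ccontr)
    assume ne: "f y \<noteq> m"
    define C where "C = cball x0 (2 * R) \<inter> f -` {m}"
    have "closed C" unfolding C_def
      by (intro continuous_closed_preimage continuous_on_subset[OF cont R(2)]) auto
    moreover have x0C: "x0 \<in> C" using R by (simp add: C_def m_def)
    ultimately obtain z where z: "z \<in> C" "\<And>x. x \<in> C \<Longrightarrow> dist y z \<le> dist y x"
      using distance_attains_inf[of C y] by blast
    define \<rho> where "\<rho> = dist y z"
    have rho: "\<rho> > 0" using ne z(1) by (auto simp: \<rho>_def C_def)
    have rR: "\<rho> < R" using z(2)[OF x0C] y by (simp add: \<rho>_def dist_commute)
    have zin: "z \<in> ball x0 (2 * R)"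
      using rR y dist_triangle[of x0 z y] by (auto simp: \<rho>_def dist_commute)
    have zD: "z \<in> D" using zin R(2) by (auto simp: subset_eq)
    have inner: "f p < m" if p: "dist y p < \<rho>" for p
    proof -
      have pc: "p \<in> cball x0 (2 * R)" using p rR y dist_triangle[of x0 p y] by (auto simp: dist_commute)
      moreover have "f p \<noteq> m" using z(2)[of p] p pc by (auto simp: C_def \<rho>_def)
      ultimately show ?thesis using max[of p] R(2) by (force simp: m_def)
    qed
    \<comment> \<open>\<open>t\<close> is a defining function of the ball about \<open>y\<close>
      with \<open>z\<close> on its boundary, negative inside; \<open>s\<close> is the squared
      distance from \<open>z\<close>. The barrier combines \<open>- t\<close>, a large multiple of
      the square of \<open>t\<close>, and \<open>- s\<close>.\<close>
    define t where "t = (\<lambda>x. (x - y) \<bullet> (x - y) - \<rho>\<^sup>2)"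
    define s where "s = (\<lambda>x. (x - z) \<bullet> (x - z))"
    have st: "smooth_on D t" and ss: "smooth_on D s"
      unfolding t_def s_def by (intro smooth_on_diff smooth_on_inner smooth_on_ident smooth_on_const open_D)+
    have tz: "t z = 0" by (simp add: t_def \<rho>_def dist_norm dot_square_norm norm_minus_commute)
    have tneg: "t x < 0 \<longleftrightarrow> dist y x < \<rho>" for x
    proof -
      have "t x = (dist y x)\<^sup>2 - \<rho>\<^sup>2"
        by (simp add: t_def dot_square_norm dist_norm norm_minus_commute)
      moreover have "(dist y x)\<^sup>2 < \<rho>\<^sup>2 \<longleftrightarrow> dist y x < \<rho>"
        using rho by (metis abs_of_nonneg less_imp_le power2_less_imp_less power_strict_mono zero_le_dist zero_less_numeral)
      ultimately show ?thesis by linarith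
    qed
    have grad: "deriv_normsq G t z > 0"
    proof (rule ccontr)
      assume "\<not> ?thesis"
      then have "deriv_normsq G t z = 0" using deriv_normsq_nonneg(1)[OF st zD] by simp
      then have "fderiv t z (z - y) = 0" by (rule deriv_normsq_nonneg(2)[OF st zD])
      moreover have "(t has_derivative (\<lambda>v. (z - y) \<bullet> v + v \<bullet> (z - y))) (at z)"
        unfolding t_def by (auto intro!: derivative_eq_intros)
      ultimately have "(z - y) \<bullet> (z - y) = 0" using fderiv_eqI by fastforce
      then show False using rho by (simp add: \<rho>_def)
    qed
    \<comment> \<open>At \<open>z\<close> the square of \<open>t\<close> has Laplacian
      \<open>2 * deriv_normsq G t z\<close>, so this \<open>K\<close> lets its contribution outweigh
      those of \<open>t\<close> and \<open>s\<close>, whatever their signs.\<close>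
    define K where "K = (\<bar>laplacian G t z\<bar> + \<bar>laplacian G s z\<bar> + 1) / deriv_normsq G t z"
    have K: "K > 0" using grad by (simp add: K_def add_nonneg_pos)
    define h where "h = (\<lambda>x. (- 1) *\<^sub>R t x + (K *\<^sub>R (t x * t x) + (- 1) *\<^sub>R s x))"
    have sm: "smooth_on D (\<lambda>x. t x * t x)" "smooth_on D (\<lambda>x. K *\<^sub>R (t x * t x))"
       "smooth_on D (\<lambda>x. (- 1) *\<^sub>R t x)" "smooth_on D (\<lambda>x. (- 1) *\<^sub>R s x)"
      by (intro smooth_on_mult smooth_on_linear[OF open_D bounded_linear_scaleR_right] open_D st ss)+
    have sh: "smooth_on D h" unfolding h_def by (intro smooth_on_add open_D sm)
    have "laplacian G h z = - laplacian G t z + (K * (2 * deriv_normsq G t z) - laplacian G s z)"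
      unfolding h_def laplacian_add[OF sm(3) smooth_on_add[OF open_D sm(2,4)] zD] laplacian_add[OF sm(2,4) zD]
        laplacian_bounded_linear[OF bounded_linear_scaleR_right sm(1) zD]
        laplacian_bounded_linear[OF bounded_linear_scaleR_right st zD]
        laplacian_bounded_linear[OF bounded_linear_scaleR_right ss zD]
        laplacian_square_at_zero[OF st zD tz] by simp
    moreover have "K * deriv_normsq G t z = \<bar>laplacian G t z\<bar> + \<bar>laplacian G s z\<bar> + 1"
      using grad by (simp add: K_def)
    ultimately have hz: "laplacian G h z > 0" by argo
    have h0: "h z = 0" by (simp add: h_def tz s_def)
    have "open (D \<inter> laplacian G h -` {0<..})" "open (D \<inter> (\<lambda>x. K * t x) -` {..<1})"
      by (intro continuous_open_preimage open_D smooth_on_continuous_on[OF smooth_laplacian[OF sh]]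
          continuous_on_mult continuous_on_const smooth_on_continuous_on[OF st]; simp)+
    then have "open ((D \<inter> laplacian G h -` {0<..}) \<inter> (D \<inter> (\<lambda>x. K * t x) -` {..<1}))" by (rule open_Int)
    moreover have "z \<in> (D \<inter> laplacian G h -` {0<..}) \<inter> (D \<inter> (\<lambda>x. K * t x) -` {..<1})"
      using zD hz tz by simp
    ultimately obtain r where r: "r > 0" "cball z r \<subseteq> (D \<inter> laplacian G h -` {0<..}) \<inter> (D \<inter> (\<lambda>x. K * t x) -` {..<1})"
      by (meson open_contains_cball)
    have rD: "cball z r \<subseteq> D" using r by blast
    have cf: "continuous_on (cball z r) f" and ch: "continuous_on (cball z r) h"
      using continuous_on_subset[OF cont rD] continuous_on_subset[OF smooth_on_continuous_on[OF sh] rD] by auto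
    \<comment> \<open>On the sphere the term \<open>- s\<close> is a negative constant, so
      \<open>h x >= 0\<close> forces \<open>t x * (K * t x - 1) > 0\<close>. Since \<open>r\<close>
      was chosen with \<open>K * t < 1\<close>, the point lies strictly inside the ball about
      \<open>y\<close>, where \<open>f\<close> is below its maximum.\<close>
    have hf: "f x < m" if x: "x \<in> sphere z r" "h x \<ge> 0" for x
    proof -
      have "s x = r\<^sup>2" using x(1) by (simp add: s_def dot_square_norm dist_norm norm_minus_commute)
      then have "t x * (K * t x - 1) > 0" using x(2) r(1) by (simp add: h_def algebra_simps) (smt (verit) zero_less_power)
      moreover have "K * t x - 1 < 0" using x(1) r(2) by (auto simp: subset_eq)
      ultimately have "t x < 0" by (simp add: zero_less_mult_iff)
      then show ?thesis using inner tneg by blast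
    qed
    define K1 where "K1 = sphere z r \<inter> h -` {0..}"
    have sub: "sphere z r \<subseteq> cball z r" by auto
    have "closed K1" unfolding K1_def
      by (intro continuous_closed_preimage continuous_on_subset[OF ch sub]) auto
    then have cK1: "compact K1"
      using compact_Int_closed[OF compact_sphere, of K1 z r] by (simp add: K1_def Int_assoc)
    have "\<exists>e>0. \<forall>x\<in>K1. f x + e * h x < m"
    proof (cases "K1 = {}")
      case True then show ?thesis by (intro exI[of _ 1]) auto
    next
      case False
      have K1c: "K1 \<subseteq> cball z r" by (auto simp: K1_def)
      obtain a where a: "a \<in> K1" "\<And>x. x \<in> K1 \<Longrightarrow> f x \<le> f a"
        using continuous_attains_sup[OF cK1 False continuous_on_subset[OF cf K1c]] by blast
      obtain b where b: "b \<in> K1" "\<And>x. x \<in> K1 \<Longrightarrow> h x \<le> h b"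
        using continuous_attains_sup[OF cK1 False continuous_on_subset[OF ch K1c]] by blast
      have fa: "f a < m" using a(1) hf by (auto simp: K1_def)
      have hb: "h b \<ge> 0" using b(1) by (auto simp: K1_def)
      \<comment> \<open>The values of \<open>f + e h\<close> on \<open>K1\<close> are at most
        \<open>f a + e * h b\<close>, which is \<open>m - e\<close>; the summand 1 provides this gap
        and keeps the denominator positive.\<close>
      define e where "e = (m - f a) / (h b + 1)"
      have e: "e > 0" using fa hb by (simp add: e_def)
      have "f x + e * h x < m" if "x \<in> K1" for x
      proof -
        have hx: "e * h x \<le> e * h b" by (rule mult_left_mono[OF b(2)[OF that]]) (use e in simp)
        have "e * (h b + 1) = m - f a" using hb by (simp add: e_def)
        then have "e * h b + e = m - f a" by (simp add: algebra_simps)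
        then show ?thesis using hx a(2)[OF that] e by linarith
      qed
      then show ?thesis using e by blast
    qed
    then obtain e where e: "e > 0" "\<And>x. x \<in> K1 \<Longrightarrow> f x + e * h x < m" by blast
    \<comment> \<open>\<open>v\<close> is below \<open>m\<close> on the sphere and equals
      \<open>m\<close> at the centre \<open>z\<close>, so it has an interior maximum, although its
      Laplacian \<open>e * laplacian G h\<close> is positive there.\<close>
    define v where "v = (\<lambda>x. f x + e *\<^sub>R h x)"
    have vs: "v x < m" if x: "x \<in> sphere z r" for x
    proof (cases "h x \<ge> 0")
      case True then show ?thesis using e(2)[of x] x by (simp add: K1_def v_def)
    next
      case False
      then have "e * h x < 0" using e(1) by (simp add: mult_pos_neg)
      then show ?thesis using max[of x] rD sub x by (force simp: v_def m_def)
    qed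
    have "continuous_on (cball z r) v" unfolding v_def by (intro continuous_intros cf ch)
    then obtain p where p: "p \<in> cball z r" "\<And>x. x \<in> cball z r \<Longrightarrow> v x \<le> v p"
      using continuous_attains_sup[OF compact_cball, of z r v] r(1) by auto
    have "v z = m" using h0 z(1) by (simp add: v_def C_def)
    then have "v p \<ge> m" using p(2)[of z] r(1) by simp
    then have "p \<notin> sphere z r" using vs by force
    then have pb: "p \<in> ball z r" using p(1) by (auto simp: less_le)
    have seh: "smooth_on D (\<lambda>x. e *\<^sub>R h x)" by (rule smooth_on_linear[OF open_D bounded_linear_scaleR_right sh])
    have sv: "smooth_on D v" unfolding v_def by (rule smooth_on_add[OF open_D f seh])
    have pD: "p \<in> D" using p(1) rD by blast
    have "laplacian G v p \<le> 0"
      by (rule laplacian_nonpos_at_max[OF sv open_ball[of z r] _ pb]) (use rD p(2) in \<open>auto simp: subset_eq\<close>)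
    moreover have "laplacian G v p = e * laplacian G h p"
      unfolding v_def laplacian_add[OF f seh pD] laplacian_bounded_linear[OF bounded_linear_scaleR_right sh pD]
      by (simp add: lap[OF pD])
    moreover have "laplacian G h p > 0" using p(1) r(2) by blast
    ultimately show False using e(1) by (simp add: mult_le_0_iff)
  qed
  then have const: "\<forall>y\<in>ball x0 R. f y = f x0" unfolding m_def by blast
  have "ball x0 R \<subseteq> D" using R by (auto simp: subset_eq)
  moreover have "x0 \<in> ball x0 R" using R(1) by simp
  ultimately show ?thesis using const open_ball by blast
qed

end

section \<open>Charts of the two spheres\<close>

text \<open>An injective linear image of codimension one inside a hyperplane fills the hyperplane.
  This supplies the axiom \<open>tangent_space\<close> for both spheres.\<close>

lemma linear_onto_hyperplane:
  fixes L :: "'e::euclidean_space \<Rightarrow> 'v::euclidean_space"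
  assumes L: "linear L" "inj L" and dim: "DIM('v) = DIM('e) + 1"
    and a: "a \<noteq> 0" "\<And>u. L u \<bullet> a = 0" and z: "z \<bullet> a = 0"
  shows "\<exists>u. z = L u"
proof -
  have "range L = {x. a \<bullet> x = 0}"
  proof (rule subspace_dim_equal)
    show "subspace (range L)" using L(1) by (simp add: linear_subspace_image)
    show "subspace {x. a \<bullet> x = 0}" by (rule subspace_hyperplane)
    show "range L \<subseteq> {x. a \<bullet> x = 0}" using a(2) by (auto simp: inner_commute)
    have "dim (range L) = DIM('e)" using dim_image_eq[of L UNIV] L by simp
    then show "dim {x. a \<bullet> x = 0} \<le> dim (range L)" using dim_hyperplane[OF a(1)] dim by simp
  qed
  then show ?thesis using z by (auto simp: inner_commute)
qed

lemma coord_inv_coord: "inj_on (coord c) (dom_chart c) \<Longrightarrow> p \<in> dom_chart c \<Longrightarrow> coord_inv c (coord c p) = p"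
  by (simp add: coord_inv_def)

lemma submanifold_chartsD:
  assumes "d \<in> submanifold_charts S"
  shows "openin (top_of_set S) (dom_chart d)" "inj_on (coord d) (dom_chart d)"
    "open (coord d ` dom_chart d)" "smooth_on (coord d ` dom_chart d) (coord_inv d)"
    "p \<in> dom_chart d \<Longrightarrow> \<exists>W c'. open W \<and> p \<in> W \<and> smooth_on W c' \<and> (\<forall>q\<in>dom_chart d \<inter> W. c' q = coord d q)"
  using assms by (auto simp: submanifold_charts_def)

lemma coord_inv_in_dom:
  assumes "d \<in> submanifold_charts S" "x \<in> coord d ` dom_chart d"
  shows "coord_inv d x \<in> dom_chart d" "coord_inv d x \<in> S" "coord d (coord_inv d x) = x"
proof -
  show "coord_inv d x \<in> dom_chart d" "coord d (coord_inv d x) = x"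
    using assms(2) coord_inv_coord[OF submanifold_chartsD(2)[OF assms(1)]] by auto
  then show "coord_inv d x \<in> S" using submanifold_chartsD(1)[OF assms(1)] openin_imp_subset by fastforce
qed

lemma regular_param_chart:
  assumes d: "d \<in> submanifold_charts S"
  shows "regular_param (coord_inv d) (coord d ` dom_chart d)"
proof
  fix x assume x: "x \<in> coord d ` dom_chart d"
  obtain W c' where W: "open W" "coord_inv d x \<in> W" "smooth_on W c'" "\<forall>q\<in>dom_chart d \<inter> W. c' q = coord d q"
    using submanifold_chartsD(5)[OF d coord_inv_in_dom(1)[OF d x]] by blast
  have "c' (coord_inv d y) = y" if "y \<in> coord d ` dom_chart d" "coord_inv d y \<in> W" for y
    using W(4) coord_inv_in_dom[OF d that(1)] that(2) by auto
  then show "\<exists>W c. open W \<and> coord_inv d x \<in> W \<and> smooth_on W c \<and>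
      (\<forall>y\<in>coord d ` dom_chart d. coord_inv d y \<in> W \<longrightarrow> c (coord_inv d y) = y)"
    using W(1-3) by blast
qed (use submanifold_chartsD[OF d] in auto)

lemma (in regular_param) inj_DP: "x \<in> D \<Longrightarrow> inj (fderiv P x)"
  using DP_inj by (auto intro: injI)

text \<open>Differentiating the constant squared length shows that tangent vectors are orthogonal to
  the position vector; equality of the spaces is a dimension count.\<close>

lemma spherical_param_unit_sphere:
  fixes d :: "('v::euclidean_space, 'e::euclidean_space) chart"
  assumes d: "d \<in> submanifold_charts (sphere 0 1)" and dim: "DIM('v) = DIM('e) + 1"
  shows "spherical_param (coord_inv d) (coord d ` dom_chart d) (\<lambda>z. z) 1"
proof -
  interpret regular_param "coord_inv d" "coord d ` dom_chart d" by (rule regular_param_chart[OF d])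
  let ?D = "coord d ` dom_chart d"
  have unit: "coord_inv d y \<bullet> coord_inv d y = 1" if "y \<in> ?D" for y
    using coord_inv_in_dom(2)[OF d that] by (simp add: dot_square_norm)
  show ?thesis
  proof (intro spherical_param.intro regular_param_axioms spherical_param_axioms.intro)
    fix x z assume x: "x \<in> ?D" and z: "z \<bullet> coord_inv d x = 0"
    have "fderiv (\<lambda>y. coord_inv d y \<bullet> coord_inv d y) x = fderiv (\<lambda>y. 1) x"
      by (rule fderiv_cong_open[OF open_D x]) (rule unit)
    then have "fderiv (coord_inv d) x u \<bullet> coord_inv d x = 0" for u
      using fderiv_inner[OF P_differentiable[OF x] P_differentiable[OF x], of u] by (simp add: inner_commute)
    then show "\<exists>u. z = fderiv (coord_inv d) x u"
      by (rule linear_onto_hyperplane[OF linear_DP[OF x] inj_DP[OF x] dim _ _ z, rotated])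
        (use unit[OF x] in auto)
  qed (use unit in \<open>auto simp: bounded_linear_ident\<close>)
qed

text \<open>The last coordinate is constant, so tangent vectors lie in the first factor, where the
  argument for a round sphere applies. The curvature 2 is the inverse square of the radius.\<close>

lemma spherical_param_small_sphere:
  fixes d :: "('v::euclidean_space \<times> real, 'e::euclidean_space) chart"
  assumes d: "d \<in> submanifold_charts (sphere 0 (1 / sqrt 2) \<times> {1 / sqrt 2})" and dim: "DIM('v) = DIM('e) + 1"
  shows "spherical_param (coord_inv d) (coord d ` dom_chart d) (\<lambda>z. (fst z, 0)) 2"
proof -
  interpret regular_param "coord_inv d" "coord d ` dom_chart d" by (rule regular_param_chart[OF d])
  let ?D = "coord d ` dom_chart d"
  have f: "fst (coord_inv d y) \<bullet> fst (coord_inv d y) = 1/2" and s: "snd (coord_inv d y) = 1 / sqrt 2"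
    if "y \<in> ?D" for y
    using coord_inv_in_dom(2)[OF d that] by (auto simp: mem_Times_iff dot_square_norm power_divide)
  have s': "snd (fderiv (coord_inv d) x u) = 0" if x: "x \<in> ?D" for x u
  proof -
    have "fderiv (\<lambda>y. snd (coord_inv d y)) x = fderiv (\<lambda>y. 1 / sqrt 2) x"
      by (rule fderiv_cong_open[OF open_D x]) (rule s)
    then show ?thesis using fderiv_bounded_linear[OF bounded_linear_snd P_differentiable[OF x]] by simp
  qed
  show ?thesis
  proof (intro spherical_param.intro regular_param_axioms spherical_param_axioms.intro)
    show "bounded_linear (\<lambda>z :: 'v \<times> real. (fst z, 0 :: real))"
      by (intro bounded_linear_Pair bounded_linear_fst bounded_linear_zero)
    fix x assume x: "x \<in> ?D"
    show "(2 *\<^sub>R (fst (coord_inv d x), 0 :: real)) \<bullet> (2 *\<^sub>R (fst (coord_inv d x), 0)) = 2"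
      using f[OF x] by simp
    fix z :: "'v \<times> real" assume z0: "(fst z, 0) = z" and z: "z \<bullet> (fst (coord_inv d x), 0) = 0"
    let ?L = "\<lambda>u. fst (fderiv (coord_inv d) x u)"
    have L: "linear ?L" by (rule linear_compose[OF linear_DP[OF x] linear_fst, unfolded o_def])
    have inj: "inj ?L" using inj_DP[OF x] s'[OF x] by (auto simp: inj_def prod_eq_iff)
    have fd: "(\<lambda>y. fst (coord_inv d y)) differentiable (at x)"
      using smooth_on_differentiable[OF smooth_on_linear[OF open_D bounded_linear_fst smooth_P] x] .
    have "fderiv (\<lambda>y. fst (coord_inv d y) \<bullet> fst (coord_inv d y)) x = fderiv (\<lambda>y. 1/2) x"
      by (rule fderiv_cong_open[OF open_D x]) (rule f)
    then have "?L u \<bullet> fst (coord_inv d x) = 0" for u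
      using fderiv_inner[OF fd fd, of u] fderiv_bounded_linear[OF bounded_linear_fst P_differentiable[OF x]]
      by (simp add: inner_commute)
    moreover have "fst (coord_inv d x) \<noteq> 0" using f[OF x] by auto
    moreover have "fst z \<bullet> fst (coord_inv d x) = 0" using z by (simp add: inner_prod_def)
    ultimately obtain u where "fst z = ?L u" using linear_onto_hyperplane[OF L inj dim] by blast
    moreover have "snd z = 0" using z0 by (metis snd_conv)
    ultimately show "\<exists>u. z = fderiv (coord_inv d) x u" using s'[OF x] by (metis prod_eq_iff)
  qed (use s' in \<open>auto simp: prod_eq_iff\<close>)
qed

lemma global_chartI:
  assumes "openin (top_of_set S) U" "\<And>y. Q y \<in> U" "\<And>y. c (Q y) = y" "\<And>p. p \<in> U \<Longrightarrow> Q (c p) = p"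
    and "smooth_on UNIV Q" "open W" "U \<subseteq> W" "smooth_on W c"
  shows "(U, c) \<in> submanifold_charts S"
proof -
  have im: "c ` U = UNIV" using assms(2,3) by (metis UNIV_eq_I image_eqI)
  have inj: "inj_on c U" using assms(4) by (metis inj_onI)
  have "coord_inv (U, c) y = Q y" for y
    unfolding coord_inv_def by (simp add: inv_into_f_eq[OF inj assms(2,3)])
  then have "coord_inv (U, c) = Q" by blast
  then show ?thesis using assms im inj by (auto simp: submanifold_charts_def)
qed

section \<open>Stereographic charts\<close>

lemma smooth_on_Pair:
  assumes "open S" "smooth_on S f" "smooth_on S g"
  shows "smooth_on S (\<lambda>x. (f x, g x))"
proof -
  have "smooth_on S (\<lambda>x. (f x, 0) + (0, g x))"
    by (rule smooth_on_add[OF assms(1) smooth_on_linear[OF assms(1) _ assms(2)] smooth_on_linear[OF assms(1) _ assms(3)]])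
      (intro bounded_linear_Pair bounded_linear_ident bounded_linear_zero)+
  then show ?thesis by simp
qed

text \<open>Projection of the sphere of radius \<open>r\<close> from the pole
  \<open>(0, s * r)\<close>, scaled so that the equator goes to the unit sphere. The sign
  \<open>s\<close>, with \<open>s * s = 1\<close>, treats both poles at once.\<close>

definition stereo :: "real \<Rightarrow> real \<Rightarrow> 'a::euclidean_space \<times> real \<Rightarrow> 'a" where
  "stereo r s p = inverse (r - s * snd p) *\<^sub>R fst p"

definition stereo_inv :: "real \<Rightarrow> real \<Rightarrow> 'a::euclidean_space \<Rightarrow> 'a \<times> real" where
  "stereo_inv r s y = ((2 * r * inverse (y \<bullet> y + 1)) *\<^sub>R y, s * r * ((y \<bullet> y - 1) * inverse (y \<bullet> y + 1)))"

lemma inner_self_plus_1: "(y :: 'a::real_inner) \<bullet> y + 1 > 0" by (simp add: add_nonneg_pos)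

lemma inner_self_plus_1_neq_0: "(y :: 'a::real_inner) \<bullet> y + 1 \<noteq> 0"
  using inner_self_plus_1[of y] by linarith

lemma smooth_stereo: "smooth_on {p. r - s * snd p \<noteq> 0} (stereo r s)"
proof -
  have o: "open {p :: 'a \<times> real. r - s * snd p \<noteq> 0}" by (intro open_Collect_neq continuous_intros)
  have "smooth_on {p :: 'a \<times> real. r - s * snd p \<noteq> 0} (\<lambda>p. inverse (r - s * snd p) *\<^sub>R fst p)"
    by (intro smooth_on_scaleR smooth_on_inverse smooth_on_diff smooth_on_mult smooth_on_const o
        smooth_on_linear[OF o bounded_linear_fst] smooth_on_linear[OF o bounded_linear_snd] smooth_on_ident) simp
  then show ?thesis by (simp add: stereo_def[abs_def])
qed

lemma smooth_stereo_inv: "smooth_on UNIV (stereo_inv r s)"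
proof -
  have "smooth_on UNIV (\<lambda>y :: 'a. ((2 * r * inverse (y \<bullet> y + 1)) *\<^sub>R y, s * r * ((y \<bullet> y - 1) * inverse (y \<bullet> y + 1))))"
    by (intro smooth_on_Pair smooth_on_scaleR smooth_on_inverse smooth_on_mult smooth_on_diff smooth_on_add
        smooth_on_inner smooth_on_const smooth_on_ident open_UNIV) (rule inner_self_plus_1_neq_0)+
  then show ?thesis by (simp add: stereo_inv_def[abs_def])
qed

lemma stereo_stereo_inv:
  assumes "r > 0" "s * s = 1" shows "stereo r s (stereo_inv r s y) = y"
proof -
  define k where "k = y \<bullet> y"
  have k: "k + 1 > 0" by (simp add: k_def inner_self_plus_1)
  have "s * (s * r * ((k - 1) * inverse (k + 1))) = r * ((k - 1) / (k + 1))"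
    using assms(2) by (simp add: divide_inverse mult.assoc[symmetric])
  then have eq: "r - s * (s * r * ((k - 1) * inverse (k + 1))) = 2 * r / (k + 1)"
    using k by (simp add: field_simps)
  have "2 * r * inverse (k + 1) \<noteq> 0" using k assms(1) by simp
  then have "inverse (2 * r / (k + 1)) * (2 * r * inverse (k + 1)) = 1"
    unfolding divide_inverse by (rule left_inverse)
  then show ?thesis
    unfolding stereo_def stereo_inv_def k_def[symmetric] fst_conv snd_conv eq scaleR_scaleR by simp
qed

lemma stereo_inv_in_sphere:
  fixes y :: "'a::euclidean_space"
  assumes "r > 0" "s * s = 1"
  shows "stereo_inv r s y \<in> sphere 0 r" "r - s * snd (stereo_inv r s y) \<noteq> 0"
proof -
  define k where "k = y \<bullet> y"
  have k: "k + 1 > 0" by (simp add: k_def inner_self_plus_1)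
  have a: "s * (s * r * ((k - 1) * inverse (k + 1))) = r * ((k - 1) / (k + 1))"
    using assms(2) by (simp add: divide_inverse mult.assoc[symmetric])
  then have "r - s * (s * r * ((k - 1) * inverse (k + 1))) = 2 * r / (k + 1)"
    using k by (simp add: field_simps)
  then show "r - s * snd (stereo_inv r s y) \<noteq> 0" using k assms(1) by (simp add: stereo_inv_def k_def[symmetric])
  define i where "i = inverse (k + 1)"
  have q: "stereo_inv r s y = ((2 * r * i) *\<^sub>R y, s * r * ((k - 1) * i))"
    by (simp only: stereo_inv_def k_def i_def)
  have i: "i * (k + 1) = 1" using k by (simp add: i_def)
  have "stereo_inv r s y \<bullet> stereo_inv r s y = (2 * r * i) * (2 * r * i) * k + (s * s) * (r * (k - 1) * i) * (r * (k - 1) * i)"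
    by (simp add: q inner_prod_def k_def[symmetric] algebra_simps)
  \<comment> \<open>This is the identity 4k + (k - 1)^2 = (k + 1)^2.\<close>
  also have "\<dots> = (r * (i * (k + 1)))\<^sup>2"
    unfolding assms(2) by (simp add: power2_eq_square algebra_simps)
  finally have "(norm (stereo_inv r s y))\<^sup>2 = r\<^sup>2" unfolding i by (simp add: dot_square_norm)
  then show "stereo_inv r s y \<in> sphere 0 r" using assms(1) by (simp add: power2_eq_iff_nonneg)
qed

lemma stereo_inv_stereo:
  fixes p :: "'a::euclidean_space \<times> real"
  assumes "r > 0" "s * s = 1" and p: "p \<in> sphere 0 r" "r - s * snd p \<noteq> 0"
  shows "stereo_inv r s (stereo r s p) = p"
proof -
  obtain x t where xt: "p = (x, t)" by (cases p)
  define a where "a = r - s * t"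
  have a: "a \<noteq> 0" using p(2) by (simp add: a_def xt)
  have "p \<bullet> p = r\<^sup>2" using p(1) by (simp add: dot_square_norm)
  then have "x \<bullet> x + t * t = r\<^sup>2" by (simp add: xt inner_prod_def)
  moreover have "(s * t)\<^sup>2 = t * t" using assms(2) by (simp add: power_mult_distrib power2_eq_square)
  ultimately have x: "x \<bullet> x = r\<^sup>2 - (s * t)\<^sup>2" by simp
  define k where "k = stereo r s p \<bullet> stereo r s p"
  have "k = (x \<bullet> x) / a\<^sup>2" by (simp add: k_def stereo_def xt a_def[symmetric] power2_eq_square divide_inverse)
  \<comment> \<open>The difference of squares lets one factor \<open>a\<close> cancel, so
    \<open>k\<close> becomes a quotient linear in the height \<open>t\<close>.\<close>
  also have "x \<bullet> x = a * (r + s * t)" unfolding x a_def by (simp add: power2_eq_square algebra_simps)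
  finally have k: "k = (r + s * t) / a" using a by (simp add: power2_eq_square)
  have k1: "k + 1 = 2 * r / a" unfolding k using a by (simp add: a_def field_simps)
  have k2: "k - 1 = 2 * (s * t) / a" unfolding k using a by (simp add: a_def field_simps)
  have "2 * r * inverse (k + 1) = a" unfolding k1 using assms(1) a by (simp add: field_simps)
  moreover have "s * r * ((k - 1) * inverse (k + 1)) = s * s * t" unfolding k1 k2 using assms(1) a by (simp add: field_simps)
  ultimately show ?thesis
    using a assms(2) unfolding stereo_inv_def k_def[symmetric] by (simp add: stereo_def xt a_def[symmetric])
qed

lemma ex_stereo_sign:
  fixes p :: "'a::euclidean_space \<times> real"
  assumes "r > 0" obtains s :: real where "s * s = 1" "r - s * snd p \<noteq> 0"
proof (cases "snd p = r")
  case True then show ?thesis using that[of "-1"] assms by simp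
next
  case False then show ?thesis using that[of 1] by simp
qed

text \<open>Harmonicity and biharmonicity are quantified over charts of the target, so charts around
  every point are required before these conditions say anything.\<close>

lemma ex_chart_sphere:
  fixes p :: "'a::euclidean_space \<times> real"
  assumes r: "r > 0" and p: "p \<in> sphere 0 r"
  shows "\<exists>d :: ('a \<times> real, 'a) chart. d \<in> submanifold_charts (sphere 0 r) \<and> p \<in> dom_chart d"
proof -
  obtain s :: real where s: "s * s = 1" "r - s * snd p \<noteq> 0" using ex_stereo_sign[OF r] .
  let ?W = "{p :: 'a \<times> real. r - s * snd p \<noteq> 0}"
  have o: "open ?W" by (intro open_Collect_neq continuous_intros)
  have "(sphere 0 r \<inter> ?W, stereo r s) \<in> submanifold_charts (sphere 0 r)"
  proof (rule global_chartI[OF _ _ _ _ smooth_stereo_inv o _ smooth_stereo])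
    show "openin (top_of_set (sphere 0 r)) (sphere 0 r \<inter> ?W)" using o by (rule openin_open_Int)
    show "stereo_inv r s y \<in> sphere 0 r \<inter> ?W" for y :: 'a using stereo_inv_in_sphere[OF r s(1), of y] by blast
    show "stereo r s (stereo_inv r s y) = y" for y :: 'a by (rule stereo_stereo_inv[OF r s(1)])
    show "stereo_inv r s (stereo r s p) = p" if "p \<in> sphere 0 r \<inter> ?W" for p
      using that stereo_inv_stereo[OF r s(1), of p] by blast
  qed auto
  then show ?thesis using p s(2) by (intro exI[of _ "(sphere 0 r \<inter> ?W, stereo r s)"]) simp
qed

lemma ex_chart_sphere_times:
  fixes p :: "('a::euclidean_space \<times> real) \<times> real"
  assumes r: "r > 0" and p: "p \<in> sphere 0 r \<times> {h}"
  shows "\<exists>d :: (('a \<times> real) \<times> real, 'a) chart. d \<in> submanifold_charts (sphere 0 r \<times> {h}) \<and> p \<in> dom_chart d"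
proof -
  obtain s :: real where s: "s * s = 1" "r - s * snd (fst p) \<noteq> 0" using ex_stereo_sign[OF r] .
  let ?W = "{p :: ('a \<times> real) \<times> real. r - s * snd (fst p) \<noteq> 0}"
  let ?U = "(sphere 0 r \<times> {h}) \<inter> ?W"
  have o: "open ?W" by (intro open_Collect_neq continuous_intros)
  have sc: "smooth_on ?W (\<lambda>p. stereo r s (fst p))"
    by (rule smooth_on_compose[OF o _ smooth_on_linear[OF o bounded_linear_fst smooth_on_ident[OF o]] smooth_stereo]) auto
  have sq: "smooth_on UNIV (\<lambda>y :: 'a. (stereo_inv r s y, h))"
    by (intro smooth_on_Pair smooth_stereo_inv smooth_on_const open_UNIV)
  have "(?U, \<lambda>p. stereo r s (fst p)) \<in> submanifold_charts (sphere 0 r \<times> {h})"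
  proof (rule global_chartI[OF _ _ _ _ sq o _ sc])
    show "openin (top_of_set (sphere 0 r \<times> {h})) ?U" using o by (rule openin_open_Int)
    show "(stereo_inv r s y, h) \<in> ?U" for y :: 'a using stereo_inv_in_sphere[OF r s(1), of y] by simp
    show "stereo r s (fst (stereo_inv r s y, h)) = y" for y :: 'a using stereo_stereo_inv[OF r s(1)] by simp
    show "(stereo_inv r s (stereo r s (fst p)), h) = p" if "p \<in> ?U" for p
      using that stereo_inv_stereo[OF r s(1), of "fst p"] by (auto simp: prod_eq_iff mem_Times_iff)
  qed auto
  then show ?thesis using p s(2) by (intro exI[of _ "(?U, \<lambda>p. stereo r s (fst p))"]) simp
qed

section \<open>Maps from a manifold into a submanifold\<close>

lemma riemannian_chartD:
  assumes "riemannian_manifold M" "c \<in> atlas M"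
  shows "openin (mtop M) (dom_chart c)" "open (coord c ` dom_chart c)" "inj_on (coord c) (dom_chart c)"
    "dom_chart c \<subseteq> points M"
    "continuous_map (subtopology (mtop M) (dom_chart c)) (top_of_set (coord c ` dom_chart c)) (coord c)"
    "open_map (subtopology (mtop M) (dom_chart c)) (top_of_set (coord c ` dom_chart c)) (coord c)"
proof -
  show o: "openin (mtop M) (dom_chart c)" and "open (coord c ` dom_chart c)"
    using assms by (auto simp: riemannian_manifold_def smooth_manifold_def)
  show sub: "dom_chart c \<subseteq> points M" using openin_subset[OF o] .
  have h: "homeomorphic_map (subtopology (mtop M) (dom_chart c)) (top_of_set (coord c ` dom_chart c)) (coord c)"
    using assms unfolding riemannian_manifold_def smooth_manifold_def by blast
  have "topspace (subtopology (mtop M) (dom_chart c)) = dom_chart c"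
    using sub by (rule topspace_subtopology_subset)
  with homeomorphic_imp_injective_map[OF h] show "inj_on (coord c) (dom_chart c)" by simp
  show "continuous_map (subtopology (mtop M) (dom_chart c)) (top_of_set (coord c ` dom_chart c)) (coord c)"
    by (rule homeomorphic_imp_continuous_map[OF h])
  show "open_map (subtopology (mtop M) (dom_chart c)) (top_of_set (coord c ` dom_chart c)) (coord c)"
    by (rule homeomorphic_imp_open_map[OF h])
qed

lemma riemannian_ex_chart:
  assumes "riemannian_manifold M" "p \<in> points M"
  obtains c where "c \<in> atlas M" "p \<in> dom_chart c"
proof -
  have "(\<Union>c\<in>atlas M. dom_chart c) = points M"
    using assms(1) unfolding riemannian_manifold_def smooth_manifold_def by blast
  then show thesis using assms(2) that by blast
qed

lemma open_chart_image:
  assumes "riemannian_manifold M" "c \<in> atlas M" "openin (mtop M) A" "A \<subseteq> dom_chart c"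
  shows "open (coord c ` A)"
proof -
  have "openin (subtopology (mtop M) (dom_chart c)) A"
    using assms(3,4) by (metis inf.absorb_iff1 openin_subtopology_Int)
  then have "openin (top_of_set (coord c ` dom_chart c)) (coord c ` A)"
    using riemannian_chartD(6)[OF assms(1,2)] by (simp add: open_map_def)
  then show ?thesis using riemannian_chartD(2)[OF assms(1,2)] by (simp add: openin_open_eq)
qed

lemma openin_chart_preimage:
  assumes "riemannian_manifold M" "c \<in> atlas M" "open U"
  shows "openin (mtop M) {p \<in> dom_chart c. coord c p \<in> U}"
proof -
  let ?D = "coord c ` dom_chart c"
  have "openin (top_of_set ?D) (?D \<inter> U)" using assms(3) by (rule openin_open_Int)
  from openin_continuous_map_preimage[OF riemannian_chartD(5)[OF assms(1,2)] this]
  have "openin (subtopology (mtop M) (dom_chart c)) {p \<in> points M \<inter> dom_chart c. coord c p \<in> ?D \<inter> U}"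
    by simp
  moreover have "{p \<in> points M \<inter> dom_chart c. coord c p \<in> ?D \<inter> U} = {p \<in> dom_chart c. coord c p \<in> U}"
    using riemannian_chartD(4)[OF assms(1,2)] by auto
  ultimately show ?thesis using riemannian_chartD(1)[OF assms(1,2)] by (simp add: openin_open_subtopology)
qed

lemma coord_riemannian_chart:
  assumes "riemannian_manifold M" "c \<in> atlas M"
  shows "coord_riemannian (coord c ` dom_chart c) (metric M c)"
  using assms riemannian_chartD(2)[OF assms]
  by unfold_locales (auto simp: riemannian_manifold_def riemannian_metric_def inner_form_def)

lemma coord_riemannian_subset:
  assumes "coord_riemannian D G" "open W" "W \<subseteq> D"
  shows "coord_riemannian W G"
proof -
  interpret coord_riemannian D G by fact
  show ?thesis
    by unfold_locales (use assms inner_form_G smooth_on_subset[OF smooth_G] in auto)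
qed

lemma deriv_normsq_cong:
  assumes "open S" "x \<in> S" "\<And>y. y \<in> S \<Longrightarrow> f y = g y"
  shows "deriv_normsq G f x = deriv_normsq G g x"
  using fderiv_cong_open[OF assms] by (simp add: deriv_normsq_def)

text \<open>The derivative of the transition map is an isometry of the coordinate metrics, under
  which traces are invariant. It connects the chart picked by \<open>chart_at\<close> with the fixed
  chart in which the analysis takes place.\<close>

lemma deriv_normsq_chart_independent:
  assumes M: "riemannian_manifold M" and c: "c \<in> atlas M" "p \<in> dom_chart c"
    and d: "d \<in> atlas M" "p \<in> dom_chart d"
    and f: "smooth_on (coord d ` dom_chart d) (\<lambda>x. f (coord_inv d x))"
  shows "deriv_normsq (metric M c) (\<lambda>x. f (coord_inv c x)) (coord c p)
    = deriv_normsq (metric M d) (\<lambda>x. f (coord_inv d x)) (coord d p)"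
proof -
  define T where "T = coord d \<circ> coord_inv c"
  define U where "U = coord c ` (dom_chart c \<inter> dom_chart d)"
  note inj = riemannian_chartD(3)[OF M c(1)] riemannian_chartD(3)[OF M d(1)]
  let ?x = "coord c p"
  have U: "open U" unfolding U_def
    by (rule open_chart_image[OF M c(1) openin_Int[OF riemannian_chartD(1)[OF M c(1)] riemannian_chartD(1)[OF M d(1)]]]) simp
  have x: "?x \<in> U" using c d by (simp add: U_def)
  have Tx: "T ?x = coord d p" by (simp add: T_def coord_inv_coord[OF inj(1) c(2)])
  have sT: "smooth_on U T"
    using M c(1) d(1) by (auto simp: riemannian_manifold_def smooth_manifold_def U_def T_def)
  interpret c: coord_riemannian "coord c ` dom_chart c" "metric M c" by (rule coord_riemannian_chart[OF M c(1)])
  interpret d: coord_riemannian "coord d ` dom_chart d" "metric M d" by (rule coord_riemannian_chart[OF M d(1)])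
  let ?A = "fderiv T ?x"
  have lA: "linear ?A" by (rule fderiv_linear[OF sT x])
  have iso: "metric M c ?x u v = metric M d (coord d p) (?A u) (?A v)" for u v
  proof -
    have "\<forall>c\<in>atlas M. \<forall>d\<in>atlas M. \<forall>x\<in>coord c ` (dom_chart c \<inter> dom_chart d). \<forall>u v.
        metric M c x u v =
        metric M d ((coord d \<circ> coord_inv c) x)
          (fderiv (coord d \<circ> coord_inv c) x u) (fderiv (coord d \<circ> coord_inv c) x v)"
      using M unfolding riemannian_manifold_def riemannian_metric_def by blast
    then show ?thesis using c(1) d(1) x unfolding Tx[symmetric] U_def T_def by blast
  qed
  have gd: "inner_form (metric M d (coord d p))" and gc: "inner_form (metric M c ?x)"
    using c.inner_form_G d.inner_form_G c(2) d(2) by auto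
  \<comment> \<open>Injectivity is deduced from positivity of the metric, and surjectivity then from
    equal dimensions.\<close>
  have "u = 0" if "?A u = 0" for u
    using iso[of u u] that linear_0[OF inner_formD(4)[OF gd, of 0]] inner_formD(3)[OF gc, of u] by fastforce
  then have "inj ?A" using lA by (simp add: linear_injective_0)
  then have surj: "surj ?A" using lA linear_injective_imp_surjective by blast
  have fd: "(\<lambda>y. f (coord_inv d y)) differentiable (at (T ?x))"
    unfolding Tx by (rule smooth_on_differentiable[OF f]) (use d in auto)
  have "fderiv (\<lambda>x. f (coord_inv c x)) ?x = fderiv (\<lambda>y. f (coord_inv d (T y))) ?x"
    by (rule fderiv_cong_open[OF U x])
      (auto simp: U_def T_def coord_inv_coord[OF inj(1)] coord_inv_coord[OF inj(2)])
  then have D: "fderiv (\<lambda>x. f (coord_inv c x)) ?x u = fderiv (\<lambda>y. f (coord_inv d y)) (coord d p) (?A u)" for u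
    using fderiv_compose[OF smooth_on_differentiable[OF sT x] fd] by (simp add: Tx)
  have l: "linear (fderiv (\<lambda>y. f (coord_inv d y)) (coord d p))" by (rule fderiv_linear[OF f]) (use d in auto)
  have "bilinear (\<lambda>u v. fderiv (\<lambda>y. f (coord_inv d y)) (coord d p) u \<bullet> fderiv (\<lambda>y. f (coord_inv d y)) (coord d p) v)"
    unfolding bilinear_def using linear_add[OF l] linear_cmul[OF l]
    by (auto intro!: linearI simp: inner_add_left inner_add_right)
  from metric_trace_transport[where G = "metric M c" and x = ?x and G' = "metric M d" and x' = "coord d p"
      and A = ?A, OF c.coord_riemannian_axioms _ gd lA surj iso this]
  show ?thesis using c(2) by (simp add: deriv_normsq_def D)
qed

lemma open_map_domain:
  assumes "riemannian_manifold M" "c \<in> atlas M" "continuous_map (mtop M) (top_of_set S) f"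
    and "openin (top_of_set S) U"
  shows "open (coord c ` {p \<in> dom_chart c. f p \<in> U})"
proof (rule open_chart_image[OF assms(1,2)])
  have "openin (mtop M) (dom_chart c \<inter> {p \<in> points M. f p \<in> U})"
    by (intro openin_Int riemannian_chartD[OF assms(1,2)] openin_continuous_map_preimage[OF assms(3,4)])
  moreover have "dom_chart c \<inter> {p \<in> points M. f p \<in> U} = {p \<in> dom_chart c. f p \<in> U}"
    using riemannian_chartD(4)[OF assms(1,2)] by auto
  ultimately show "openin (mtop M) {p \<in> dom_chart c. f p \<in> U}" by simp
qed auto

text \<open>The target coordinates cancel: composed with its parametrisation, the coordinate
  expression is the ambient map itself, whichever target chart was taken.\<close>

lemma coord_expr_lift:
  assumes "riemannian_manifold M" "c \<in> atlas M" "d \<in> submanifold_charts S"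
    and "x \<in> coord c ` {p \<in> dom_chart c. f p \<in> dom_chart d}"
  shows "coord_inv d (coord_expr c d f x) = f (coord_inv c x)" "coord_expr c d f x \<in> coord d ` dom_chart d"
  using assms(4) coord_inv_coord[OF riemannian_chartD(3)[OF assms(1,2)]] coord_inv_coord[OF submanifold_chartsD(2)[OF assms(3)]]
  by (auto simp: coord_expr_def)

text \<open>\<open>smooth_map\<close> constrains \<open>f\<close> only where its values lie in a
  chart; \<open>cover\<close> makes these places exhaust the domain, and locally \<open>f\<close> is
  a parametrisation after a smooth coordinate expression.\<close>

lemma smooth_map_ambient:
  fixes S :: "'v::euclidean_space set" and M :: "('p, 'm::euclidean_space) riem_mfd"
  assumes M: "riemannian_manifold M" and c: "c \<in> atlas M"
    and f: "smooth_map M (submanifold S :: ('v, 'e::euclidean_space) riem_mfd) f"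
    and cover: "\<And>y. y \<in> S \<Longrightarrow> \<exists>d :: ('v, 'e) chart. d \<in> submanifold_charts S \<and> y \<in> dom_chart d"
  shows "smooth_on (coord c ` dom_chart c) (\<lambda>x. f (coord_inv c x))"
proof (rule smooth_on_local)
  fix x assume "x \<in> coord c ` dom_chart c"
  then obtain p where p: "p \<in> dom_chart c" "x = coord c p" by blast
  have cont: "continuous_map (mtop M) (top_of_set S) f" using f by (simp add: smooth_map_def submanifold_def)
  then have "f p \<in> S" using riemannian_chartD(4)[OF M c] p(1) by (auto simp: continuous_map_def)
  then obtain d :: "('v, 'e) chart" where d: "d \<in> submanifold_charts S" "f p \<in> dom_chart d" using cover by blast
  let ?W = "coord c ` {p \<in> dom_chart c. f p \<in> dom_chart d}"
  have W: "open ?W" by (rule open_map_domain[OF M c cont submanifold_chartsD(1)[OF d(1)]])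
  have sF: "smooth_on ?W (coord_expr c d f)" using f c d by (simp add: smooth_map_def submanifold_def)
  have "smooth_on ?W (\<lambda>x. coord_inv d (coord_expr c d f x))"
    by (rule smooth_on_compose[OF W _ sF submanifold_chartsD(4)[OF d(1)]])
      (use coord_expr_lift(2)[OF M c d(1)] in blast)
  then have "smooth_on ?W (\<lambda>x. f (coord_inv c x))"
    by (rule smooth_on_cong[OF W]) (rule coord_expr_lift(1)[OF M c d(1)])
  then show "\<exists>W. open W \<and> x \<in> W \<and> smooth_on W (\<lambda>x. f (coord_inv c x))" using W p d(2) by blast
qed

text \<open>Charts of \<open>S\<close> are locally restrictions of smooth ambient maps. With
  \<open>smooth_map_ambient\<close> this carries smoothness from the small to the unit sphere, whose
  charts have a different model space.\<close>

lemma smooth_map_submanifoldI: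
  fixes S :: "'v::euclidean_space set" and M :: "('p, 'm::euclidean_space) riem_mfd"
  assumes M: "riemannian_manifold M" and cont: "continuous_map (mtop M) (top_of_set S) f"
    and f: "\<And>c. c \<in> atlas M \<Longrightarrow> smooth_on (coord c ` dom_chart c) (\<lambda>x. f (coord_inv c x))"
  shows "smooth_map M (submanifold S :: ('v, 'e::euclidean_space) riem_mfd) f"
proof -
  have "smooth_on (coord c ` {p \<in> dom_chart c. f p \<in> dom_chart d}) (coord_expr c d f)"
    if c: "c \<in> atlas M" and d: "d \<in> submanifold_charts S" for c and d :: "('v, 'e) chart"
  proof (rule smooth_on_local)
    let ?W = "coord c ` {p \<in> dom_chart c. f p \<in> dom_chart d}"
    fix x assume x: "x \<in> ?W"
    have fx: "f (coord_inv c x) \<in> dom_chart d"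
      using x coord_inv_coord[OF riemannian_chartD(3)[OF M c]] by auto
    obtain V c' where V: "open V" "f (coord_inv c x) \<in> V" "smooth_on V c'" "\<forall>q\<in>dom_chart d \<inter> V. c' q = coord d q"
      using submanifold_chartsD(5)[OF d fx] by blast
    have W: "open ?W" by (rule open_map_domain[OF M c cont submanifold_chartsD(1)[OF d]])
    have sf: "smooth_on ?W (\<lambda>x. f (coord_inv c x))" by (rule smooth_on_subset[OF f[OF c]]) auto
    let ?W' = "?W \<inter> (\<lambda>x. f (coord_inv c x)) -` V"
    have W': "open ?W'" by (rule continuous_open_preimage[OF smooth_on_continuous_on[OF sf] W V(1)])
    have "smooth_on ?W' (\<lambda>x. c' (f (coord_inv c x)))"
      by (rule smooth_on_compose[OF W' _ smooth_on_subset[OF sf] V(3)]) auto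
    then have "smooth_on ?W' (coord_expr c d f)"
      by (rule smooth_on_cong[OF W'])
        (use V(4) coord_inv_coord[OF riemannian_chartD(3)[OF M c]] in \<open>auto simp: coord_expr_def\<close>)
    then show "\<exists>W. open W \<and> x \<in> W \<and> smooth_on W (coord_expr c d f)" using W' x V(2) by blast
  qed
  then show ?thesis using cont by (simp add: smooth_map_def submanifold_def)
qed

lemma spherical_map_chart:
  fixes S :: "'v::euclidean_space set" and M :: "('p, 'm::euclidean_space) riem_mfd"
    and d :: "('v, 'e::euclidean_space) chart"
  assumes M: "riemannian_manifold M" and c: "c \<in> atlas M"
    and f: "smooth_map M (submanifold S :: ('v, 'e) riem_mfd) f" and d: "d \<in> submanifold_charts S"
    and P: "spherical_param (coord_inv d) (coord d ` dom_chart d) \<pi> \<kappa>"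
  shows "spherical_map (coord_inv d) (coord d ` dom_chart d) \<pi> \<kappa>
    (coord c ` {p \<in> dom_chart c. f p \<in> dom_chart d}) (metric M c) (coord_expr c d f)"
proof -
  let ?W = "coord c ` {p \<in> dom_chart c. f p \<in> dom_chart d}"
  have cont: "continuous_map (mtop M) (top_of_set S) f" and sF: "smooth_on ?W (coord_expr c d f)"
    using f c d by (auto simp: smooth_map_def submanifold_def)
  have "open ?W" by (rule open_map_domain[OF M c cont submanifold_chartsD(1)[OF d]])
  then have "coord_riemannian ?W (metric M c)"
    by (rule coord_riemannian_subset[OF coord_riemannian_chart[OF M c]]) auto
  then show ?thesis
    using sF coord_expr_lift(2)[OF M c d] by (intro spherical_map.intro P spherical_map_axioms.intro)
qed

lemma induced_metric_eq: "induced_metric d = (\<lambda>x u v. fderiv (coord_inv d) x u \<bullet> fderiv (coord_inv d) x v)"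
  by (simp add: induced_metric_def fun_eq_iff)

lemma chart_at:
  assumes "\<exists>c. c \<in> atlas M \<and> p \<in> dom_chart c"
  shows "chart_at M p \<in> atlas M" "p \<in> dom_chart (chart_at M p)"
  using someI_ex[OF assms] by (auto simp: chart_at_def)

lemma connected_locally_constant:
  assumes "connected_space X"
    and "\<And>p. p \<in> topspace X \<Longrightarrow> \<exists>U. openin X U \<and> p \<in> U \<and> (\<forall>q\<in>U. f q = f p)"
  shows "f constant_on topspace X"
proof (cases "topspace X = {}")
  case True then show ?thesis by (simp add: constant_on_def)
next
  case False
  then obtain p where p: "p \<in> topspace X" by blast
  have o: "openin X {q \<in> topspace X. P (f q)}" for P
  proof (subst openin_subopen, intro ballI)
    fix q assume q: "q \<in> {q \<in> topspace X. P (f q)}"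
    then obtain U where U: "openin X U" "q \<in> U" "\<forall>r\<in>U. f r = f q" using assms(2) by blast
    have "r \<in> {q \<in> topspace X. P (f q)}" if "r \<in> U" for r
    proof -
      have "f r = f q" using U(3) that by blast
      then show ?thesis using q that openin_subset[OF U(1)] by auto
    qed
    then show "\<exists>T. openin X T \<and> q \<in> T \<and> T \<subseteq> {q \<in> topspace X. P (f q)}"
      using U(1,2) by blast
  qed
  have "closedin X {q \<in> topspace X. f q = f p}"
  proof -
    have "topspace X - {q \<in> topspace X. f q = f p} = {q \<in> topspace X. f q \<noteq> f p}" by blast
    then show ?thesis unfolding closedin_def using o[of "\<lambda>y. y \<noteq> f p"] by auto
  qed
  then have "{q \<in> topspace X. f q = f p} = topspace X"
    using assms(1) o[of "\<lambda>y. y = f p"] p unfolding connected_space_clopen_in by blast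
  then show ?thesis unfolding constant_on_def by blast
qed

section \<open>Harmonic maps into the small sphere\<close>

abbreviation small_sphere_set :: "(('n::euclidean_space \<times> real) \<times> real) set" where
  "small_sphere_set \<equiv> sphere 0 (1 / sqrt 2) \<times> {1 / sqrt 2}"

locale harmonic_into_small_sphere =
  fixes M :: "('p, 'm::euclidean_space) riem_mfd"
    and \<psi> :: "'p \<Rightarrow> ('n::euclidean_space \<times> real) \<times> real"
  assumes riem: "riemannian_manifold M"
    and harm: "harmonic_map M (small_sphere :: (('n \<times> real) \<times> real, 'n) riem_mfd) \<psi>"
begin

definition local_map :: "('p, 'm) chart \<Rightarrow> 'm \<Rightarrow> ('n \<times> real) \<times> real" where
  "local_map c x = \<psi> (coord_inv c x)"

text \<open>Twice the energy density, read in the chart \<open>c\<close>: the q of the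
  overview.\<close>

definition dpsi_normsq :: "('p, 'm) chart \<Rightarrow> 'm \<Rightarrow> real" where
  "dpsi_normsq c = deriv_normsq (metric M c) (local_map c)"

text \<open>
  At \<open>(x, 1/\<surd>2)\<close> this is \<open>(- x, 1/\<surd>2)\<close>, the unit normal of the small sphere in the unit sphere; in the
  form below its derivative is visibly \<open>- d\<psi>\<close>.
\<close>

definition unit_normal :: "('p, 'm) chart \<Rightarrow> 'm \<Rightarrow> ('n \<times> real) \<times> real" where
  "unit_normal c x = - local_map c x + (0, sqrt 2)"

lemma smooth_psi: "smooth_map M (submanifold small_sphere_set :: (('n \<times> real) \<times> real, 'n) riem_mfd) \<psi>"
  using harm by (simp add: harmonic_map_def small_sphere_def)

lemma continuous_psi: "continuous_map (mtop M) (top_of_set small_sphere_set) \<psi>"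
  using smooth_psi by (simp add: smooth_map_def submanifold_def)

lemma psi_in: "p \<in> points M \<Longrightarrow> \<psi> p \<in> small_sphere_set"
  using continuous_psi by (auto simp: continuous_map_def)

lemma ex_small_chart:
  assumes "p \<in> points M"
  obtains d :: "(('n \<times> real) \<times> real, 'n) chart" where "d \<in> submanifold_charts small_sphere_set" "\<psi> p \<in> dom_chart d"
  using ex_chart_sphere_times[OF _ psi_in[OF assms]] by auto

lemma small_sphere_subset: "small_sphere_set \<subseteq> (sphere 0 1 :: (('n \<times> real) \<times> real) set)"
proof
  fix z :: "('n \<times> real) \<times> real" assume "z \<in> small_sphere_set"
  then have "norm (fst z) = 1 / sqrt 2" "snd z = 1 / sqrt 2" by (auto simp: mem_Times_iff)
  then have "(norm z)\<^sup>2 = 1" by (simp add: norm_prod_def power_divide)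
  then show "z \<in> sphere 0 1" by (simp add: power2_eq_1_iff) (smt (verit) norm_ge_zero)
qed

lemma ex_unit_chart:
  assumes "p \<in> points M"
  obtains d :: "(('n \<times> real) \<times> real, 'n \<times> real) chart" where "d \<in> submanifold_charts (sphere 0 1)" "\<psi> p \<in> dom_chart d"
  using ex_chart_sphere[OF zero_less_one subsetD[OF small_sphere_subset psi_in[OF assms]]] that by blast

lemma continuous_psi_unit: "continuous_map (mtop M) (top_of_set (sphere 0 1)) \<psi>"
  using continuous_psi small_sphere_subset by (simp add: continuous_map_in_subtopology) blast

context
  fixes c assumes c: "c \<in> atlas M"
begin

lemma coord_inv_chart: "p \<in> dom_chart c \<Longrightarrow> coord_inv c (coord c p) = p"
  by (rule coord_inv_coord[OF riemannian_chartD(3)[OF riem c]])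

lemma local_map_coord: "p \<in> dom_chart c \<Longrightarrow> local_map c (coord c p) = \<psi> p"
  by (simp add: local_map_def coord_inv_chart)

lemma open_chart: "open (coord c ` dom_chart c)"
  by (rule riemannian_chartD(2)[OF riem c])

lemma smooth_local_map: "smooth_on (coord c ` dom_chart c) (local_map c)"
  unfolding local_map_def[abs_def]
  by (rule smooth_map_ambient[OF riem c smooth_psi], rule ex_chart_sphere_times) simp_all

lemma local_map_in: "x \<in> coord c ` dom_chart c \<Longrightarrow> local_map c x \<in> small_sphere_set"
  using psi_in riemannian_chartD(4)[OF riem c] by (auto simp: local_map_coord)

lemma snd_local_map: "x \<in> coord c ` dom_chart c \<Longrightarrow> snd (local_map c x) = 1 / sqrt 2"
  using local_map_in by (auto simp: mem_Times_iff)

lemma local_map_unit: "x \<in> coord c ` dom_chart c \<Longrightarrow> local_map c x \<bullet> local_map c x = 1"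
  using subsetD[OF small_sphere_subset local_map_in] by (simp add: dot_square_norm)

lemma coord_riemannian_c: "coord_riemannian (coord c ` dom_chart c) (metric M c)"
  by (rule coord_riemannian_chart[OF riem c])

lemma smooth_dpsi_normsq: "smooth_on (coord c ` dom_chart c) (dpsi_normsq c)"
  unfolding dpsi_normsq_def by (rule coord_riemannian.smooth_deriv_normsq[OF coord_riemannian_c smooth_local_map])

lemma smooth_unit_normal: "smooth_on (coord c ` dom_chart c) (unit_normal c)"
  unfolding unit_normal_def[abs_def] by (intro smooth_on_add smooth_on_minus smooth_on_const open_chart smooth_local_map)

lemma fderiv_unit_normal:
  assumes x: "x \<in> coord c ` dom_chart c" shows "fderiv (unit_normal c) x u = - fderiv (local_map c) x u"
proof -
  have "((\<lambda>x. - local_map c x + (0, sqrt 2)) has_derivative (\<lambda>u. - fderiv (local_map c) x u + 0)) (at x)"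
    by (intro has_derivative_add has_derivative_minus has_derivative_const smooth_on_has_derivative[OF smooth_local_map x])
  then show ?thesis using fderiv_eqI by (fastforce simp: unit_normal_def[abs_def])
qed

text \<open>The derivative is orthogonal to the position vector, which has constant length, and to
  the last axis, along which the map is constant; the normal is a combination of the two.\<close>

lemma fderiv_local_map_unit_normal:
  assumes x: "x \<in> coord c ` dom_chart c" shows "fderiv (local_map c) x u \<bullet> unit_normal c x = 0"
proof -
  note d = smooth_on_differentiable[OF smooth_local_map x]
  have "fderiv (\<lambda>y. local_map c y \<bullet> local_map c y) x = fderiv (\<lambda>y. 1) x"
    by (rule fderiv_cong_open[OF open_chart x]) (rule local_map_unit)
  then have "fderiv (local_map c) x u \<bullet> local_map c x = 0"
    using fderiv_inner[OF d d, of u] by (simp add: inner_commute)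
  moreover have "fderiv (\<lambda>y. snd (local_map c y)) x = fderiv (\<lambda>y. 1 / sqrt 2) x"
    by (rule fderiv_cong_open[OF open_chart x]) (rule snd_local_map)
  then have "snd (fderiv (local_map c) x u) = 0"
    using fderiv_bounded_linear[OF bounded_linear_snd d] by simp
  ultimately show ?thesis by (simp add: unit_normal_def inner_diff_right inner_prod_def[of _ "(0, sqrt 2)"])
qed

lemma unit_normal_inner_self: "x \<in> coord c ` dom_chart c \<Longrightarrow> unit_normal c x \<bullet> unit_normal c x = 1"
  using local_map_unit[of x] snd_local_map[of x]
  by (simp add: unit_normal_def inner_diff_left inner_diff_right inner_commute inner_prod_def[of _ "(0, sqrt 2)"])

text \<open>Harmonicity in the small sphere is the tension formula with curvature 2; rewriting its
  normal vector through \<open>unit_normal\<close> gives the shape that the unit sphere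
  demands.\<close>

lemma laplacian_local_map:
  assumes x: "x \<in> coord c ` dom_chart c"
  shows "laplacian (metric M c) (local_map c) x + dpsi_normsq c x *\<^sub>R local_map c x = dpsi_normsq c x *\<^sub>R unit_normal c x"
proof -
  obtain p where p: "p \<in> dom_chart c" "x = coord c p" using x by blast
  have "p \<in> points M" using p riemannian_chartD(4)[OF riem c] by blast
  then obtain d :: "(('n \<times> real) \<times> real, 'n) chart"
    where d: "d \<in> submanifold_charts small_sphere_set" "\<psi> p \<in> dom_chart d" by (rule ex_small_chart)
  let ?W = "coord c ` {p \<in> dom_chart c. \<psi> p \<in> dom_chart d}"
  let ?F = "coord_expr c d \<psi>"
  interpret spherical_map "coord_inv d" "coord d ` dom_chart d" "\<lambda>z. (fst z, 0)" 2 ?W "metric M c" ?F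
    by (rule spherical_map_chart[OF riem c smooth_psi d(1) spherical_param_small_sphere[OF d(1)]]) simp
  have xW: "x \<in> ?W" using p d by blast
  have eq: "coord_inv d (?F y) = local_map c y" if "y \<in> ?W" for y
    using coord_expr_lift(1)[OF riem c d(1) that] by (simp add: local_map_def)
  have "coord_tension (metric M c) (induced_metric d) ?F x = 0"
    using harm c d p by (simp add: harmonic_map_def small_sphere_def submanifold_def)
  then have "laplacian (metric M c) \<Phi> x + deriv_normsq (metric M c) \<Phi> x *\<^sub>R \<nu> (?F x) = 0"
    using DP_tension[OF xW] linear_0[OF linear_DP[OF F_D[OF xW]]] by (simp add: induced_metric_eq)
  then have "laplacian (metric M c) (local_map c) x + dpsi_normsq c x *\<^sub>R \<nu> (?F x) = 0"
    using laplacian_cong[OF open_W xW eq] deriv_normsq_cong[OF open_W xW eq] by (simp add: dpsi_normsq_def)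
  \<comment> \<open>The first components agree with factor 2, and the last one vanishes because
    \<open>2 / sqrt 2 = sqrt 2\<close>.\<close>
  moreover have "\<nu> (?F x) = local_map c x - unit_normal c x"
    using snd_local_map[OF x] by (simp add: \<nu>_def eq[OF xW] unit_normal_def prod_eq_iff scaleR_2 real_div_sqrt)
  ultimately show ?thesis by (simp add: algebra_simps)
qed

lemma coord_energy_density_psi:
  fixes d :: "(('n \<times> real) \<times> real, 'n) chart"
  assumes d: "d \<in> submanifold_charts small_sphere_set" and p: "p \<in> dom_chart c" "\<psi> p \<in> dom_chart d"
  shows "coord_energy_density (metric M c) (induced_metric d) (coord_expr c d \<psi>) (coord c p) = 1/2 * dpsi_normsq c (coord c p)"
proof -
  let ?W = "coord c ` {p \<in> dom_chart c. \<psi> p \<in> dom_chart d}"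
  let ?F = "coord_expr c d \<psi>"
  interpret spherical_map "coord_inv d" "coord d ` dom_chart d" "\<lambda>z. (fst z, 0)" 2 ?W "metric M c" ?F
    by (rule spherical_map_chart[OF riem c smooth_psi d spherical_param_small_sphere[OF d]]) simp
  have xW: "coord c p \<in> ?W" using p by blast
  have eq: "coord_inv d (?F y) = local_map c y" if "y \<in> ?W" for y
    using coord_expr_lift(1)[OF riem c d that] by (simp add: local_map_def)
  show ?thesis
    using energy_density_eq[OF xW] deriv_normsq_cong[OF open_W xW eq] by (simp add: induced_metric_eq dpsi_normsq_def)
qed

end

section \<open>The same map with the unit sphere as target\<close>

lemma smooth_psi_unit: "smooth_map M (submanifold (sphere 0 1) :: (('n \<times> real) \<times> real, 'n \<times> real) riem_mfd) \<psi>"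
  by (rule smooth_map_submanifoldI[OF riem continuous_psi_unit])
    (rule smooth_local_map[unfolded local_map_def[abs_def]])

text \<open>All three claims are read off from the ambient images of the tension and bitension
  fields, since the derivative of the parametrisation is linear and injective.\<close>

lemma unit_sphere_tension_bitension:
  fixes d :: "(('n \<times> real) \<times> real, 'n \<times> real) chart"
  assumes c: "c \<in> atlas M" and d: "d \<in> submanifold_charts (sphere 0 1)"
    and p: "p \<in> dom_chart c" "\<psi> p \<in> dom_chart d"
  defines "\<tau> \<equiv> coord_tension (metric M c) (induced_metric d) (coord_expr c d \<psi>) (coord c p)"
    and "\<tau>2 \<equiv> coord_bitension (metric M c) (induced_metric d) (coord_expr c d \<psi>) (coord c p)"
  shows "\<tau> = 0 \<Longrightarrow> dpsi_normsq c (coord c p) = 0"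
    and "\<tau>2 = 0 \<Longrightarrow> laplacian (metric M c) (dpsi_normsq c) (coord c p) = 0"
    and "(\<And>x. x \<in> coord c ` dom_chart c \<Longrightarrow> dpsi_normsq c x = k) \<Longrightarrow> \<tau>2 = 0"
proof -
  let ?W = "coord c ` {p \<in> dom_chart c. \<psi> p \<in> dom_chart d}"
  let ?F = "coord_expr c d \<psi>"
  let ?x = "coord c p"
  interpret spherical_map "coord_inv d" "coord d ` dom_chart d" "\<lambda>z. z" 1 ?W "metric M c" ?F
    by (rule spherical_map_chart[OF riem c smooth_psi_unit d spherical_param_unit_sphere[OF d]]) simp
  have xW: "?x \<in> ?W" and xD: "?x \<in> coord c ` dom_chart c" using p by blast+
  have sub: "?W \<subseteq> coord c ` dom_chart c" by blast
  have eq: "coord_inv d (?F y) = local_map c y" if "y \<in> ?W" for y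
    using coord_expr_lift(1)[OF riem c d that] by (simp add: local_map_def)
  have D: "fderiv \<Phi> y = fderiv (local_map c) y" if "y \<in> ?W" for y by (rule fderiv_cong_open[OF open_W that eq])
  have nsq: "deriv_normsq (metric M c) \<Phi> y = dpsi_normsq c y" if "y \<in> ?W" for y
    using deriv_normsq_cong[OF open_W that eq] by (simp add: dpsi_normsq_def)
  have T: "laplacian (metric M c) \<Phi> y + dpsi_normsq c y *\<^sub>R \<Phi> y = dpsi_normsq c y *\<^sub>R unit_normal c y" if "y \<in> ?W" for y
    using laplacian_local_map[OF c subsetD[OF sub that]] laplacian_cong[OF open_W that eq] eq[OF that] by simp
  have H: "induced_metric d = H" by (simp add: induced_metric_eq)
  have \<tau>: "fderiv (coord_inv d) (?F ?x) \<tau> = dpsi_normsq c ?x *\<^sub>R unit_normal c ?x"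
    unfolding \<tau>_def H DP_tension[OF xW] using T[OF xW] nsq[OF xW] by (simp add: \<nu>_def)
  have nn: "unit_normal c ?x \<bullet> unit_normal c ?x = 1" by (rule unit_normal_inner_self[OF c xD])
  show "dpsi_normsq c ?x = 0" if "\<tau> = 0"
    using \<tau> nn linear_0[OF linear_DP[OF F_D[OF xW]]] that by auto
  let ?t1 = "metric_trace (metric M c) ?x (\<lambda>u v. fderiv (dpsi_normsq c) ?x v *\<^sub>R fderiv (local_map c) ?x u)"
  let ?t2 = "metric_trace (metric M c) ?x (\<lambda>u v. fderiv (dpsi_normsq c) ?x u *\<^sub>R fderiv (local_map c) ?x v)"
  have "fderiv (coord_inv d) (?F ?x) (coord_bitension (metric M c) H ?F ?x) =
      laplacian (metric M c) (dpsi_normsq c) ?x *\<^sub>R unit_normal c ?x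
     - metric_trace (metric M c) ?x (\<lambda>u v. fderiv (dpsi_normsq c) ?x v *\<^sub>R fderiv \<Phi> ?x u)
     - metric_trace (metric M c) ?x (\<lambda>u v. fderiv (dpsi_normsq c) ?x u *\<^sub>R fderiv \<Phi> ?x v)"
  proof (rule DP_bitension)
    show "smooth_on ?W (unit_normal c)" "smooth_on ?W (dpsi_normsq c)"
      using smooth_on_subset[OF smooth_unit_normal[OF c] sub] smooth_on_subset[OF smooth_dpsi_normsq[OF c] sub] by auto
    show "fderiv (unit_normal c) y u = - fderiv \<Phi> y u" if "y \<in> ?W" for y u
      using fderiv_unit_normal[OF c subsetD[OF sub that]] D[OF that] by simp
    show "fderiv \<Phi> y u \<bullet> unit_normal c y = 0" if "y \<in> ?W" for y u
      using fderiv_local_map_unit_normal[OF c subsetD[OF sub that]] D[OF that] by simp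
  qed (use nsq T xW in simp_all)
  then have \<tau>2: "fderiv (coord_inv d) (?F ?x) \<tau>2 = laplacian (metric M c) (dpsi_normsq c) ?x *\<^sub>R unit_normal c ?x - ?t1 - ?t2"
    unfolding \<tau>2_def H D[OF xW] .
  \<comment> \<open>Both gradient terms are tangent to the small sphere, so pairing with the unit
    normal isolates the Laplacian of q.\<close>
  have "?t1 \<bullet> unit_normal c ?x = 0" "?t2 \<bullet> unit_normal c ?x = 0"
    unfolding metric_trace_linear[OF linear_inner_left, symmetric]
    by (simp_all add: fderiv_local_map_unit_normal[OF c xD] metric_trace_def)
  then show "laplacian (metric M c) (dpsi_normsq c) ?x = 0" if "\<tau>2 = 0"
    using arg_cong[OF \<tau>2, of "\<lambda>z. z \<bullet> unit_normal c ?x"] that nn linear_0[OF linear_DP[OF F_D[OF xW]]]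
    by (simp add: inner_diff_left)
  assume const: "\<And>x. x \<in> coord c ` dom_chart c \<Longrightarrow> dpsi_normsq c x = k"
  have "fderiv (dpsi_normsq c) ?x = fderiv (\<lambda>_. k) ?x"
    by (rule fderiv_cong_open[OF open_chart[OF c] xD const])
  moreover have "laplacian (metric M c) (dpsi_normsq c) ?x = laplacian (metric M c) (\<lambda>_. k) ?x"
    by (rule laplacian_cong[OF open_chart[OF c] xD const])
  moreover have "laplacian (metric M c) (\<lambda>_. k) ?x = 0"
    by (simp add: laplacian_def hessian_def[abs_def] metric_trace_def)
  ultimately have "fderiv (coord_inv d) (?F ?x) \<tau>2 = 0"
    unfolding \<tau>2 by (simp add: metric_trace_def)
  then show "\<tau>2 = 0" using DP_eq_0[OF F_D[OF xW]] by simp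
qed

text \<open>Removes both choices made by \<open>chart_at\<close>: the target chart drops out in
  \<open>coord_energy_density_psi\<close>, the source chart by the invariance of the trace.\<close>

lemma energy_density_psi:
  assumes c: "c \<in> atlas M" and p: "p \<in> dom_chart c"
  shows "energy_density M (small_sphere :: (('n \<times> real) \<times> real, 'n) riem_mfd) \<psi> p = 1/2 * dpsi_normsq c (coord c p)"
proof -
  let ?N = "small_sphere :: (('n \<times> real) \<times> real, 'n) riem_mfd"
  have pM: "p \<in> points M" using p riemannian_chartD(4)[OF riem c] by blast
  let ?c = "chart_at M p" and ?d = "chart_at ?N (\<psi> p)"
  have "\<exists>d. d \<in> atlas ?N \<and> \<psi> p \<in> dom_chart d"
    using ex_small_chart[OF pM] by (metis small_sphere_def submanifold_def riem_mfd.select_convs(2))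
  note d = chart_at[OF this]
  have c': "?c \<in> atlas M" "p \<in> dom_chart ?c" using chart_at[of M p] c p by blast+
  have "energy_density M ?N \<psi> p = coord_energy_density (metric M ?c) (induced_metric ?d) (coord_expr ?c ?d \<psi>) (coord ?c p)"
    by (simp add: energy_density_def Let_def small_sphere_def submanifold_def)
  also have "\<dots> = 1/2 * dpsi_normsq ?c (coord ?c p)"
    by (rule coord_energy_density_psi[OF c'(1) _ c'(2) d(2)])
      (use d(1) in \<open>simp add: small_sphere_def submanifold_def\<close>)
  also have "dpsi_normsq ?c (coord ?c p) = dpsi_normsq c (coord c p)"
    using deriv_normsq_chart_independent[OF riem c' c p smooth_local_map[OF c, unfolded local_map_def[abs_def]]]
    by (simp add: dpsi_normsq_def local_map_def[abs_def])
  finally show ?thesis .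
qed

section \<open>From charts to the whole manifold\<close>

abbreviation energy :: "'p \<Rightarrow> real" where
  "energy \<equiv> energy_density M (small_sphere :: (('n \<times> real) \<times> real, 'n) riem_mfd) \<psi>"

lemma openin_energy_density:
  assumes "open V" shows "openin (mtop M) {p \<in> points M. energy p \<in> V}"
proof (subst openin_subopen, intro ballI)
  fix p assume p: "p \<in> {p \<in> points M. energy p \<in> V}"
  then obtain c where c: "c \<in> atlas M" "p \<in> dom_chart c" using riemannian_ex_chart[OF riem] by blast
  let ?U = "coord c ` dom_chart c \<inter> (\<lambda>x. 1/2 * dpsi_normsq c x) -` V"
  have "open ?U"
    by (intro continuous_open_preimage continuous_on_mult continuous_on_const
        smooth_on_continuous_on[OF smooth_dpsi_normsq[OF c(1)]] open_chart[OF c(1)] assms)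
  from openin_chart_preimage[OF riem c(1) this]
  have "openin (mtop M) {q \<in> dom_chart c. coord c q \<in> ?U}" .
  moreover have "{q \<in> dom_chart c. coord c q \<in> ?U} = {q \<in> dom_chart c. energy q \<in> V}"
  proof -
    have "energy q = 1/2 * dpsi_normsq c (coord c q)" if "q \<in> dom_chart c" for q
      by (rule energy_density_psi[OF c(1) that])
    then show ?thesis by (intro Collect_cong conj_cong refl) (simp only:, blast)
  qed
  ultimately show "\<exists>T. openin (mtop M) T \<and> p \<in> T \<and> T \<subseteq> {p \<in> points M. energy p \<in> V}"
    using p c(2) riemannian_chartD(4)[OF riem c(1)] by (intro exI[of _ "{q \<in> dom_chart c. energy q \<in> V}"]) auto
qed

text \<open>A vanishing squared norm forces a vanishing derivative, so the map is constant on
  coordinate balls; connectedness does the rest.\<close>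

lemma zero_dpsi_normsq_imp_constant:
  assumes conn: "connected_space (mtop M)"
    and zero: "\<And>c x. c \<in> atlas M \<Longrightarrow> x \<in> coord c ` dom_chart c \<Longrightarrow> dpsi_normsq c x = 0"
  shows "\<psi> constant_on points M"
proof (rule connected_locally_constant[OF conn])
  fix p assume "p \<in> points M"
  then obtain c where c: "c \<in> atlas M" "p \<in> dom_chart c" using riemannian_ex_chart[OF riem] by blast
  have x: "coord c p \<in> coord c ` dom_chart c" using c by blast
  obtain r where r: "r > 0" "ball (coord c p) r \<subseteq> coord c ` dom_chart c"
    using open_chart[OF c(1)] x by (meson open_contains_ball)
  have const: "local_map c y = local_map c (coord c p)" if y: "y \<in> ball (coord c p) r" for y
  proof (rule has_derivative_zero_unique[where f = "local_map c", OF convex_ball _ y])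
    fix z assume "z \<in> ball (coord c p) r"
    then have z: "z \<in> coord c ` dom_chart c" using r by blast
    have "deriv_normsq (metric M c) (local_map c) z = 0" using zero[OF c(1) z] by (simp add: dpsi_normsq_def)
    from coord_riemannian.deriv_normsq_nonneg(2)[OF coord_riemannian_c[OF c(1)] smooth_local_map[OF c(1)] z this]
    have "fderiv (local_map c) z = (\<lambda>h. 0)" by blast
    then show "(local_map c has_derivative (\<lambda>h. 0)) (at z within ball (coord c p) r)"
      using has_derivative_at_withinI[OF smooth_on_has_derivative[OF smooth_local_map[OF c(1)] z]] by simp
  qed (use r in simp)
  let ?U = "{q \<in> dom_chart c. coord c q \<in> ball (coord c p) r}"
  have "openin (mtop M) ?U" by (rule openin_chart_preimage[OF riem c(1) open_ball])
  moreover have "\<forall>q\<in>?U. \<psi> q = \<psi> p"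
  proof
    fix q assume "q \<in> ?U"
    then have "local_map c (coord c q) = local_map c (coord c p)" "q \<in> dom_chart c" using const by blast+
    then show "\<psi> q = \<psi> p" using local_map_coord[OF c(1)] c(2) by metis
  qed
  moreover have "p \<in> ?U" using c(2) r(1) by simp
  ultimately show "\<exists>U. openin (mtop M) U \<and> p \<in> U \<and> (\<forall>q\<in>U. \<psi> q = \<psi> p)" by blast
qed

text \<open>Compactness provides a maximum of the energy density. The set where it is attained is
  closed by continuity and open by the strong maximum principle, applied in a chart around each of
  its points.\<close>

lemma biharmonic_imp_constant_energy_density:
  assumes compact: "compact_space (mtop M)" and conn: "connected_space (mtop M)" and ne: "points M \<noteq> {}"
    and bi: "biharmonic_map M (unit_sphere :: (('n \<times> real) \<times> real, 'n \<times> real) riem_mfd) \<psi>"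
  shows "energy constant_on points M"
proof -
  have lap: "laplacian (metric M c) (dpsi_normsq c) x = 0" if c: "c \<in> atlas M" and x: "x \<in> coord c ` dom_chart c" for c x
  proof -
    obtain p where p: "p \<in> dom_chart c" "x = coord c p" using x by blast
    have "p \<in> points M" using p riemannian_chartD(4)[OF riem c] by blast
    then obtain d :: "(('n \<times> real) \<times> real, 'n \<times> real) chart"
      where d: "d \<in> submanifold_charts (sphere 0 1)" "\<psi> p \<in> dom_chart d" by (rule ex_unit_chart)
    have "coord_bitension (metric M c) (induced_metric d) (coord_expr c d \<psi>) (coord c p) = 0"
      using bi c d p by (simp add: biharmonic_map_def unit_sphere_def submanifold_def)
    then show ?thesis using unit_sphere_tension_bitension(2)[OF c d(1) p(1) d(2)] p(2) by simp
  qed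
  have cont: "continuous_map (mtop M) euclidean energy"
    unfolding continuous_map_def using openin_energy_density by auto
  have "compactin euclidean (energy ` points M)"
    by (rule image_compactin[OF _ cont]) (use compact in \<open>simp add: compact_space_def\<close>)
  then have "compact (energy ` points M)" by simp
  then obtain p0 where p0: "p0 \<in> points M" "\<And>p. p \<in> points M \<Longrightarrow> energy p \<le> energy p0"
    using compact_attains_sup[of "energy ` points M"] ne by auto
  define A where "A = {p \<in> points M. energy p = energy p0}"
  have "openin (mtop M) A"
  proof (subst openin_subopen, intro ballI)
    fix p assume pA: "p \<in> A"
    then obtain c where c: "c \<in> atlas M" "p \<in> dom_chart c" using riemannian_ex_chart[OF riem] by (auto simp: A_def)
    have x: "coord c p \<in> coord c ` dom_chart c" using c by blast
    have max: "dpsi_normsq c y \<le> dpsi_normsq c (coord c p)" if y: "y \<in> coord c ` dom_chart c" for y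
    proof -
      obtain q where q: "q \<in> dom_chart c" "y = coord c q" using y by blast
      have "energy q \<le> energy p" using p0(2)[of q] q(1) riemannian_chartD(4)[OF riem c(1)] pA by (auto simp: A_def)
      then show ?thesis using energy_density_psi[OF c(1) q(1)] energy_density_psi[OF c] q(2) by simp
    qed
    obtain S where S: "open S" "coord c p \<in> S" "\<forall>x\<in>S. dpsi_normsq c x = dpsi_normsq c (coord c p)"
      using coord_riemannian.strong_maximum_principle[OF coord_riemannian_c[OF c(1)] smooth_dpsi_normsq[OF c(1)] lap[OF c(1)] x max]
      by blast
    have "openin (mtop M) {q \<in> dom_chart c. coord c q \<in> S}" by (rule openin_chart_preimage[OF riem c(1) S(1)])
    moreover have "q \<in> A" if q: "q \<in> dom_chart c" "coord c q \<in> S" for q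
    proof -
      have "dpsi_normsq c (coord c q) = dpsi_normsq c (coord c p)" using S(3) q(2) by blast
      then have "energy q = energy p" using energy_density_psi[OF c(1) q(1)] energy_density_psi[OF c] by simp
      then show ?thesis using pA q(1) riemannian_chartD(4)[OF riem c(1)] by (auto simp: A_def)
    qed
    ultimately show "\<exists>T. openin (mtop M) T \<and> p \<in> T \<and> T \<subseteq> A"
      using c(2) S(2) by (intro exI[of _ "{q \<in> dom_chart c. coord c q \<in> S}"]) auto
  qed
  moreover have "closedin (mtop M) A"
  proof -
    have "points M - A = {p \<in> points M. energy p \<in> - {energy p0}}" by (auto simp: A_def)
    then show ?thesis using openin_energy_density[of "- {energy p0}"] by (auto simp: closedin_def A_def)
  qed
  ultimately have "A = points M"
    using conn p0(1) unfolding connected_space_clopen_in by (auto simp: A_def)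
  then show ?thesis unfolding constant_on_def A_def by blast
qed

lemma constant_energy_density_imp_biharmonic:
  assumes "energy constant_on points M"
  shows "biharmonic_map M (unit_sphere :: (('n \<times> real) \<times> real, 'n \<times> real) riem_mfd) \<psi>"
proof -
  obtain k where k: "\<And>p. p \<in> points M \<Longrightarrow> energy p = k" using assms by (auto simp: constant_on_def)
  have "coord_bitension (metric M c) (induced_metric d) (coord_expr c d \<psi>) (coord c p) = 0"
    if c: "c \<in> atlas M" and d: "d \<in> submanifold_charts (sphere 0 1)" and p: "p \<in> dom_chart c" "\<psi> p \<in> dom_chart d"
    for c p and d :: "(('n \<times> real) \<times> real, 'n \<times> real) chart"
  proof (rule unit_sphere_tension_bitension(3)[OF c d p])
    fix x assume "x \<in> coord c ` dom_chart c"
    then obtain q where q: "q \<in> dom_chart c" "x = coord c q" by blast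
    have "energy q = k" using k q(1) riemannian_chartD(4)[OF riem c] by blast
    then show "dpsi_normsq c x = 2 * k" using energy_density_psi[OF c q(1)] q(2) by simp
  qed
  then show ?thesis using smooth_psi_unit by (simp add: biharmonic_map_def unit_sphere_def submanifold_def)
qed

text \<open>The tension field in the unit sphere has image q times a unit vector, so it vanishes
  only together with q.\<close>

lemma harmonic_imp_constant:
  assumes conn: "connected_space (mtop M)"
    and h: "harmonic_map M (unit_sphere :: (('n \<times> real) \<times> real, 'n \<times> real) riem_mfd) \<psi>"
  shows "\<psi> constant_on points M"
proof (rule zero_dpsi_normsq_imp_constant[OF conn])
  fix c x assume c: "c \<in> atlas M" and x: "x \<in> coord c ` dom_chart c"
  obtain p where p: "p \<in> dom_chart c" "x = coord c p" using x by blast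
  have "p \<in> points M" using p riemannian_chartD(4)[OF riem c] by blast
  then obtain d :: "(('n \<times> real) \<times> real, 'n \<times> real) chart"
    where d: "d \<in> submanifold_charts (sphere 0 1)" "\<psi> p \<in> dom_chart d" by (rule ex_unit_chart)
  have "coord_tension (metric M c) (induced_metric d) (coord_expr c d \<psi>) (coord c p) = 0"
    using h c d p by (simp add: harmonic_map_def unit_sphere_def submanifold_def)
  then show "dpsi_normsq c x = 0" using unit_sphere_tension_bitension(1)[OF c d(1) p(1) d(2)] p(2) by simp
qed

end

theorem theorem1p4:
  fixes M :: "('p, 'm::euclidean_space) riem_mfd"
    and \<psi> :: "'p \<Rightarrow> ('n::euclidean_space \<times> real) \<times> real"
  assumes "riemannian_manifold M"
    and "compact_space (mtop M)"
    and "connected_space (mtop M)"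
    and "harmonic_map M (small_sphere :: (('n \<times> real) \<times> real, 'n) riem_mfd) \<psi>"
    and "\<not> \<psi> constant_on points M"
  defines "\<phi> \<equiv> small_sphere_inclusion \<circ> \<psi>"
  shows "(biharmonic_map M (unit_sphere :: (('n \<times> real) \<times> real, 'n \<times> real) riem_mfd) \<phi> \<and>
          \<not> harmonic_map M (unit_sphere :: (('n \<times> real) \<times> real, 'n \<times> real) riem_mfd) \<phi>)
         \<longleftrightarrow> energy_density M (small_sphere :: (('n \<times> real) \<times> real, 'n) riem_mfd) \<psi> constant_on points M"
proof -
  interpret harmonic_into_small_sphere M \<psi> using assms(1,4) by unfold_locales
  have "\<phi> = \<psi>" by (simp add: \<phi>_def small_sphere_inclusion_def comp_def)
  \<comment> \<open>On an empty set every map counts as constant, so nonconstancy excludes it; the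
    maximum of the energy density needs a point.\<close>
  moreover have "points M \<noteq> {}" using assms(5) by (auto simp: constant_on_def)
  ultimately show ?thesis
    using biharmonic_imp_constant_energy_density[OF assms(2,3)] constant_energy_density_imp_biharmonic
      harmonic_imp_constant[OF assms(3)] assms(5) by blast
qed

end
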